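(* Let $K$ be a field and let $G_1$ and $G_2$ be finite simple graphs on disjoint nonempty vertex sets, not both complete. Then $$\mathrm{reg}(J_{G_1*G_2})=\max\{\mathrm{reg}(J_{G_1}),\mathrm{reg}(J_{G_2}),3\}.$$
   Context: For a finite simple graph $G$ on a vertex set of size $n$, identified with $[n]$, let $S=K[x_1,\ldots,x_n,y_1,\ldots,y_n]$ (standard grading). The binomial edge ideal $J_G\subset S$ is generated by $f_{ij}=x_iy_j-x_jy_i$ for all $i<j$ with $\{i,j\}\in E(G)$. For a finitely generated graded $S$-module $M$, $\mathrm{reg}(M)=\max\{j-i:\beta_{i,j}(M)\neq 0\}$; if $G$ has no edges (so $J_G=0$) we use the convention $\mathrm{reg}(J_G)=\mathrm{reg}(S/J_G)+1=1$. The join $G_1*G_2$ of graphs on disjoint vertex sets $V_1,V_2$ has vertex set $V_1\cup V_2$ and edge set $E(G_1)\cup E(G_2)\cup\{\{v,w\}:v\in V_1,w\in V_2\}$. A one-vertex graph is complete. *)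

theory Defs
  imports Complex_Main "HOL-Library.Poly_Mapping"
begin

section \<open>Finite simple graphs\<close>

definition fin_simple_graph :: "'v set \<Rightarrow> 'v set set \<Rightarrow> bool" where
  "fin_simple_graph V E \<longleftrightarrow> finite V \<and> (\<forall>e\<in>E. e \<subseteq> V \<and> card e = 2)"

definition complete_graph :: "'v set \<Rightarrow> 'v set set \<Rightarrow> bool" where
  "complete_graph V E \<longleftrightarrow> (\<forall>u\<in>V. \<forall>v\<in>V. u \<noteq> v \<longrightarrow> {u, v} \<in> E)"

definition join_edges :: "'v set \<Rightarrow> 'v set set \<Rightarrow> 'v set \<Rightarrow> 'v set set \<Rightarrow> 'v set set" where
  "join_edges V1 E1 V2 E2 = E1 \<union> E2 \<union> {{v, w} |v w. v \<in> V1 \<and> w \<in> V2}"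


section \<open>Polynomial rings with the standard grading\<close>

text \<open>
  Polynomials with variables in the type \<open>'x\<close>: finitely supported maps from monomials
  (exponent vectors) to coefficients, with the convolution product. The ring \<open>K[A]\<close> for a
  set \<open>A\<close> of variables is a subset of this type.
\<close>

type_synonym ('x, 'k) mpoly = "('x \<Rightarrow>\<^sub>0 nat) \<Rightarrow>\<^sub>0 'k"

definition indet :: "'x \<Rightarrow> ('x, 'k::comm_ring_1) mpoly" where
  "indet x = Poly_Mapping.single (Poly_Mapping.single x 1) 1"

definition poly_ring :: "'x set \<Rightarrow> ('x, 'k::comm_ring_1) mpoly set" where
  "poly_ring A = {p. \<forall>m\<in>Poly_Mapping.keys p. Poly_Mapping.keys m \<subseteq> A}"

definition mon_degree :: "('x \<Rightarrow>\<^sub>0 nat) \<Rightarrow> nat" where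
  "mon_degree m = (\<Sum>x\<in>Poly_Mapping.keys m. Poly_Mapping.lookup m x)"

text \<open>\<open>homogeneous d\<close> contains \<open>0\<close> for every \<open>d\<close>, and nothing else when \<open>d < 0\<close>.\<close>

definition homogeneous :: "int \<Rightarrow> ('x, 'k::comm_ring_1) mpoly set" where
  "homogeneous d = {p. \<forall>m\<in>Poly_Mapping.keys p. int (mon_degree m) = d}"

definition irrelevant_ideal :: "'x set \<Rightarrow> ('x, 'k::comm_ring_1) mpoly set" where
  "irrelevant_ideal A = {p \<in> poly_ring A. Poly_Mapping.lookup p 0 = 0}"

definition ideal_gen :: "'x set \<Rightarrow> ('x, 'k::comm_ring_1) mpoly set \<Rightarrow> ('x, 'k) mpoly set" where
  "ideal_gen A B = {(\<Sum>b\<in>F. c b * b) |F c. finite F \<and> F \<subseteq> B \<and> (\<forall>b\<in>F. c b \<in> poly_ring A)}"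


section \<open>Minimal graded free resolutions, Betti numbers, regularity\<close>

text \<open>
  The free module of rank \<open>r\<close> over \<open>K[A]\<close>; elements are coordinate vectors indexed by
  \<open>{..<r}\<close>, extended by \<open>0\<close>.
\<close>

definition free_mod :: "'x set \<Rightarrow> nat \<Rightarrow> (nat \<Rightarrow> ('x, 'k::comm_ring_1) mpoly) set" where
  "free_mod A r = {u. (\<forall>k<r. u k \<in> poly_ring A) \<and> (\<forall>k\<ge>r. u k = 0)}"

text \<open>The linear map out of a free module of rank \<open>r\<close> sending the \<open>k\<close>-th basis vector to \<open>g k\<close>,
  respectively to the vector \<open>D k\<close> of another free module.\<close>

definition lin_map ::
  "(('x, 'k::comm_ring_1) mpoly \<Rightarrow> 'm \<Rightarrow> 'm) \<Rightarrow> nat \<Rightarrow> (nat \<Rightarrow> 'm::ab_group_add)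
    \<Rightarrow> (nat \<Rightarrow> ('x, 'k) mpoly) \<Rightarrow> 'm" where
  "lin_map scale r g u = (\<Sum>k<r. scale (u k) (g k))"

definition free_map ::
  "nat \<Rightarrow> (nat \<Rightarrow> nat \<Rightarrow> ('x, 'k::comm_ring_1) mpoly)
    \<Rightarrow> (nat \<Rightarrow> ('x, 'k) mpoly) \<Rightarrow> nat \<Rightarrow> ('x, 'k) mpoly" where
  "free_map r D u = (\<lambda>l. \<Sum>k<r. u k * D k l)"

text \<open>
  A graded \<open>K[A]\<close>-module is given by its scalar multiplication and its family
  \<open>M :: int \<Rightarrow> 'm set\<close> of homogeneous components; the module itself is the sum of the \<open>M d\<close>.

  A graded free resolution
  \<open>\<dots> \<rightarrow> F\<^sub>2 \<rightarrow> F\<^sub>1 \<rightarrow> F\<^sub>0 \<rightarrow> M \<rightarrow> 0\<close> by modules of finite rank consists of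
  \<^item> the lists \<open>ds i\<close> of the degrees of the basis elements of \<open>F\<^sub>i\<close>, that is,
    \<open>F\<^sub>i\<close> is the direct sum of the twists \<open>S(-j)\<close> for \<open>j\<close> in \<open>ds i\<close>;
  \<^item> the images \<open>g k\<close> in \<open>M\<close> of the basis elements of \<open>F\<^sub>0\<close>;
  \<^item> the images \<open>D i k\<close> in \<open>F\<^sub>i\<close> of the basis elements of \<open>F\<^bsub>i+1\<^esub>\<close>,
  all maps being homogeneous of degree \<open>0\<close>. Infinite length is permitted.
\<close>

definition graded_free_resolution ::
  "'x set \<Rightarrow> (('x, 'k::field) mpoly \<Rightarrow> 'm \<Rightarrow> 'm) \<Rightarrow> (int \<Rightarrow> 'm::ab_group_add set)
    \<Rightarrow> (nat \<Rightarrow> int list) \<Rightarrow> (nat \<Rightarrow> 'm) \<Rightarrow> (nat \<Rightarrow> nat \<Rightarrow> nat \<Rightarrow> ('x, 'k) mpoly) \<Rightarrow> bool" where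
  "graded_free_resolution A scale M ds g D \<longleftrightarrow>
    (let r = (\<lambda>i. length (ds i));
         F = (\<lambda>i. free_mod A (r i));
         \<epsilon> = lin_map scale (r 0) g;
         \<delta> = (\<lambda>i. free_map (r (Suc i)) (D i))
     in (\<forall>k<r 0. g k \<in> M (ds 0 ! k)) \<and>
        (\<forall>i. \<forall>k<r (Suc i). D i k \<in> F i \<and>
           (\<forall>l<r i. D i k l \<in> homogeneous (ds (Suc i) ! k - ds i ! l))) \<and>
        (\<forall>d. M d \<subseteq> \<epsilon> ` F 0) \<and>
        {u \<in> F 0. \<epsilon> u = 0} = \<delta> 0 ` F 1 \<and>
        (\<forall>i. {u \<in> F (Suc i). \<delta> i u = (\<lambda>l. 0)} = \<delta> (Suc i) ` F (Suc (Suc i))))"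

text \<open>Minimality: the image of \<open>F\<^bsub>i+1\<^esub>\<close> lies in the irrelevant ideal times \<open>F\<^sub>i\<close>.\<close>

definition minimal_graded_free_resolution ::
  "'x set \<Rightarrow> (('x, 'k::field) mpoly \<Rightarrow> 'm \<Rightarrow> 'm) \<Rightarrow> (int \<Rightarrow> 'm::ab_group_add set)
    \<Rightarrow> (nat \<Rightarrow> int list) \<Rightarrow> (nat \<Rightarrow> 'm) \<Rightarrow> (nat \<Rightarrow> nat \<Rightarrow> nat \<Rightarrow> ('x, 'k) mpoly) \<Rightarrow> bool" where
  "minimal_graded_free_resolution A scale M ds g D \<longleftrightarrow>
    graded_free_resolution A scale M ds g D \<and>
    (\<forall>i. \<forall>k<length (ds (Suc i)). \<forall>l<length (ds i). D i k l \<in> irrelevant_ideal A)"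

text \<open>
  For a finitely generated graded module over \<open>K[A]\<close> with \<open>A\<close> finite, minimal graded free
  resolutions exist and are unique up to isomorphism, so the choice is immaterial.
\<close>

definition betti ::
  "'x set \<Rightarrow> (('x, 'k::field) mpoly \<Rightarrow> 'm \<Rightarrow> 'm) \<Rightarrow> (int \<Rightarrow> 'm::ab_group_add set)
    \<Rightarrow> nat \<Rightarrow> int \<Rightarrow> nat" where
  "betti A scale M i j =
    count_list ((SOME ds. \<exists>g D. minimal_graded_free_resolution A scale M ds g D) i) j"

definition regularity ::
  "'x set \<Rightarrow> (('x, 'k::field) mpoly \<Rightarrow> 'm \<Rightarrow> 'm) \<Rightarrow> (int \<Rightarrow> 'm::ab_group_add set) \<Rightarrow> int" where
  "regularity A scale M = Max {j - int i |i j. betti A scale M i j \<noteq> 0}"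


section \<open>Binomial edge ideals\<close>

datatype 'v bvar = XVar 'v | YVar 'v

definition bei_vars :: "'v set \<Rightarrow> 'v bvar set" where
  "bei_vars V = XVar ` V \<union> YVar ` V"

definition edge_binomial :: "'v \<Rightarrow> 'v \<Rightarrow> ('v bvar, 'k::comm_ring_1) mpoly" where
  "edge_binomial i j = indet (XVar i) * indet (YVar j) - indet (XVar j) * indet (YVar i)"

text \<open>
  Vertices are not ordered: each edge \<open>{i, j}\<close> contributes both \<open>f\<^bsub>ij\<^esub>\<close> and
  \<open>f\<^bsub>ji\<^esub> = - f\<^bsub>ij\<^esub>\<close>, which generate the same ideal as either one.
\<close>

definition binomial_edge_ideal :: "'v set \<Rightarrow> 'v set set \<Rightarrow> ('v bvar, 'k::comm_ring_1) mpoly set" where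
  "binomial_edge_ideal V E = ideal_gen (bei_vars V) {edge_binomial i j |i j. {i, j} \<in> E}"

text \<open>
  \<open>reg(J\<^sub>G)\<close> over the field \<open>'k\<close>, with the convention \<open>reg(0) = 1\<close>; \<open>J\<^sub>G\<close> is the graded module
  whose component of degree \<open>d\<close> is the set of its homogeneous elements of degree \<open>d\<close>.
\<close>

definition bei_reg :: "'k::field itself \<Rightarrow> 'v set \<Rightarrow> 'v set set \<Rightarrow> int" where
  "bei_reg K V E =
    (if E = {} then 1
     else regularity (bei_vars V) (*)
            (\<lambda>d. (binomial_edge_ideal V E :: ('v bvar, 'k) mpoly set) \<inter> homogeneous d))"

end

theory Submission
  imports Defs "HOL-Library.Function_Algebras" "HOL-Library.Product_Plus"
begin

text \<open>
  Let \<open>V\<close> be the vertex set of the join, \<open>G\<^sub>1\<close> and \<open>G\<^sub>2\<close> the graphs on \<open>V\<^sub>1\<close> and \<open>V\<^sub>2\<close>, \<open>G\<close> their join, and write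
  \<open>J\<^sub>W\<close> for the ideal of the complete graph on \<open>W\<close>. The relations \<open>x\<^sub>w f\<^bsub>uv\<^esub> = x\<^sub>u f\<^bsub>wv\<^esub> - x\<^sub>v f\<^bsub>wu\<^esub>\<close> show that
  for \<open>u, v \<in> V\<^sub>1\<close> the class of \<open>f\<^bsub>uv\<^esub>\<close> modulo \<open>J\<^sub>G\<close> is killed by the variables of \<open>V\<^sub>2\<close>, and conversely; hence
  \<open>J\<^sub>V / J\<^sub>G\<close> is the direct sum of \<open>J\<^bsub>V\<^sub>1\<^esub> / J\<^bsub>G\<^sub>1\<^esub>\<close> and \<open>J\<^bsub>V\<^sub>2\<^esub> / J\<^bsub>G\<^sub>2\<^esub>\<close>, each killed by the variables of the other side.
  Killed variables do not change the regularity, and since every \<open>J\<^sub>W\<close> has regularity at most 2, the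
  exact sequences \<open>0 \<rightarrow> J\<^sub>G \<rightarrow> J\<^sub>V \<rightarrow> J\<^sub>V / J\<^sub>G \<rightarrow> 0\<close> for the three graphs give: for \<open>r \<ge> 3\<close>, the regularity of
  \<open>J\<^sub>G\<close> is at most \<open>r\<close> if and only if those of \<open>J\<^bsub>G\<^sub>1\<^esub>\<close> and \<open>J\<^bsub>G\<^sub>2\<^esub>\<close> are. It is not at most 2, because of the Koszul
  syzygy between the two edges of an induced path \<open>u - w - v\<close>. Graded Betti numbers are read off from Koszul
  homology, by dimension shifting along a minimal resolution.
\<close>

section \<open>Koszul homology\<close>

text \<open>\<open>betti\<close> reads off one minimal resolution picked by \<open>SOME\<close>. Two
  things must come before any use of it: minimal resolutions exist, which rests on finite generation
  of graded submodules, and the degrees occurring in them have a description independent of the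
  choice. Regularity only depends on which degrees occur, so Tor enters through its vanishing alone,
  and the theorem is reached as an equivalence of upper bounds \<open>r\<close>, from which the
  maximum is read off.

  The constant 3: J_W has no Tor_i in degrees above i + 2. Passing from J_G to J_V / J_G lowers the
  bound from r to r - 1, and r - 1 must still be at least 2 for J_V to be invisible.

  The bound 2 for a complete graph comes from the map x_v -> s z_v, y_v -> t z_v with kernel J_W:
  membership becomes vanishing of sums of coefficients over classes of monomials, and adding a
  variable or taking a colon only changes a set of classes. The direct sum decomposition of J_V /
  J_G is expressed by the two projections that set the variables of one side to zero.\<close>

definition koszul_sign :: "('x \<Rightarrow> nat) \<Rightarrow> 'x \<Rightarrow> 'x set \<Rightarrow> 'm::ab_group_add \<Rightarrow> 'm" where
  "koszul_sign ord a T u = (if even (card {b \<in> T. ord b < ord a}) then u else - u)"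

text \<open>A function \<open>u\<close> holds the coefficients of the chain sum_T u(T) e_T;
  collecting those of the boundary at e_T turns the usual deletion of an element into insertion.
  Values at sets of the wrong size are left unconstrained by \<open>koszul_chains\<close>, so one
  operator serves all homological degrees.\<close>

definition koszul_bd ::
  "'x set \<Rightarrow> ('x \<Rightarrow> nat) \<Rightarrow> ('x \<Rightarrow> 'm \<Rightarrow> 'm::ab_group_add) \<Rightarrow> ('x set \<Rightarrow> 'm) \<Rightarrow> 'x set \<Rightarrow> 'm" where
  "koszul_bd A ord X u T = (\<Sum>a\<in>A - T. koszul_sign ord a T (X a (u (insert a T))))"

text \<open>
  Modules are given by their families of homogeneous components, and \<open>koszul_vanishes A ord X M N i j\<close> says that
  the Koszul homology of the quotient \<open>M / N\<close> in homological degree \<open>i\<close> and internal degree \<open>j\<close>, that is,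
  \<open>Tor\<^sub>i(M / N, K)\<^sub>j\<close>, is zero. Pairs of families replace quotient modules. Chains of homological degree \<open>i\<close>
  are indexed by the \<open>i\<close>-element sets of variables, and \<open>ord\<close> fixes the signs.
\<close>

definition koszul_chains :: "'x set \<Rightarrow> (int \<Rightarrow> 'm set) \<Rightarrow> int \<Rightarrow> int \<Rightarrow> ('x set \<Rightarrow> 'm) set" where
  "koszul_chains A M i j = {u. \<forall>T\<subseteq>A. int (card T) = i \<longrightarrow> u T \<in> M (j - i)}"

definition koszul_vanishes ::
  "'x set \<Rightarrow> ('x \<Rightarrow> nat) \<Rightarrow> ('x \<Rightarrow> 'm \<Rightarrow> 'm::ab_group_add) \<Rightarrow> (int \<Rightarrow> 'm set) \<Rightarrow> (int \<Rightarrow> 'm set)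
    \<Rightarrow> int \<Rightarrow> int \<Rightarrow> bool" where
  "koszul_vanishes A ord X M N i j \<longleftrightarrow>
    (\<forall>u\<in>koszul_chains A M i j. koszul_bd A ord X u \<in> koszul_chains A N (i - 1) j \<longrightarrow>
      (\<exists>v\<in>koszul_chains A M (i + 1) j. u - koszul_bd A ord X v \<in> koszul_chains A N i j))"

definition graded_family :: "'x set \<Rightarrow> ('x \<Rightarrow> 'm \<Rightarrow> 'm::ab_group_add) \<Rightarrow> (int \<Rightarrow> 'm set) \<Rightarrow> bool" where
  "graded_family A X M \<longleftrightarrow>
    (\<forall>d. 0 \<in> M d \<and> (\<forall>u\<in>M d. \<forall>v\<in>M d. u - v \<in> M d) \<and> (\<forall>a\<in>A. \<forall>u\<in>M d. X a u \<in> M (d + 1)))"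

lemma graded_familyI:
  assumes "\<And>d. 0 \<in> M d" and "\<And>d u v. u \<in> M d \<Longrightarrow> v \<in> M d \<Longrightarrow> u - v \<in> M d"
    and "\<And>d a u. a \<in> A \<Longrightarrow> u \<in> M d \<Longrightarrow> X a u \<in> M (d + 1)"
  shows "graded_family A X M"
  using assms unfolding graded_family_def by blast

context
  fixes A X and M :: "int \<Rightarrow> 'm::ab_group_add set"
  assumes M: "graded_family A X M"
begin

lemma graded_zero: "0 \<in> M d"
  using M unfolding graded_family_def by blast

lemma graded_diff: "u \<in> M d \<Longrightarrow> v \<in> M d \<Longrightarrow> u - v \<in> M d"
  using M unfolding graded_family_def by blast

lemma graded_minus: "u \<in> M d \<Longrightarrow> - u \<in> M d"
  using graded_diff[OF graded_zero] by force

lemma graded_add: "u \<in> M d \<Longrightarrow> v \<in> M d \<Longrightarrow> u + v \<in> M d"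
  using graded_diff[of u d "- v"] graded_minus[of v d] by simp

lemma graded_op: "a \<in> A \<Longrightarrow> u \<in> M d \<Longrightarrow> X a u \<in> M (d + 1)"
  using M unfolding graded_family_def by blast

lemma graded_sum: "(\<And>k. k \<in> I \<Longrightarrow> f k \<in> M d) \<Longrightarrow> sum f I \<in> M d"
  by (induction I rule: infinite_finite_induct) (auto intro: graded_zero graded_add)

lemma graded_sign: "u \<in> M d \<Longrightarrow> koszul_sign ord a T u \<in> M d"
  unfolding koszul_sign_def by (auto intro: graded_minus)

lemma graded_chains_diff:
  "u \<in> koszul_chains A M i j \<Longrightarrow> v \<in> koszul_chains A M i j \<Longrightarrow> u - v \<in> koszul_chains A M i j"
  unfolding koszul_chains_def by (auto intro: graded_diff)

lemma graded_chains_add: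
  "u \<in> koszul_chains A M i j \<Longrightarrow> v \<in> koszul_chains A M i j \<Longrightarrow> u + v \<in> koszul_chains A M i j"
  unfolding koszul_chains_def by (auto intro: graded_add)

lemma graded_chains_bd:
  assumes "finite A" and u: "u \<in> koszul_chains A M (i + 1) j"
  shows "koszul_bd A ord X u \<in> koszul_chains A M i j"
proof -
  have "koszul_bd A ord X u T \<in> M (j - i)" if T: "T \<subseteq> A" "int (card T) = i" for T
    unfolding koszul_bd_def
  proof (intro graded_sum graded_sign)
    fix a assume a: "a \<in> A - T"
    have "finite T" using T assms(1) finite_subset by blast
    then have "int (card (insert a T)) = i + 1" using a T by simp
    then have "u (insert a T) \<in> M (j - (i + 1))"
      using u a T unfolding koszul_chains_def by blast
    from graded_op[OF _ this, of a] a show "X a (u (insert a T)) \<in> M (j - i)"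
      by simp
  qed
  then show ?thesis unfolding koszul_chains_def by blast
qed

end

lemma koszul_chains_mono: "(\<And>d. M d \<subseteq> N d) \<Longrightarrow> u \<in> koszul_chains A M i j \<Longrightarrow> u \<in> koszul_chains A N i j"
  unfolding koszul_chains_def by blast

text \<open>Exchanging the two summations only shows that twice the sum is zero, which says nothing
  in characteristic 2; the induction on \<open>B\<close> cancels each pair separately.\<close>

lemma antisymmetric_sum_zero:
  fixes w :: "'x \<Rightarrow> 'x \<Rightarrow> 'm::ab_group_add"
  assumes "finite B" and "\<And>a b. a \<in> B \<Longrightarrow> b \<in> B \<Longrightarrow> a \<noteq> b \<Longrightarrow> w a b = - w b a"
  shows "(\<Sum>a\<in>B. \<Sum>b\<in>B - {a}. w a b) = 0"
  using assms
proof (induction B)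
  case (insert c B)
  have "(\<Sum>b\<in>insert c B - {a}. w a b) = w a c + (\<Sum>b\<in>B - {a}. w a b)" if "a \<in> B" for a
  proof -
    have "insert c B - {a} = insert c (B - {a})" using that insert.hyps by blast
    then show ?thesis using insert.hyps by simp
  qed
  then have "(\<Sum>a\<in>B. \<Sum>b\<in>insert c B - {a}. w a b)
      = (\<Sum>a\<in>B. w a c) + (\<Sum>a\<in>B. \<Sum>b\<in>B - {a}. w a b)"
    by (simp add: sum.distrib)
  moreover have "(\<Sum>a\<in>B. \<Sum>b\<in>B - {a}. w a b) = 0"
    using insert by blast
  moreover have "(\<Sum>a\<in>B. w a c) = - (\<Sum>a\<in>B. w c a)"
    unfolding sum_negf[symmetric]
  proof (intro sum.cong refl)
    fix a assume "a \<in> B"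
    then show "w a c = - w c a" using insert.hyps by (intro insert.prems) auto
  qed
  moreover have "insert c B - {c} = B" using insert.hyps by blast
  ultimately show ?case using insert.hyps by simp
qed simp

locale koszul =
  fixes A :: "'x set" and ord :: "'x \<Rightarrow> nat" and X :: "'x \<Rightarrow> 'm::ab_group_add \<Rightarrow> 'm"
  assumes finite_A: "finite A" and inj_ord: "inj_on ord A"
    and X_add: "X a (u + v) = X a u + X a v"
    and X_commute: "X a (X b u) = X b (X a u)"
begin

abbreviation sgn_at :: "'x \<Rightarrow> 'x set \<Rightarrow> 'm \<Rightarrow> 'm" where "sgn_at \<equiv> koszul_sign ord"
abbreviation "bd \<equiv> koszul_bd A ord X"
abbreviation "kchains \<equiv> koszul_chains A"
abbreviation "vanishes \<equiv> koszul_vanishes A ord X"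
abbreviation "graded \<equiv> graded_family A X"

lemma X_zero [simp]: "X a 0 = 0"
  using X_add[of a 0 0] by simp

lemma X_minus: "X a (- u) = - X a u"
  using X_add[of a u "- u"] by (simp add: eq_neg_iff_add_eq_0 add.commute)

lemma X_sum: "X a (sum f I) = (\<Sum>k\<in>I. X a (f k))"
  by (induction I rule: infinite_finite_induct) (auto simp: X_add)

lemma X_sign: "X a (sgn_at b T u) = sgn_at b T (X a u)"
  unfolding koszul_sign_def by (simp add: X_minus)

lemma sign_add: "sgn_at b T (u + v) = sgn_at b T u + sgn_at b T v"
  unfolding koszul_sign_def by simp

lemma sign_sum: "sgn_at b T (sum f I) = (\<Sum>k\<in>I. sgn_at b T (f k))"
  unfolding koszul_sign_def by (simp add: sum_negf)

lemma sign_sign [simp]: "sgn_at b T (sgn_at b T u) = u"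
  unfolding koszul_sign_def by simp

lemma bd_add: "bd (u + v) = bd u + bd v"
  unfolding koszul_bd_def by (simp add: fun_eq_iff X_add sign_add sum.distrib)

lemma bd_minus: "bd (- u) = - bd u"
proof -
  have "bd (- u) + bd u = bd 0"
    unfolding bd_add[symmetric] by simp
  moreover have "bd 0 = 0"
    unfolding koszul_bd_def by (simp add: fun_eq_iff koszul_sign_def cong: if_cong)
  ultimately show ?thesis by (simp add: eq_neg_iff_add_eq_0)
qed

lemma bd_diff: "bd (u - v) = bd u - bd v"
  using bd_add[of u "- v"] bd_minus[of v] by simp

text \<open>Of \<open>a\<close> and \<open>b\<close> exactly one precedes the other, so exactly one
  of the two counts of predecessors grows when the other element is inserted.\<close>

lemma sign_flip:
  assumes "T \<subseteq> A" "a \<in> A" "b \<in> A" "a \<notin> T" "b \<notin> T" "a \<noteq> b"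
  shows "sgn_at a T (sgn_at b (insert a T) u) = - sgn_at b T (sgn_at a (insert b T) u)"
proof -
  have fin: "finite {c \<in> T. P c}" for P
    using assms(1) finite_A by (simp add: finite_subset)
  have sgn_insert: "sgn_at b (insert a T) x = (if ord a < ord b then - sgn_at b T x else sgn_at b T x)"
    if "a \<notin> T" for a b and x :: 'm
  proof -
    have "{c \<in> insert a T. ord c < ord b}
        = (if ord a < ord b then insert a {c \<in> T. ord c < ord b} else {c \<in> T. ord c < ord b})"
      by auto
    then show ?thesis using fin that unfolding koszul_sign_def by auto
  qed
  have "ord a < ord b \<or> ord b < ord a"
    using inj_onD[OF inj_ord] assms by (meson linorder_neqE_nat)
  then show ?thesis
    unfolding sgn_insert[OF assms(4)] sgn_insert[OF assms(5)] by (auto simp: koszul_sign_def)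
qed

lemma bd_bd:
  assumes "T \<subseteq> A"
  shows "bd (bd u) T = 0"
proof -
  let ?w = "\<lambda>a b. sgn_at a T (sgn_at b (insert a T) (X a (X b (u (insert b (insert a T))))))"
  have diff: "A - insert a T = (A - T) - {a}" for a by blast
  have "bd (bd u) T = (\<Sum>a\<in>A - T. \<Sum>b\<in>(A - T) - {a}. ?w a b)"
    unfolding koszul_bd_def diff by (simp only: X_sum X_sign sign_sum)
  also have "\<dots> = 0"
  proof (rule antisymmetric_sum_zero)
    show "finite (A - T)" using finite_A by blast
    fix a b assume "a \<in> A - T" "b \<in> A - T" "a \<noteq> b"
    then show "?w a b = - ?w b a"
      using sign_flip[of T a b] assms X_commute[of a b] by (simp add: insert_commute)
  qed
  finally show ?thesis .
qed

lemma bd_bd_chains: "graded L \<Longrightarrow> bd (bd u) \<in> kchains L i j"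
  unfolding koszul_chains_def by (auto simp: bd_bd graded_zero)

lemma vanishesI:
  assumes "\<And>u. u \<in> kchains M i j \<Longrightarrow> bd u \<in> kchains N (i - 1) j \<Longrightarrow>
    \<exists>v\<in>kchains M (i + 1) j. u - bd v \<in> kchains N i j"
  shows "vanishes M N i j"
  using assms unfolding koszul_vanishes_def by blast

lemma vanishesE:
  assumes "vanishes M N i j" "u \<in> kchains M i j" "bd u \<in> kchains N (i - 1) j"
  obtains v where "v \<in> kchains M (i + 1) j" "u - bd v \<in> kchains N i j"
  using assms unfolding koszul_vanishes_def by blast

lemma vanishes_negative: "graded M \<Longrightarrow> i < 0 \<Longrightarrow> vanishes M N i j"
  by (rule vanishesI, rule bexI[of _ 0]) (auto simp: koszul_chains_def graded_zero)

section \<open>Pieces of the long exact sequence of 0 -> N/L -> M/L -> M/N -> 0\<close>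

context
  fixes L N M
  assumes L: "graded L" and N: "graded N" and M: "graded M"
    and LN: "\<And>d. L d \<subseteq> N d" and NM: "\<And>d. N d \<subseteq> M d"
begin

text \<open>Tor_i(M/L) -> Tor_i(M/N) -> Tor_{i-1}(N/L): the boundary of a cycle modulo
  \<open>N\<close> is a cycle of N/L, and subtracting a chain \<open>w\<close> that bounds it turns
  \<open>u\<close> into a cycle modulo \<open>L\<close>.\<close>

lemma vanishes_quotient:
  assumes "vanishes M L i j" "vanishes N L (i - 1) j"
  shows "vanishes M N i j"
proof (rule vanishesI)
  fix u assume u: "u \<in> kchains M i j" and bdu: "bd u \<in> kchains N (i - 1) j"
  obtain w where w: "w \<in> kchains N i j" "bd u - bd w \<in> kchains L (i - 1) j"
    using vanishesE[OF assms(2) bdu bd_bd_chains[OF L]] by auto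
  have "u - w \<in> kchains M i j"
    using graded_chains_diff[OF M u] koszul_chains_mono[OF NM w(1)] by blast
  moreover have "bd (u - w) \<in> kchains L (i - 1) j"
    using w(2) by (simp add: bd_diff)
  ultimately obtain v where v: "v \<in> kchains M (i + 1) j" "u - w - bd v \<in> kchains L i j"
    using vanishesE[OF assms(1)] by blast
  have "(u - w - bd v) + w \<in> kchains N i j"
    using graded_chains_add[OF N koszul_chains_mono[OF LN v(2)] w(1)] .
  then have "u - bd v \<in> kchains N i j" by (simp add: algebra_simps)
  with v(1) show "\<exists>v\<in>kchains M (i + 1) j. u - bd v \<in> kchains N i j" by blast
qed

text \<open>Tor_i(N/L) -> Tor_i(M/L) -> Tor_i(M/N): a cycle is moved into \<open>N\<close> by a
  boundary and then bounded there.\<close>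

lemma vanishes_extension:
  assumes "vanishes N L i j" "vanishes M N i j"
  shows "vanishes M L i j"
proof (rule vanishesI)
  fix u assume u: "u \<in> kchains M i j" and bdu: "bd u \<in> kchains L (i - 1) j"
  obtain v where v: "v \<in> kchains M (i + 1) j" "u - bd v \<in> kchains N i j"
    using vanishesE[OF assms(2) u koszul_chains_mono[OF LN bdu]] by blast
  have "bd (u - bd v) \<in> kchains L (i - 1) j"
    unfolding bd_diff using graded_chains_diff[OF L bdu bd_bd_chains[OF L]] .
  then obtain w where w: "w \<in> kchains N (i + 1) j" "u - bd v - bd w \<in> kchains L i j"
    using vanishesE[OF assms(1) v(2)] by blast
  have "v + w \<in> kchains M (i + 1) j"
    using graded_chains_add[OF M v(1) koszul_chains_mono[OF NM w(1)]] .
  moreover have "u - bd (v + w) \<in> kchains L i j"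
    using w(2) by (simp add: bd_add algebra_simps)
  ultimately show "\<exists>v\<in>kchains M (i + 1) j. u - bd v \<in> kchains L i j" by blast
qed

text \<open>Tor_{i+1}(M/N) -> Tor_i(N/L) -> Tor_i(M/L): a chain \<open>v\<close> of \<open>M\<close>
  that bounds the cycle is itself a cycle modulo \<open>N\<close>, so some \<open>v - bd w\<close>
  lies in \<open>N\<close>, and it has the same boundary.\<close>

lemma vanishes_sub:
  assumes "vanishes M L i j" "vanishes M N (i + 1) j"
  shows "vanishes N L i j"
proof (rule vanishesI)
  fix u assume u: "u \<in> kchains N i j" and bdu: "bd u \<in> kchains L (i - 1) j"
  obtain v where v: "v \<in> kchains M (i + 1) j" "u - bd v \<in> kchains L i j"
    using vanishesE[OF assms(1) koszul_chains_mono[OF NM u] bdu] by blast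
  have "u - (u - bd v) \<in> kchains N i j"
    by (rule graded_chains_diff[OF N u koszul_chains_mono[OF LN v(2)]])
  then have "bd v \<in> kchains N (i + 1 - 1) j" by simp
  then obtain w where w: "w \<in> kchains M (i + 1 + 1) j" "v - bd w \<in> kchains N (i + 1) j"
    using vanishesE[OF assms(2) v(1)] by blast
  have "bd (bd w) \<in> kchains L i j" by (rule bd_bd_chains[OF L])
  from graded_chains_add[OF L v(2) this]
  have "u - bd (v - bd w) \<in> kchains L i j"
    unfolding bd_diff by (simp add: algebra_simps)
  with w(2) show "\<exists>v\<in>kchains N (i + 1) j. u - bd v \<in> kchains L i j" by blast
qed

end

text \<open>Multiplication by a variable is null-homotopic on the Koszul complex.\<close>

definition wedge :: "'x \<Rightarrow> ('x set \<Rightarrow> 'm) \<Rightarrow> 'x set \<Rightarrow> 'm" where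
  "wedge a u T = (if a \<in> T then sgn_at a (T - {a}) (u (T - {a})) else 0)"

lemma sign_zero [simp]: "sgn_at b T 0 = 0"
  unfolding koszul_sign_def by simp

lemma wedge_homotopy:
  assumes a: "a \<in> A" and T: "T \<subseteq> A"
  shows "bd (wedge a u) T + wedge a (bd u) T = X a (u T)"
proof (cases "a \<in> T")
  case False
  \<comment> \<open>\<open>wedge a u\<close> is supported on sets containing \<open>a\<close>, so
    only \<open>b = a\<close> contributes.\<close>
  have "bd (wedge a u) T
      = (\<Sum>b\<in>A - T. if b = a then X a (u T) else 0)"
    unfolding koszul_bd_def
  proof (rule sum.cong)
    fix b assume "b \<in> A - T"
    show "sgn_at b T (X b (wedge a u (insert b T))) = (if b = a then X a (u T) else 0)"
      using False by (cases "b = a") (auto simp: wedge_def X_sign)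
  qed simp
  also have "\<dots> = X a (u T)"
    using a False finite_A by simp
  finally show ?thesis using False by (simp add: wedge_def)
next
  case True
  define S where "S = T - {a}"
  have S: "S \<subseteq> A" "a \<notin> S" "T = insert a S" using True T unfolding S_def by blast+
  have "wedge a (bd u) T
    = (\<Sum>b\<in>A - S. sgn_at a S (sgn_at b S (X b (u (insert b S)))))"
    using True by (simp add: wedge_def S_def[symmetric] koszul_bd_def sign_sum)
  also have "\<dots> = X a (u T) + (\<Sum>b\<in>(A - S) - {a}. sgn_at a S (sgn_at b S (X b (u (insert b S)))))"
    using a S finite_A by (subst sum.remove[of _ a]) auto
  \<comment> \<open>The two families of terms with \<open>b \<noteq> a\<close> cancel by
    \<open>sign_flip\<close>.\<close>
  also have "(\<Sum>b\<in>(A - S) - {a}. sgn_at a S (sgn_at b S (X b (u (insert b S))))) = - bd (wedge a u) T"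
    unfolding koszul_bd_def sum_negf[symmetric]
  proof (rule sum.cong)
    show "A - S - {a} = A - T" using S by blast
    fix b assume b: "b \<in> A - T"
    let ?y = "X b (u (insert b S))"
    have diff: "insert b T - {a} = insert b S" using b S by blast
    have "sgn_at b T (X b (wedge a u (insert b T))) = sgn_at b (insert a S) (sgn_at a (insert b S) ?y)"
      using True by (simp add: wedge_def X_sign diff S(3)[symmetric])
    also have "\<dots> = sgn_at a S (sgn_at a S (sgn_at b (insert a S) (sgn_at a (insert b S) ?y)))"
      by simp
    also have "sgn_at a S (sgn_at b (insert a S) (sgn_at a (insert b S) ?y)) =
       - sgn_at b S (sgn_at a (insert b S) (sgn_at a (insert b S) ?y))"
      by (rule sign_flip) (use S a b in auto)
    finally show "sgn_at a S (sgn_at b S ?y) = - sgn_at b T (X b (wedge a u (insert b T)))"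
      by (simp add: koszul_sign_def)
  qed
  finally show ?thesis by (simp add: algebra_simps)
qed

lemma wedge_chains:
  assumes "graded M" and "u \<in> kchains M i (j - 1)"
  shows "wedge a u \<in> kchains M (i + 1) j"
proof -
  have "wedge a u T \<in> M (j - (i + 1))" if T: "T \<subseteq> A" "int (card T) = i + 1" for T
  proof (cases "a \<in> T")
    case True
    have "finite T" using T finite_A finite_subset by blast
    then have "int (card (T - {a})) = i" using T True card_Suc_Diff1[of T a] by linarith
    then have "u (T - {a}) \<in> M (j - 1 - i)" using assms(2) T unfolding koszul_chains_def by blast
    then have "u (T - {a}) \<in> M (j - (i + 1))" by (simp add: algebra_simps)
    then show ?thesis using True by (simp add: wedge_def graded_sign[OF assms(1)])
  qed (simp add: wedge_def graded_zero[OF assms(1)])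
  then show ?thesis unfolding koszul_chains_def by blast
qed

text \<open>\<open>N'\<close> plays the part of N + x_a M. In the long exact sequence of 0 ->
  M/N(-1) -> M/N -> M/N' -> 0 the maps induced by x_a are zero, as x_a is null-homotopic, so
  Tor_i(M/N) embeds into Tor_i(M/N').\<close>

lemma vanishes_regular:
  assumes M: "graded M" and N: "graded N" and NM: "\<And>d. N d \<subseteq> M d" and a: "a \<in> A"
    and regular: "\<And>d p. p \<in> M d \<Longrightarrow> X a p \<in> N (d + 1) \<Longrightarrow> p \<in> N d"
    and N': "\<And>d p. p \<in> N' d \<Longrightarrow> \<exists>n\<in>N d. \<exists>q\<in>M (d - 1). p = n + X a q"
    and NN': "\<And>d. N d \<subseteq> N' d"
    and van: "vanishes M N' i j"
  shows "vanishes M N i j"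
proof (rule vanishesI)
  fix u assume u: "u \<in> kchains M i j" and bdu: "bd u \<in> kchains N (i - 1) j"
  obtain v where v: "v \<in> kchains M (i + 1) j" "u - bd v \<in> kchains N' i j"
    using vanishesE[OF van u koszul_chains_mono[OF NN' bdu]] by blast
  have "\<exists>n q. n \<in> N (j - i) \<and> q \<in> M (j - i - 1) \<and> (u - bd v) T = n + X a q"
    if "T \<subseteq> A" "int (card T) = i" for T
    using N'[of "(u - bd v) T" "j - i"] v(2) that unfolding koszul_chains_def by blast
  then obtain n w where nw: "\<And>T. T \<subseteq> A \<Longrightarrow> int (card T) = i \<Longrightarrow>
      n T \<in> N (j - i) \<and> w T \<in> M (j - i - 1) \<and> (u - bd v) T = n T + X a (w T)"
    by metis
  have n: "n \<in> kchains N i j" using nw unfolding koszul_chains_def by blast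
  have w: "w \<in> kchains M i (j - 1)" using nw unfolding koszul_chains_def by (auto simp: algebra_simps)
  \<comment> \<open>\<open>w\<close> is a cycle modulo \<open>N\<close>: x_a times its boundary is
    the boundary of \<open>u - bd v - n\<close>, which lies in \<open>N\<close>, and x_a is
    regular.\<close>
  have bdw: "bd w \<in> kchains N (i - 1) (j - 1)"
  proof -
    have "bd w T \<in> N (j - 1 - (i - 1))" if T: "T \<subseteq> A" "int (card T) = i - 1" for T
    proof (rule regular)
      show "bd w T \<in> M (j - 1 - (i - 1))"
        using graded_chains_bd[OF M finite_A, of w "i - 1" "j - 1"] w T by (auto simp: koszul_chains_def)
      have fT: "finite T" using T finite_A finite_subset by blast
      have "X a (bd w T) = (\<Sum>b\<in>A - T. sgn_at b T (X b (X a (w (insert b T)))))"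
        unfolding koszul_bd_def by (simp add: X_sum X_sign X_commute[of a])
      also have "\<dots> = bd (u - bd v - n) T"
        unfolding koszul_bd_def[of A ord X "u - bd v - n"]
      proof (rule sum.cong)
        fix b assume b: "b \<in> A - T"
        then have "(u - bd v) (insert b T) = n (insert b T) + X a (w (insert b T))"
          using nw[of "insert b T"] T fT by auto
        then show "sgn_at b T (X b (X a (w (insert b T))))
            = sgn_at b T (X b ((u - bd v - n) (insert b T)))" by simp
      qed simp
      also have "\<dots> \<in> N (j - (i - 1))"
      proof -
        have "bd (u - bd v - n) \<in> kchains N (i - 1) j"
          unfolding bd_diff
          using graded_chains_diff[OF N graded_chains_diff[OF N bdu bd_bd_chains[OF N]]
              graded_chains_bd[OF N finite_A, of n "i - 1" j]] n by simp
        then show ?thesis using T by (auto simp: koszul_chains_def)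
      qed
      finally show "X a (bd w T) \<in> N (j - 1 - (i - 1) + 1)" by (simp add: algebra_simps)
    qed
    then show ?thesis unfolding koszul_chains_def by blast
  qed
  have "v + wedge a w \<in> kchains M (i + 1) j"
    using graded_chains_add[OF M v(1) wedge_chains[OF M w]] .
  \<comment> \<open>By the homotopy, x_a w is \<open>bd (wedge a w) + wedge a (bd w)\<close>, and
    the second summand lies in \<open>N\<close>.\<close>
  moreover have "u - bd (v + wedge a w) \<in> kchains N i j"
  proof -
    have "(u - bd (v + wedge a w)) T = n T + wedge a (bd w) T" if T: "T \<subseteq> A" "int (card T) = i" for T
    proof -
      have "(u - bd (v + wedge a w)) T = (u - bd v) T - bd (wedge a w) T"
        by (simp add: bd_add)
      also have "\<dots> = n T + X a (w T) - bd (wedge a w) T" using nw[OF T] by simp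
      also have "\<dots> = n T + wedge a (bd w) T" using wedge_homotopy[OF a T(1), of w, symmetric] by simp
      finally show ?thesis .
    qed
    moreover have "n + wedge a (bd w) \<in> kchains N i j"
      using graded_chains_add[OF N n] wedge_chains[OF N bdw] by simp
    ultimately show ?thesis unfolding koszul_chains_def by simp
  qed
  ultimately show "\<exists>v\<in>kchains M (i + 1) j. u - bd v \<in> kchains N i j" by blast
qed

end

text \<open>\<open>\<epsilon>\<close> induces an isomorphism F/Z -> M/N: \<open>Z\<close> is the
  full preimage of \<open>N\<close>, and \<open>\<epsilon>\<close> is onto modulo \<open>N\<close>.
  It is instantiated with multiplication by a variable, with the map of a free cover, and with the
  coordinate of rank one vectors.\<close>

locale koszul_map =
  src: koszul A ord X + tgt: koszul A ord Y
  for A :: "'x set" and ord and X :: "'x \<Rightarrow> 'm::ab_group_add \<Rightarrow> 'm" and Y :: "'x \<Rightarrow> 'n::ab_group_add \<Rightarrow> 'n" +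
  fixes \<epsilon> :: "'m \<Rightarrow> 'n" and F Z :: "int \<Rightarrow> 'm set" and M N :: "int \<Rightarrow> 'n set"
  assumes map_add: "\<epsilon> (u + v) = \<epsilon> u + \<epsilon> v" and map_op: "\<epsilon> (X a u) = Y a (\<epsilon> u)"
    and F: "graded_family A X F" and N: "graded_family A Y N" and M: "graded_family A Y M"
    and NM: "\<And>d. N d \<subseteq> M d"
    and map_onto: "\<And>d m. m \<in> M d \<Longrightarrow> \<exists>u\<in>F d. m - \<epsilon> u \<in> N d"
    and map_into: "\<And>d u. u \<in> F d \<Longrightarrow> \<epsilon> u \<in> M d"
    and Z_eq: "\<And>d. Z d = {u \<in> F d. \<epsilon> u \<in> N d}"
begin

lemma map_zero: "\<epsilon> 0 = 0"
  using map_add[of 0 0] by simp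

lemma map_diff: "\<epsilon> (u - v) = \<epsilon> u - \<epsilon> v"
  using map_add[of "u - v" v] by simp

lemma map_minus: "\<epsilon> (- u) = - \<epsilon> u"
  using map_diff[of 0 u] map_zero by simp

lemma map_sum: "\<epsilon> (sum f I) = (\<Sum>k\<in>I. \<epsilon> (f k))"
  by (induction I rule: infinite_finite_induct) (auto simp: map_add map_zero)

lemma map_bd: "\<epsilon> (src.bd u T) = tgt.bd (\<lambda>T. \<epsilon> (u T)) T"
  unfolding koszul_bd_def map_sum
  by (rule sum.cong) (auto simp: koszul_sign_def map_minus map_op)

lemma map_chains: "u \<in> src.kchains F i j \<Longrightarrow> (\<lambda>T. \<epsilon> (u T)) \<in> tgt.kchains M i j"
  unfolding koszul_chains_def using map_into by blast

lemma lift_chain: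
  assumes "u \<in> tgt.kchains M i j"
  obtains w where "w \<in> src.kchains F i j" "u - (\<lambda>T. \<epsilon> (w T)) \<in> tgt.kchains N i j"
proof -
  have "\<exists>w. w \<in> F (j - i) \<and> u T - \<epsilon> w \<in> N (j - i)" if "T \<subseteq> A" "int (card T) = i" for T
    using map_onto[of "u T" "j - i"] assms that unfolding koszul_chains_def by blast
  then obtain w where "\<And>T. T \<subseteq> A \<Longrightarrow> int (card T) = i \<Longrightarrow> w T \<in> F (j - i) \<and> u T - \<epsilon> (w T) \<in> N (j - i)"
    by metis
  then show ?thesis using that unfolding koszul_chains_def by auto
qed

lemma in_chains_Z:
  "u \<in> src.kchains Z i j \<longleftrightarrow> u \<in> src.kchains F i j \<and> (\<lambda>T. \<epsilon> (u T)) \<in> tgt.kchains N i j"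
  unfolding koszul_chains_def Z_eq by blast

lemma vanishes_iff: "src.vanishes F Z i j \<longleftrightarrow> tgt.vanishes M N i j"
proof
  assume van: "src.vanishes F Z i j"
  show "tgt.vanishes M N i j"
  proof (rule tgt.vanishesI)
    fix u assume u: "u \<in> tgt.kchains M i j" and bdu: "tgt.bd u \<in> tgt.kchains N (i - 1) j"
    obtain w where w: "w \<in> src.kchains F i j" "u - (\<lambda>T. \<epsilon> (w T)) \<in> tgt.kchains N i j"
      using lift_chain[OF u] .
    have "tgt.bd (u - (\<lambda>T. \<epsilon> (w T))) \<in> tgt.kchains N (i - 1) j"
      using graded_chains_bd[OF N tgt.finite_A, of _ "i - 1" j] w(2) by simp
    from graded_chains_diff[OF N bdu this] have "(\<lambda>T. \<epsilon> (src.bd w T)) \<in> tgt.kchains N (i - 1) j"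
      by (simp add: tgt.bd_diff map_bd)
    moreover have "src.bd w \<in> src.kchains F (i - 1) j"
      using graded_chains_bd[OF F src.finite_A, of _ "i - 1" j] w(1) by simp
    ultimately have "src.bd w \<in> src.kchains Z (i - 1) j" unfolding in_chains_Z by blast
    then obtain v where v: "v \<in> src.kchains F (i + 1) j" "w - src.bd v \<in> src.kchains Z i j"
      using src.vanishesE[OF van w(1)] by blast
    have "(\<lambda>T. \<epsilon> ((w - src.bd v) T)) \<in> tgt.kchains N i j" using v(2) unfolding in_chains_Z by blast
    from graded_chains_add[OF N w(2) this]
    have "u - tgt.bd (\<lambda>T. \<epsilon> (v T)) \<in> tgt.kchains N i j"
      by (simp add: map_diff map_bd plus_fun_def fun_diff_def)
    then show "\<exists>v\<in>tgt.kchains M (i + 1) j. u - tgt.bd v \<in> tgt.kchains N i j"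
      using map_chains[OF v(1)] by blast
  qed
next
  assume van: "tgt.vanishes M N i j"
  show "src.vanishes F Z i j"
  proof (rule src.vanishesI)
    fix u assume u: "u \<in> src.kchains F i j" and bdu: "src.bd u \<in> src.kchains Z (i - 1) j"
    have "tgt.bd (\<lambda>T. \<epsilon> (u T)) \<in> tgt.kchains N (i - 1) j"
      using bdu unfolding in_chains_Z map_bd by blast
    then obtain v where v: "v \<in> tgt.kchains M (i + 1) j"
        "(\<lambda>T. \<epsilon> (u T)) - tgt.bd v \<in> tgt.kchains N i j"
      using tgt.vanishesE[OF van map_chains[OF u]] by blast
    obtain w where w: "w \<in> src.kchains F (i + 1) j" "v - (\<lambda>T. \<epsilon> (w T)) \<in> tgt.kchains N (i + 1) j"
      using lift_chain[OF v(1)] .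
    have "tgt.bd (v - (\<lambda>T. \<epsilon> (w T))) \<in> tgt.kchains N i j"
      by (rule graded_chains_bd[OF N tgt.finite_A w(2)])
    moreover have "(\<lambda>T. \<epsilon> (u T)) - tgt.bd v + tgt.bd (v - (\<lambda>T. \<epsilon> (w T)))
        = (\<lambda>T. \<epsilon> ((u - src.bd w) T))"
      unfolding tgt.bd_diff by (simp add: fun_eq_iff map_diff map_bd)
    ultimately have "(\<lambda>T. \<epsilon> ((u - src.bd w) T)) \<in> tgt.kchains N i j"
      using graded_chains_add[OF N v(2)] by metis
    moreover have "u - src.bd w \<in> src.kchains F i j"
      by (rule graded_chains_diff[OF F u graded_chains_bd[OF F src.finite_A w(1)]])
    ultimately show "\<exists>v\<in>src.kchains F (i + 1) j. u - src.bd v \<in> src.kchains Z i j"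
      using w(1) unfolding in_chains_Z by blast
  qed
qed

end

section \<open>Polynomials\<close>

abbreviation coef :: "('a \<Rightarrow>\<^sub>0 'b::zero) \<Rightarrow> 'a \<Rightarrow> 'b" where "coef \<equiv> Poly_Mapping.lookup"
abbreviation supp :: "('a \<Rightarrow>\<^sub>0 'b::zero) \<Rightarrow> 'a set" where "supp \<equiv> Poly_Mapping.keys"
abbreviation monom :: "('x \<Rightarrow>\<^sub>0 nat) \<Rightarrow> 'k::comm_ring_1 \<Rightarrow> ('x, 'k) mpoly" where
  "monom \<equiv> Poly_Mapping.single"

definition expo :: "'x \<Rightarrow> 'x \<Rightarrow>\<^sub>0 nat" where "expo a = Poly_Mapping.single a 1"

lemma coef_expo: "coef (expo a) b = (if a = b then 1 else 0)"
  unfolding expo_def by (simp add: lookup_single when_def)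

lemma supp_expo [simp]: "supp (expo a) = {a}"
  unfolding expo_def by simp

lemma indet_eq_monom: "indet a = monom (expo a) 1"
  unfolding indet_def expo_def ..

lemma supp_add_nat: "supp (m + m' :: 'x \<Rightarrow>\<^sub>0 nat) = supp m \<union> supp m'"
  by (auto simp: in_keys_iff lookup_add)

lemma expo_minus_add: "a \<in> supp m \<Longrightarrow> (m - expo a) + expo a = (m :: 'x \<Rightarrow>\<^sub>0 nat)"
  by (rule poly_mapping_eqI) (auto simp: lookup_add lookup_minus coef_expo in_keys_iff)

lemma coef_monom_mult: "coef (monom t c * p) (m + t) = c * coef p m"
proof -
  have "coef (monom t c * p) (m + t) = (\<Sum>k. coef (monom t c) k * (\<Sum>q. coef p q when m + t = k + q))"
    unfolding lookup_mult by simp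
  also have "\<dots> = (\<Sum>k. c * (\<Sum>q. coef p q when m + t = t + q) when k = t)"
    by (rule Sum_any.cong) (auto simp: lookup_single when_def)
  also have "\<dots> = c * (\<Sum>q. coef p q when q = m)"
    by (simp add: add.commute[of m t] eq_commute[of m])
  finally show ?thesis by simp
qed

lemma supp_monom_mult: "supp (monom t c * p) \<subseteq> (\<lambda>m. m + t) ` supp p"
  using keys_mult[of "monom t c" p] by (force simp: add.commute split: if_splits)

lemma coef_monom_mult_outside: "(\<And>n. m \<noteq> n + t) \<Longrightarrow> coef (monom t c * p) m = 0"
  using supp_monom_mult[of t c p] by (metis (no_types, lifting) imageE in_keys_iff subsetD)

lemma coef_indet_mult [simp]: "coef (indet a * p) (m + expo a) = coef p m"
  unfolding indet_eq_monom coef_monom_mult by simp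

lemma supp_indet_mult: "supp (indet a * p) = (\<lambda>m. m + expo a) ` supp p"
proof
  show "supp (indet a * p) \<subseteq> (\<lambda>m. m + expo a) ` supp p"
    unfolding indet_eq_monom by (rule supp_monom_mult)
  show "(\<lambda>m. m + expo a) ` supp p \<subseteq> supp (indet a * p)"
    by (auto simp: in_keys_iff)
qed

lemma coef_indet_mult_outside: "a \<notin> supp m \<Longrightarrow> coef (indet a * p) m = 0"
  unfolding indet_eq_monom by (rule coef_monom_mult_outside) (auto simp: supp_add_nat)

lemma poly_sum_monom:
  assumes "finite B" "supp p \<subseteq> B"
  shows "p = (\<Sum>m\<in>B. monom m (coef p m))"
proof (rule poly_mapping_eqI)
  fix k
  have "(\<Sum>m\<in>B. coef (monom m (coef p m)) k) = (\<Sum>m\<in>B. if m = k then coef p m else 0)"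
    by (intro sum.cong refl) (auto simp: lookup_single)
  then show "coef p k = coef (\<Sum>m\<in>B. monom m (coef p m)) k"
    unfolding lookup_sum using assms by (auto simp: in_keys_iff)
qed

lemma monom_in_poly_ring: "supp m \<subseteq> A \<Longrightarrow> monom m c \<in> poly_ring A"
  unfolding poly_ring_def by simp

lemma poly_ring_zero: "0 \<in> poly_ring A"
  unfolding poly_ring_def by simp

lemma poly_ring_one: "1 \<in> poly_ring A"
  unfolding poly_ring_def by simp

lemma poly_ring_diff: "p \<in> poly_ring A \<Longrightarrow> q \<in> poly_ring A \<Longrightarrow> p - q \<in> poly_ring A"
  unfolding poly_ring_def using keys_diff[of p q] by blast

lemma poly_ring_add: "p \<in> poly_ring A \<Longrightarrow> q \<in> poly_ring A \<Longrightarrow> p + q \<in> poly_ring A"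
  unfolding poly_ring_def using keys_add[of p q] by blast

lemma poly_ring_minus: "p \<in> poly_ring A \<Longrightarrow> - p \<in> poly_ring A"
  unfolding poly_ring_def by simp

lemma poly_ring_sum: "(\<And>i. i \<in> I \<Longrightarrow> f i \<in> poly_ring A) \<Longrightarrow> sum f I \<in> poly_ring A"
  by (induction I rule: infinite_finite_induct) (auto simp: poly_ring_zero poly_ring_add)

lemma poly_ring_mult: "p \<in> poly_ring A \<Longrightarrow> q \<in> poly_ring A \<Longrightarrow> p * q \<in> poly_ring A"
  unfolding poly_ring_def using keys_mult[of p q] by (fastforce simp: supp_add_nat)

lemma poly_ring_indet: "a \<in> A \<Longrightarrow> indet a \<in> poly_ring A"
  unfolding indet_eq_monom by (rule monom_in_poly_ring) simp

lemma poly_ring_mono: "A \<subseteq> B \<Longrightarrow> p \<in> poly_ring A \<Longrightarrow> p \<in> poly_ring B"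
  unfolding poly_ring_def by blast

lemma mon_degree_superset: "finite B \<Longrightarrow> supp m \<subseteq> B \<Longrightarrow> mon_degree m = (\<Sum>x\<in>B. coef m x)"
  unfolding mon_degree_def by (rule sum.mono_neutral_left) (auto simp: in_keys_iff)

lemma mon_degree_add: "mon_degree (m + m') = mon_degree m + mon_degree m'"
  using mon_degree_superset[of "supp m \<union> supp m'"]
  by (simp add: supp_add_nat lookup_add sum.distrib)

lemma mon_degree_expo [simp]: "mon_degree (expo a) = 1"
  unfolding mon_degree_def by (simp add: coef_expo)

lemma mon_degree_zero [simp]: "mon_degree 0 = 0"
  unfolding mon_degree_def by simp

lemma mon_degree_eq_zero: "mon_degree m = 0 \<longleftrightarrow> m = 0"
  unfolding mon_degree_def by (auto simp: in_keys_iff intro: poly_mapping_eqI)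

lemma homogeneous_zero: "0 \<in> homogeneous d"
  unfolding homogeneous_def by simp

lemma homogeneous_diff: "p \<in> homogeneous d \<Longrightarrow> q \<in> homogeneous d \<Longrightarrow> p - q \<in> homogeneous d"
  unfolding homogeneous_def using keys_diff[of p q] by blast

lemma homogeneous_add: "p \<in> homogeneous d \<Longrightarrow> q \<in> homogeneous d \<Longrightarrow> p + q \<in> homogeneous d"
  unfolding homogeneous_def using keys_add[of p q] by blast

lemma homogeneous_sum: "(\<And>i. i \<in> I \<Longrightarrow> f i \<in> homogeneous d) \<Longrightarrow> sum f I \<in> homogeneous d"
  by (induction I rule: infinite_finite_induct) (auto simp: homogeneous_zero homogeneous_add)

lemma homogeneous_mult:
  "p \<in> homogeneous d \<Longrightarrow> q \<in> homogeneous e \<Longrightarrow> p * q \<in> homogeneous (d + e)"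
  unfolding homogeneous_def using keys_mult[of p q] by (fastforce simp: mon_degree_add)

lemma homogeneous_monom: "int (mon_degree m) = d \<Longrightarrow> monom m c \<in> homogeneous d"
  unfolding homogeneous_def by simp

lemma homogeneous_indet: "indet a \<in> homogeneous 1"
  unfolding indet_eq_monom by (rule homogeneous_monom) simp

lemma homogeneous_indet_mult: "p \<in> homogeneous d \<Longrightarrow> indet a * p \<in> homogeneous (d + 1)"
  using homogeneous_mult[OF homogeneous_indet] by (metis add.commute)

lemma homogeneous_coef_zero: "p \<in> homogeneous d \<Longrightarrow> d \<noteq> 0 \<Longrightarrow> coef p 0 = 0"
  unfolding homogeneous_def by (force simp: in_keys_iff)

definition graded_part :: "('x, 'k::comm_ring_1) mpoly set \<Rightarrow> int \<Rightarrow> ('x, 'k) mpoly set" where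
  "graded_part I d = I \<inter> homogeneous d"

lemma graded_family_graded_part:
  assumes "0 \<in> I" "\<And>p q. p \<in> I \<Longrightarrow> q \<in> I \<Longrightarrow> p - q \<in> I" "\<And>a p. a \<in> A \<Longrightarrow> p \<in> I \<Longrightarrow> indet a * p \<in> I"
  shows "graded_family A (\<lambda>a p. indet a * p) (graded_part I)"
  using assms unfolding graded_part_def
  by (intro graded_familyI) (auto intro: homogeneous_zero homogeneous_diff homogeneous_indet_mult)

lemma graded_family_poly_ring: "graded_family A (\<lambda>a p. indet a * p) (graded_part (poly_ring A))"
  by (intro graded_family_graded_part poly_ring_zero poly_ring_diff poly_ring_mult poly_ring_indet)

lemma graded_family_zero: "graded_family A (\<lambda>a p. indet a * p) (graded_part {0})"
  by (intro graded_family_graded_part) auto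

locale poly_koszul =
  fixes A :: "'x set" and ord :: "'x \<Rightarrow> nat" and K :: "'k::field itself"
  assumes finite_vars: "finite A" and inj_on_ord: "inj_on ord A"

sublocale poly_koszul \<subseteq> koszul A ord "\<lambda>a (p :: ('x, 'k) mpoly). indet a * p"
  by unfold_locales (auto simp: finite_vars inj_on_ord algebra_simps)

lemma koszul_chains_shift:
  "koszul_chains A (\<lambda>d. M (d - c)) i j = koszul_chains A M i (j - c)"
  unfolding koszul_chains_def by (simp add: algebra_simps)

lemma koszul_vanishes_shift:
  "koszul_vanishes A ord X (\<lambda>d. M (d - c)) (\<lambda>d. N (d - c)) i j \<longleftrightarrow> koszul_vanishes A ord X M N i (j - c)"
  unfolding koszul_vanishes_def koszul_chains_shift ..


section \<open>Ideals cut out by sums of coefficients over classes of monomials\<close>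

definition class_sum :: "(('x \<Rightarrow>\<^sub>0 nat) \<Rightarrow> 'c) \<Rightarrow> ('x, 'k::comm_ring_1) mpoly \<Rightarrow> 'c \<Rightarrow> 'k" where
  "class_sum cl p \<kappa> = (\<Sum>m\<in>{m \<in> supp p. cl m = \<kappa>}. coef p m)"

text \<open>The kernel of the linear map that sends a monomial to its class and every class outside
  \<open>C\<close> to zero. For a toric \<open>cl\<close> this is the toric ideal together with the
  monomials whose class lies outside \<open>C\<close>.\<close>

definition class_ideal ::
  "'x set \<Rightarrow> (('x \<Rightarrow>\<^sub>0 nat) \<Rightarrow> 'c) \<Rightarrow> 'c set \<Rightarrow> ('x, 'k::comm_ring_1) mpoly set" where
  "class_ideal A cl C = {p \<in> poly_ring A. \<forall>\<kappa>\<in>C. class_sum cl p \<kappa> = 0}"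

lemma class_sum_superset:
  "finite B \<Longrightarrow> supp p \<subseteq> B \<Longrightarrow> class_sum cl p \<kappa> = (\<Sum>m\<in>{m \<in> B. cl m = \<kappa>}. coef p m)"
  unfolding class_sum_def by (rule sum.mono_neutral_left) (auto simp: in_keys_iff)

lemma class_sum_zero [simp]: "class_sum cl 0 \<kappa> = 0"
  unfolding class_sum_def by simp

lemma class_sum_diff:
  fixes p q :: "('x, 'k::comm_ring_1) mpoly"
  shows "class_sum cl (p - q) \<kappa> = class_sum cl p \<kappa> - class_sum cl q \<kappa>"
proof -
  have *: "class_sum cl r \<kappa> = (\<Sum>m\<in>{m \<in> supp p \<union> supp q. cl m = \<kappa>}. coef r m)"
    if "supp r \<subseteq> supp p \<union> supp q" for r :: "('x, 'k) mpoly"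
    using that by (intro class_sum_superset) auto
  show ?thesis
    using *[of p] *[of q] *[OF keys_diff] by (simp add: lookup_minus sum_subtractf)
qed

lemma class_sum_add: "class_sum cl (p + q) \<kappa> = class_sum cl p \<kappa> + class_sum cl q \<kappa>"
  using class_sum_diff[of cl "p + q" q \<kappa>] by simp

lemma class_sum_sum: "class_sum cl (sum f I) \<kappa> = (\<Sum>i\<in>I. class_sum cl (f i) \<kappa>)"
  by (induction I rule: infinite_finite_induct) (auto simp: class_sum_add)

lemma class_sum_monom: "class_sum cl (monom m c) \<kappa> = (if cl m = \<kappa> then c else 0)"
proof -
  have "class_sum cl (monom m c) \<kappa> = (\<Sum>n\<in>{n \<in> {m}. cl n = \<kappa>}. coef (monom m c) n)"
    by (rule class_sum_superset) auto
  moreover have "{n \<in> {m}. cl n = \<kappa>} = (if cl m = \<kappa> then {m} else {})" by auto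
  ultimately show ?thesis by simp
qed

lemma class_sum_empty: "(\<And>m. m \<in> supp p \<Longrightarrow> cl m \<noteq> \<kappa>) \<Longrightarrow> class_sum cl p \<kappa> = 0"
  unfolding class_sum_def by (rule sum.neutral) auto

text \<open>
  For an ideal of this kind, adding a variable and taking the colon by a variable are operations on the set of
  classes, \<open>C - multiples a\<close> and \<open>class_colon a C\<close>.
\<close>

locale class_ideals = poly_koszul A ord K
  for A :: "'x set" and ord and K :: "'k::field itself" +
  fixes cl :: "('x \<Rightarrow>\<^sub>0 nat) \<Rightarrow> 'c"
  assumes class_cancel: "a \<in> A \<Longrightarrow> cl (m + expo a) = cl (n + expo a) \<longleftrightarrow> cl m = cl n"
    and class_degree: "supp m \<subseteq> A \<Longrightarrow> supp n \<subseteq> A \<Longrightarrow> cl m = cl n \<Longrightarrow> mon_degree m = mon_degree n"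
begin

abbreviation "S \<equiv> graded_part (poly_ring A :: ('x, 'k) mpoly set)"
abbreviation "I C \<equiv> graded_part (class_ideal A cl C :: ('x, 'k) mpoly set)"

text \<open>Equivalent to \<open>class_colon a C \<subseteq> C\<close> for all variables, which is
  what makes the class ideal closed under multiplication by them.\<close>

definition class_closed :: "'c set \<Rightarrow> bool" where
  "class_closed C \<longleftrightarrow> (\<forall>a\<in>A. \<forall>m. supp m \<subseteq> A \<longrightarrow> cl (m + expo a) \<in> C \<longrightarrow> cl m \<in> C)"

definition multiples :: "'x \<Rightarrow> 'c set" where
  "multiples a = {cl (m + expo a) |m. supp m \<subseteq> A}"

definition class_colon :: "'x \<Rightarrow> 'c set \<Rightarrow> 'c set" where
  "class_colon a C = {cl m |m. supp m \<subseteq> A \<and> cl (m + expo a) \<in> C}"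

lemma class_sum_indet_mult:
  fixes p :: "('x, 'k) mpoly"
  assumes "a \<in> A"
  shows "class_sum cl (indet a * p) (cl (m + expo a)) = class_sum cl p (cl m)"
proof -
  have "{n \<in> supp (indet a * p). cl n = cl (m + expo a)} = (\<lambda>n. n + expo a) ` {n \<in> supp p. cl n = cl m}"
    unfolding supp_indet_mult using class_cancel[OF assms] by auto
  moreover have "inj_on (\<lambda>n. n + expo a) B" for B :: "('x \<Rightarrow>\<^sub>0 nat) set"
    by (auto intro: inj_onI)
  ultimately show ?thesis
    unfolding class_sum_def by (simp add: sum.reindex)
qed

lemma class_sum_indet_mult_outside:
  fixes p :: "('x, 'k) mpoly"
  assumes "p \<in> poly_ring A" and "\<kappa> \<notin> multiples a"
  shows "class_sum cl (indet a * p) \<kappa> = 0"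
  using assms unfolding supp_indet_mult poly_ring_def multiples_def
  by (intro class_sum_empty) (auto simp: supp_indet_mult)

text \<open>By \<open>class_cancel\<close> multiplication by x_a is injective on classes, so the
  class sums of x_a p are those of \<open>p\<close> moved along, and they vanish on all classes
  outside \<open>multiples a\<close>.\<close>

lemma class_ideal_indet_mult:
  fixes p :: "('x, 'k) mpoly"
  assumes a: "a \<in> A" and p: "p \<in> poly_ring A"
  shows "indet a * p \<in> class_ideal A cl C \<longleftrightarrow> p \<in> class_ideal A cl (class_colon a C)"
proof -
  have "(\<forall>\<kappa>\<in>C. class_sum cl (indet a * p) \<kappa> = 0) \<longleftrightarrow>
      (\<forall>m. supp m \<subseteq> A \<longrightarrow> cl (m + expo a) \<in> C \<longrightarrow> class_sum cl (indet a * p) (cl (m + expo a)) = 0)"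
    (is "?L \<longleftrightarrow> ?R")
  proof
    assume R: ?R
    show ?L
    proof
      fix \<kappa> assume "\<kappa> \<in> C"
      with R class_sum_indet_mult_outside[OF p, of \<kappa> a] show "class_sum cl (indet a * p) \<kappa> = 0"
        unfolding multiples_def by (cases "\<kappa> \<in> multiples a") (auto simp: multiples_def)
    qed
  qed blast
  also have "\<dots> \<longleftrightarrow> (\<forall>\<kappa>\<in>class_colon a C. class_sum cl p \<kappa> = 0)"
    unfolding class_sum_indet_mult[OF a] class_colon_def by blast
  finally show ?thesis
    unfolding class_ideal_def using p a by (simp add: poly_ring_mult poly_ring_indet)
qed

lemma graded_S: "graded S"
  by (rule graded_family_poly_ring)

lemma class_ideal_antimono: "C' \<subseteq> C \<Longrightarrow> class_ideal A cl C \<subseteq> class_ideal A cl C'"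
  unfolding class_ideal_def by blast

lemma I_subset_S: "I C d \<subseteq> S d"
  unfolding graded_part_def class_ideal_def by blast

lemma graded_I: "class_closed C \<Longrightarrow> graded (I C)"
proof (rule graded_family_graded_part)
  assume C: "class_closed C"
  then have "class_colon a C \<subseteq> C" if "a \<in> A" for a
    unfolding class_closed_def class_colon_def using that by blast
  then show "indet a * p \<in> class_ideal A cl C" if "a \<in> A" "p \<in> class_ideal A cl C" for a and p :: "('x, 'k) mpoly"
    using that class_ideal_indet_mult[of a p C] class_ideal_antimono[of "class_colon a C" C]
    by (auto simp: class_ideal_def)
qed (auto simp: class_ideal_def class_sum_diff poly_ring_zero poly_ring_diff)

lemma class_closed_diff_multiples:
  assumes "class_closed C" "a \<in> A"
  shows "class_closed (C - multiples a)"
  unfolding class_closed_def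
proof (intro ballI allI impI)
  fix b m assume b: "b \<in> A" and m: "supp m \<subseteq> A" and mem: "cl (m + expo b) \<in> C - multiples a"
  have "cl m \<notin> multiples a"
  proof
    assume "cl m \<in> multiples a"
    then obtain n where n: "cl m = cl (n + expo a)" "supp n \<subseteq> A" unfolding multiples_def by blast
    then have "cl (m + expo b) = cl (n + expo b + expo a)"
      using class_cancel[OF b, of m "n + expo a"] by (simp add: ac_simps)
    moreover have "supp (n + expo b) \<subseteq> A" using n b by (simp add: supp_add_nat)
    ultimately show False using mem unfolding multiples_def by blast
  qed
  then show "cl m \<in> C - multiples a" using assms(1) b m mem unfolding class_closed_def by blast
qed

text \<open>For each class of \<open>multiples a\<close> that \<open>p\<close> meets,
  \<open>q\<close> puts the class sum of \<open>p\<close> on a single monomial whose product with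
  x_a lies in that class; subtracting x_a q kills these sums and changes no others.\<close>

lemma class_ideal_diff_multiples:
  assumes a: "a \<in> A" and p: "p \<in> I (C - multiples a) d"
  shows "\<exists>n\<in>I C d. \<exists>q\<in>S (d - 1). p = n + indet a * q"
proof -
  define B where "B = cl ` supp p \<inter> multiples a"
  have finB: "finite B" unfolding B_def by simp
  have "\<exists>m. supp m \<subseteq> A \<and> cl (m + expo a) = \<kappa>" if "\<kappa> \<in> B" for \<kappa>
  proof -
    have "\<kappa> \<in> multiples a" using that unfolding B_def by blast
    then show ?thesis unfolding multiples_def by auto
  qed
  then obtain r where r: "\<And>\<kappa>. \<kappa> \<in> B \<Longrightarrow> supp (r \<kappa>) \<subseteq> A \<and> cl (r \<kappa> + expo a) = \<kappa>"
    by metis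
  define q where "q = (\<Sum>\<kappa>\<in>B. monom (r \<kappa>) (class_sum cl p \<kappa>))"
  have p': "p \<in> poly_ring A" "p \<in> homogeneous d" and van: "\<And>\<kappa>. \<kappa> \<in> C - multiples a \<Longrightarrow> class_sum cl p \<kappa> = 0"
    using p unfolding graded_part_def class_ideal_def by blast+
  have "q \<in> homogeneous (d - 1)"
    unfolding q_def
  proof (intro homogeneous_sum homogeneous_monom)
    fix \<kappa> assume \<kappa>: "\<kappa> \<in> B"
    then obtain m where m: "m \<in> supp p" "cl m = \<kappa>" unfolding B_def by blast
    have "mon_degree m = mon_degree (r \<kappa> + expo a)"
      using r[OF \<kappa>] m p'(1) a unfolding poly_ring_def by (intro class_degree) (auto simp: supp_add_nat)
    moreover have "int (mon_degree m) = d" using m p'(2) unfolding homogeneous_def by blast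
    ultimately show "int (mon_degree (r \<kappa>)) = d - 1" by (simp add: mon_degree_add)
  qed
  moreover have qA: "q \<in> poly_ring A"
    unfolding q_def using r by (intro poly_ring_sum monom_in_poly_ring) blast
  ultimately have q: "q \<in> S (d - 1)" unfolding graded_part_def by blast
  have "class_sum cl (p - indet a * q) \<kappa> = 0" if "\<kappa> \<in> C" for \<kappa>
  proof (cases "\<kappa> \<in> multiples a")
    case True
    then obtain m where m: "\<kappa> = cl (m + expo a)" "supp m \<subseteq> A" unfolding multiples_def by blast
    have "class_sum cl (indet a * q) \<kappa> = (\<Sum>\<mu>\<in>B. if cl (r \<mu>) = cl m then class_sum cl p \<mu> else 0)"
      unfolding m(1) class_sum_indet_mult[OF a] q_def class_sum_sum class_sum_monom ..
    also have "\<dots> = (\<Sum>\<mu>\<in>B. if \<mu> = \<kappa> then class_sum cl p \<kappa> else 0)"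
    proof (rule sum.cong)
      fix \<mu> assume "\<mu> \<in> B"
      then show "(if cl (r \<mu>) = cl m then class_sum cl p \<mu> else 0) = (if \<mu> = \<kappa> then class_sum cl p \<kappa> else 0)"
        using r[of \<mu>] class_cancel[OF a, of "r \<mu>" m] m(1) by auto
    qed simp
    also have "\<dots> = class_sum cl p \<kappa>"
    proof (cases "\<kappa> \<in> B")
      case False
      then have "class_sum cl p \<kappa> = 0" using True unfolding B_def by (intro class_sum_empty) blast
      with False show ?thesis by (simp add: sum.neutral cong: if_cong)
    qed (use finB in simp)
    finally show ?thesis by (simp add: class_sum_diff)
  next
    case False
    then show ?thesis using that van class_sum_indet_mult_outside[OF qA False] by (simp add: class_sum_diff)
  qed
  then have "p - indet a * q \<in> I C d"
    unfolding graded_part_def class_ideal_def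
    using p' q a homogeneous_indet_mult[of q "d - 1" a]
    by (auto simp: graded_part_def intro: poly_ring_diff poly_ring_mult poly_ring_indet homogeneous_diff)
  moreover have "p = (p - indet a * q) + indet a * q" by simp
  ultimately show ?thesis using q by blast
qed

text \<open>If multiplication by x_a never leaves \<open>C\<close>, every class of \<open>C\<close>
  met by a polynomial lies in \<open>class_colon a C\<close>, so the colon by x_a adds nothing and
  x_a is regular modulo the ideal.\<close>

lemma vanishes_class_regular:
  assumes C: "class_closed C" and a: "a \<in> A"
    and regular: "\<And>m. supp m \<subseteq> A \<Longrightarrow> cl m \<in> C \<Longrightarrow> cl (m + expo a) \<in> C"
    and van: "vanishes S (I (C - multiples a)) i j"
  shows "vanishes S (I C) i j"
proof (rule vanishes_regular[OF graded_S graded_I[OF C] I_subset_S a _ class_ideal_diff_multiples[OF a] _ van])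
  fix d and p :: "('x, 'k) mpoly" assume p: "p \<in> S d" and "indet a * p \<in> I C (d + 1)"
  then have "p \<in> class_ideal A cl (class_colon a C)"
    using class_ideal_indet_mult[OF a, of p C] unfolding graded_part_def by blast
  then have "class_sum cl p \<kappa> = 0" if "\<kappa> \<in> C" for \<kappa>
  proof (cases "\<kappa> \<in> cl ` supp p")
    case True
    then have "\<kappa> \<in> class_colon a C"
      using that p regular unfolding class_colon_def graded_part_def poly_ring_def by blast
    then show ?thesis using \<open>p \<in> class_ideal A cl (class_colon a C)\<close> unfolding class_ideal_def by blast
  qed (auto intro: class_sum_empty)
  then show "p \<in> I C d" using p unfolding graded_part_def class_ideal_def by blast
next
  show "I C d \<subseteq> I (C - multiples a) d" for d
    unfolding graded_part_def using class_ideal_antimono by blast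
qed

text \<open>From 0 -> S/(I : x_a)(-1) -> S/I -> S/(I + x_a) -> 0, where multiplication by x_a
  identifies the first term with (I + x_a)/I.\<close>

lemma vanishes_class_colon:
  assumes C: "class_closed C" and a: "a \<in> A"
    and colon: "vanishes S (I (class_colon a C)) i (j - 1)"
    and quot: "vanishes S (I (C - multiples a)) i j"
  shows "vanishes S (I C) i j"
proof -
  let ?X = "\<lambda>a (p :: ('x, 'k) mpoly). indet a * p"
  interpret shift: koszul_map A ord ?X ?X "?X a" "\<lambda>d. S (d - 1)" "\<lambda>d. I (class_colon a C) (d - 1)"
    "I (C - multiples a)" "I C"
  proof (unfold_locales)
    show "graded (\<lambda>d. S (d - 1))"
      using graded_S unfolding graded_family_def by (metis add_diff_eq diff_add_eq)
    show "graded (I C)" "graded (I (C - multiples a))"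
      using C a by (auto intro: graded_I class_closed_diff_multiples)
    show "I C d \<subseteq> I (C - multiples a) d" for d
      unfolding graded_part_def using class_ideal_antimono by blast
    show "\<exists>u\<in>S (d - 1). m - indet a * u \<in> I C d" if "m \<in> I (C - multiples a) d" for d m
      using class_ideal_diff_multiples[OF a that] by (metis add_diff_cancel_right')
    show "indet a * u \<in> I (C - multiples a) d" if "u \<in> S (d - 1)" for d u
      using that a homogeneous_indet_mult[of u "d - 1" a] class_ideal_indet_mult[OF a, of u "C - multiples a"]
      unfolding graded_part_def by (auto simp: class_ideal_def class_colon_def multiples_def)
    show "I (class_colon a C) (d - 1) = {u \<in> S (d - 1). indet a * u \<in> I C d}" for d
      using homogeneous_indet_mult[of _ "d - 1" a] class_ideal_indet_mult[OF a, of _ C]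
      unfolding graded_part_def by (auto simp: class_ideal_def)
  qed (auto simp: algebra_simps)
  have "vanishes (I (C - multiples a)) (I C) i j"
    using colon shift.vanishes_iff by (simp add: koszul_vanishes_shift)
  then show ?thesis
    using vanishes_extension[of "I C" "I (C - multiples a)" S i j] quot C a I_subset_S
    by (simp add: graded_I graded_S class_closed_diff_multiples shift.NM)
qed

text \<open>The quotient is the field in degree 0, while chains of bidegree (i, j) have coefficients
  of degree j - i: off the diagonal every chain already lies in the ideal, and \<open>0\<close>
  bounds it.\<close>

lemma vanishes_class_irrelevant:
  assumes "i \<noteq> j"
  shows "vanishes S (I {cl 0}) i j"
proof (rule vanishesI, rule bexI[of _ 0])
  fix u assume u: "u \<in> kchains S i j"
  have "u T \<in> I {cl 0} (j - i)" if T: "T \<subseteq> A" "int (card T) = i" for T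
  proof -
    have uT: "u T \<in> S (j - i)" using u T unfolding koszul_chains_def by blast
    have "class_sum cl (u T) (cl 0) = 0"
    proof (rule class_sum_empty)
      fix m assume m: "m \<in> supp (u T)"
      then have "int (mon_degree m) \<noteq> 0" using uT assms unfolding graded_part_def homogeneous_def by auto
      then show "cl m \<noteq> cl 0"
        using class_degree[of m 0] m uT unfolding graded_part_def poly_ring_def by auto
    qed
    then show ?thesis using uT unfolding graded_part_def class_ideal_def by auto
  qed
  then have "u \<in> kchains (I {cl 0}) i j" unfolding koszul_chains_def by blast
  moreover have "bd 0 = 0" using bd_diff[of 0 0] by simp
  ultimately show "u - bd 0 \<in> kchains (I {cl 0}) i j" by simp
qed (auto simp: koszul_chains_def graded_zero[OF graded_S])

end

lemma supp_minus_nat: "supp (m - n :: 'x \<Rightarrow>\<^sub>0 nat) \<subseteq> supp m"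
  by (auto simp: in_keys_iff lookup_minus)

lemma class_sum_id: "class_sum (\<lambda>m. m) p \<kappa> = coef p \<kappa>"
proof -
  have "{m \<in> supp p. m = \<kappa>} = (if \<kappa> \<in> supp p then {\<kappa>} else {})" by auto
  then show ?thesis unfolding class_sum_def by (auto simp: in_keys_iff)
qed

lemma class_ideal_id_zero: "class_ideal A (\<lambda>m. m) {m. supp m \<subseteq> A} = {0}"
  unfolding class_ideal_def class_sum_id
  by (auto simp: poly_ring_zero poly_ring_def intro!: poly_mapping_eqI) (metis in_keys_iff)

section \<open>Koszul homology of the polynomial ring\<close>

context poly_koszul
begin

abbreviation "S \<equiv> graded_part (poly_ring A :: ('x, 'k) mpoly set)"
abbreviation "Null \<equiv> graded_part ({0} :: ('x, 'k) mpoly set)"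

text \<open>With the identity as class map each class is one monomial, and the monomials in the
  variables \<open>B\<close> give the ideal generated by the variables outside \<open>B\<close>.
  Every added variable is regular on the enlarged quotient ring; at \<open>B = A\<close> the ideal
  is zero.\<close>

lemma vanishes_ring_off_diagonal:
  assumes "i \<noteq> j"
  shows "vanishes S Null i j"
proof -
  interpret id: class_ideals A ord K "\<lambda>m. m"
    by unfold_locales auto
  have closed: "id.class_closed {m. supp m \<subseteq> B}" for B
    unfolding id.class_closed_def by (auto simp: supp_add_nat)
  have "B \<subseteq> A \<Longrightarrow> vanishes S (id.I {m. supp m \<subseteq> B}) i j" if "finite B" for B
    using that
  proof (induction B)
    case empty
    have "{m :: 'x \<Rightarrow>\<^sub>0 nat. supp m \<subseteq> {}} = {0}" by auto
    then show ?case using id.vanishes_class_irrelevant[OF assms] by simp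
  next
    case (insert a B)
    have "m \<in> id.multiples a" if "supp m \<subseteq> insert a B" "\<not> supp m \<subseteq> B" for m
    proof -
      have "a \<in> supp m" using that by blast
      moreover have "supp (m - expo a) \<subseteq> A"
        using that insert.prems supp_minus_nat[of m "expo a"] by blast
      ultimately show ?thesis
        unfolding id.multiples_def using expo_minus_add[of a m] by (smt (verit) mem_Collect_eq)
    qed
    moreover have "m \<notin> id.multiples a" if "supp m \<subseteq> B" for m
      using that insert.hyps unfolding id.multiples_def by (auto simp: supp_add_nat)
    ultimately have "{m. supp m \<subseteq> insert a B} - id.multiples a = {m. supp m \<subseteq> B}" by blast
    then have "vanishes S (id.I ({m. supp m \<subseteq> insert a B} - id.multiples a)) i j"
      using insert by simp
    then show ?case
      using insert.prems by (intro id.vanishes_class_regular[OF closed, of a]) (simp_all add: supp_add_nat)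
  qed
  from this[OF finite_vars] show ?thesis by (simp add: class_ideal_id_zero)
qed

text \<open>The induction from the field is silent here, since the field does have homology on the
  diagonal. Instead: the coefficients are constants, and the coefficient of x_a in the boundary at
  \<open>T - {a}\<close> is \<open>u T\<close> up to sign, so a cycle is zero.\<close>

lemma vanishes_ring_diagonal:
  assumes "i > 0"
  shows "vanishes S Null i i"
proof (rule vanishesI, rule bexI[of _ 0])
  fix u assume u: "u \<in> kchains S i i" and bdu: "bd u \<in> kchains Null (i - 1) i"
  have "u T = 0" if T: "T \<subseteq> A" "int (card T) = i" for T
  proof -
    have uT: "coef (u R) m = 0" if "R \<subseteq> A" "int (card R) = i" "m \<noteq> 0" for R m
    proof -
      have "u R \<in> homogeneous 0" using u that unfolding koszul_chains_def graded_part_def by auto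
      then show ?thesis using that(3) unfolding homogeneous_def by (auto simp: in_keys_iff mon_degree_eq_zero)
    qed
    have finT: "finite T" using T finite_vars finite_subset by blast
    obtain a where a: "a \<in> T" using T assms by fastforce
    define R where "R = T - {a}"
    have R: "R = T - {a}" "int (card R) = i - 1"
      using card_Suc_Diff1[OF finT a] T(2) unfolding R_def by auto
    have "R \<subseteq> A" using T R by blast
    then have "bd u R = 0"
      using bdu R(2) unfolding koszul_chains_def graded_part_def by blast
    then have "0 = coef (bd u R) (expo a)" by simp
    also have "\<dots> = (\<Sum>b\<in>A - R. coef (sgn_at b R (indet b * u (insert b R))) (expo a))"
      unfolding koszul_bd_def lookup_sum ..
    also have "\<dots> = (\<Sum>b\<in>A - R. if b = a then coef (sgn_at a R (u T)) 0 else 0)"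
    proof (rule sum.cong)
      fix b assume b: "b \<in> A - R"
      have "coef (indet b * u (insert b R)) (expo a) = (if b = a then coef (u T) 0 else 0)"
      proof (cases "b = a")
        case True
        then show ?thesis using coef_indet_mult[of a "u T" 0] R a by (simp add: insert_absorb)
      next
        case False
        then show ?thesis using coef_indet_mult_outside[of b "expo a"] by simp
      qed
      then show "coef (sgn_at b R (indet b * u (insert b R))) (expo a)
          = (if b = a then coef (sgn_at a R (u T)) 0 else 0)"
        unfolding koszul_sign_def by (cases "b = a") simp_all
    qed simp
    also have "\<dots> = coef (sgn_at a R (u T)) 0"
      using a R T finite_vars by auto
    finally have "coef (u T) 0 = 0" unfolding koszul_sign_def by (auto split: if_splits)
    then show ?thesis using uT[OF T] by (metis poly_mapping_eqI lookup_zero)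
  qed
  then have "u \<in> kchains Null i i"
    unfolding koszul_chains_def graded_part_def by (auto simp: homogeneous_zero)
  moreover have "bd 0 = 0" using bd_diff[of 0 0] by simp
  ultimately show "u - bd 0 \<in> kchains Null i i" by simp
qed (auto simp: koszul_chains_def graded_part_def poly_ring_zero homogeneous_zero)

lemma vanishes_ring:
  assumes "i \<noteq> 0 \<or> j \<noteq> 0"
  shows "vanishes S Null i j"
proof -
  consider "i \<noteq> j" | "i = j" "i > 0" | "i < 0" using assms by linarith
  then show ?thesis
    using vanishes_ring_off_diagonal vanishes_ring_diagonal vanishes_negative[OF graded_family_poly_ring]
    by cases blast+
qed

end


section \<open>Ideals given by generators\<close>

lemma ideal_gen_zero: "0 \<in> ideal_gen A B"
  unfolding ideal_gen_def by (auto intro: exI[of _ "{}"])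

lemma ideal_gen_closed:
  assumes "p \<in> ideal_gen A B" and "0 \<in> J" and "\<And>p q. p \<in> J \<Longrightarrow> q \<in> J \<Longrightarrow> p + q \<in> J"
    and "\<And>c b. c \<in> poly_ring A \<Longrightarrow> b \<in> B \<Longrightarrow> c * b \<in> J"
  shows "p \<in> J"
proof -
  have "(\<Sum>b\<in>F. c b * b) \<in> J" if "finite F" "F \<subseteq> B" "\<forall>b\<in>F. c b \<in> poly_ring A" for F c
    using that by (induction F) (use assms in auto)
  then show ?thesis using assms(1) unfolding ideal_gen_def by blast
qed

lemma ideal_gen_add:
  assumes "p \<in> ideal_gen A B" "q \<in> ideal_gen A B"
  shows "p + q \<in> ideal_gen A B"
proof -
  obtain F c G e where F: "finite F" "F \<subseteq> B" "\<forall>b\<in>F. c b \<in> poly_ring A" "p = (\<Sum>b\<in>F. c b * b)"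
    and G: "finite G" "G \<subseteq> B" "\<forall>b\<in>G. e b \<in> poly_ring A" "q = (\<Sum>b\<in>G. e b * b)"
    using assms unfolding ideal_gen_def by blast
  let ?h = "\<lambda>b. (if b \<in> F then c b else 0) + (if b \<in> G then e b else 0)"
  have "(\<Sum>b\<in>F \<union> G. ?h b * b) = (\<Sum>b\<in>F \<union> G. (if b \<in> F then c b * b else 0))
      + (\<Sum>b\<in>F \<union> G. (if b \<in> G then e b * b else 0))"
    unfolding sum.distrib[symmetric] by (intro sum.cong) (auto simp: algebra_simps)
  also have "\<dots> = p + q"
    unfolding F(4) G(4) using F(1) G(1) by (simp add: sum.If_cases Int_absorb1 Int_commute)
  finally have "p + q = (\<Sum>b\<in>F \<union> G. ?h b * b)" ..
  moreover have "\<forall>b\<in>F \<union> G. ?h b \<in> poly_ring A"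
    using F(3) G(3) by (auto intro: poly_ring_add poly_ring_zero)
  ultimately show ?thesis
    unfolding ideal_gen_def using F(1,2) G(1,2) by (intro CollectI exI[of _ "F \<union> G"] exI[of _ ?h]) auto
qed

lemma ideal_gen_gen:
  assumes "c \<in> poly_ring A" "b \<in> B"
  shows "c * b \<in> ideal_gen A B"
  unfolding ideal_gen_def using assms
  by (intro CollectI exI[of _ "{b}"] exI[of _ "\<lambda>_. c"]) auto

lemma ideal_gen_mult:
  assumes "p \<in> ideal_gen A B" "c \<in> poly_ring A"
  shows "c * p \<in> ideal_gen A B"
proof -
  have "p \<in> {p. c * p \<in> ideal_gen A B}"
    using assms(1)
    by (rule ideal_gen_closed)
      (auto simp: distrib_left mult.assoc[symmetric] ideal_gen_zero
        intro: ideal_gen_add ideal_gen_gen poly_ring_mult[OF assms(2)])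
  then show ?thesis by blast
qed

lemma ideal_gen_diff:
  assumes "p \<in> ideal_gen A B" "q \<in> ideal_gen A B"
  shows "p - q \<in> ideal_gen A B"
  using ideal_gen_add[OF assms(1) ideal_gen_mult[OF assms(2), of "- 1"]]
  by (simp add: poly_ring_minus poly_ring_one)

lemma ideal_gen_sum: "(\<And>i. i \<in> I \<Longrightarrow> f i \<in> ideal_gen A B) \<Longrightarrow> sum f I \<in> ideal_gen A B"
  by (induction I rule: infinite_finite_induct) (auto simp: ideal_gen_zero ideal_gen_add)

lemma ideal_gen_subset_poly_ring: "B \<subseteq> poly_ring A \<Longrightarrow> ideal_gen A B \<subseteq> poly_ring A"
  by (rule subsetI, erule ideal_gen_closed) (auto intro: poly_ring_zero poly_ring_add poly_ring_mult)

lemma graded_family_ideal_gen: "graded_family A (\<lambda>a p. indet a * p) (graded_part (ideal_gen A B))"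
  by (intro graded_family_graded_part ideal_gen_zero ideal_gen_diff ideal_gen_mult poly_ring_indet)


section \<open>The binomial edge ideal of a complete graph\<close>

definition complete_edges :: "'v set \<Rightarrow> 'v set set" where
  "complete_edges V = {{u, v} |u v. u \<in> V \<and> v \<in> V \<and> u \<noteq> v}"

text \<open>Two monomials have the same class iff they have the same image under \<open>x\<^sub>v \<mapsto> s z\<^sub>v\<close>, \<open>y\<^sub>v \<mapsto> t z\<^sub>v\<close>.\<close>

definition bei_class :: "'v set \<Rightarrow> ('v bvar \<Rightarrow>\<^sub>0 nat) \<Rightarrow> ('v \<Rightarrow> nat) \<times> nat" where
  "bei_class V m = (\<lambda>v. coef m (XVar v) + coef m (YVar v), \<Sum>v\<in>V. coef m (XVar v))"

lemma finite_bei_vars: "finite V \<Longrightarrow> finite (bei_vars V)"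
  unfolding bei_vars_def by simp

lemma bei_vars_iff [simp]: "XVar v \<in> bei_vars V \<longleftrightarrow> v \<in> V" "YVar v \<in> bei_vars V \<longleftrightarrow> v \<in> V"
  unfolding bei_vars_def by auto

lemma bei_class_add: "bei_class V (m + n) = bei_class V m + bei_class V n"
  unfolding bei_class_def by (simp add: lookup_add sum.distrib plus_prod_def fun_eq_iff)

lemma bei_class_degree:
  assumes "finite V" "supp m \<subseteq> bei_vars V"
  shows "mon_degree m = (\<Sum>v\<in>V. fst (bei_class V m) v)"
proof -
  have "mon_degree m = (\<Sum>x\<in>XVar ` V. coef m x) + (\<Sum>x\<in>YVar ` V. coef m x)"
    using mon_degree_superset[OF finite_bei_vars[OF assms(1)] assms(2)] assms(1)
    unfolding bei_vars_def by (subst sum.union_disjoint[symmetric]) auto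
  also have "\<dots> = (\<Sum>v\<in>V. coef m (XVar v)) + (\<Sum>v\<in>V. coef m (YVar v))"
    by (simp add: sum.reindex inj_on_def)
  finally show ?thesis by (simp add: bei_class_def sum.distrib)
qed

lemma bei_class_expo:
  assumes "finite V" "v \<in> V"
  shows "bei_class V (expo (XVar v)) = (\<lambda>w. if w = v then 1 else 0, 1)"
    and "bei_class V (expo (YVar v)) = (\<lambda>w. if w = v then 1 else 0, 0)"
  using assms unfolding bei_class_def by (auto simp: coef_expo fun_eq_iff)

lemma bei_class_fst_pos: "fst (bei_class V m) v > 0 \<longleftrightarrow> XVar v \<in> supp m \<or> YVar v \<in> supp m"
  unfolding bei_class_def by (auto simp: in_keys_iff)

lemma bei_class_snd_pos:
  assumes "finite V"
  shows "snd (bei_class V m) > 0 \<longleftrightarrow> (\<exists>v\<in>V. XVar v \<in> supp m)"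
proof -
  have "snd (bei_class V m) = 0 \<longleftrightarrow> (\<forall>v\<in>V. XVar v \<notin> supp m)"
    using assms by (simp add: bei_class_def in_keys_iff)
  then show ?thesis by (metis neq0_conv)
qed

locale complete_bei = poly_koszul "bei_vars V" ord K
  for V :: "'v set" and ord and K :: "'k::field itself" +
  assumes finite_V: "finite V"

sublocale complete_bei \<subseteq> cls: class_ideals "bei_vars V" ord K "bei_class V"
  by unfold_locales (auto simp: bei_class_add bei_class_degree[OF finite_V])

context complete_bei
begin

abbreviation cl :: "('v bvar \<Rightarrow>\<^sub>0 nat) \<Rightarrow> ('v \<Rightarrow> nat) \<times> nat" where "cl \<equiv> bei_class V"

definition supported :: "'v bvar set \<Rightarrow> (('v \<Rightarrow> nat) \<times> nat) set" where
  "supported B = cl ` {m. supp m \<subseteq> B}"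

text \<open>The first component of a class records which vertices occur, so congruent monomials
  involve the same vertices.\<close>

lemma supported_bei_vars:
  assumes "supp m \<subseteq> bei_vars V" "W \<subseteq> V"
  shows "cl m \<in> supported (bei_vars W) \<longleftrightarrow> supp m \<subseteq> bei_vars W"
proof
  assume "cl m \<in> supported (bei_vars W)"
  then obtain n where n: "cl m = cl n" "supp n \<subseteq> bei_vars W" unfolding supported_def by blast
  have "v \<in> W" if "XVar v \<in> supp m \<or> YVar v \<in> supp m" for v
    using that bei_class_fst_pos[of V m v] bei_class_fst_pos[of V n v] n
    unfolding bei_vars_def by auto
  then show "supp m \<subseteq> bei_vars W"
    using assms(1) unfolding bei_vars_def by auto
qed (auto simp: supported_def)

text \<open>The second component counts x-variables, so a monomial congruent to one in the
  y-variables is itself free of x-variables.\<close>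

lemma supported_YVar:
  assumes "supp m \<subseteq> bei_vars V" "W \<subseteq> V"
  shows "cl m \<in> supported (YVar ` W) \<longleftrightarrow> supp m \<subseteq> YVar ` W"
proof
  assume "cl m \<in> supported (YVar ` W)"
  then obtain n where n: "cl m = cl n" "supp n \<subseteq> YVar ` W" unfolding supported_def by blast
  have "\<not> snd (cl n) > 0" using n(2) unfolding bei_class_snd_pos[OF finite_V] by auto
  then have X: "XVar v \<notin> supp m" for v
    using n(1) assms(1) bei_class_snd_pos[OF finite_V, of m] unfolding bei_vars_def by auto
  have "v \<in> W" if "YVar v \<in> supp m" for v
    using that bei_class_fst_pos[of V m v] bei_class_fst_pos[of V n v] n by auto
  then show "supp m \<subseteq> YVar ` W"
    using assms(1) X unfolding bei_vars_def by auto
qed (auto simp: supported_def)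

lemma multiplesI: "supp m \<subseteq> bei_vars V \<Longrightarrow> a \<in> supp m \<Longrightarrow> cl m \<in> cls.multiples a"
proof -
  assume m: "supp m \<subseteq> bei_vars V" "a \<in> supp m"
  have "supp (m - expo a) \<subseteq> bei_vars V"
    using m(1) supp_minus_nat[of m "expo a"] by blast
  then show ?thesis
    unfolding cls.multiples_def using expo_minus_add[OF m(2)] by (smt (verit) mem_Collect_eq)
qed

lemma class_swap:
  "u \<in> V \<Longrightarrow> v \<in> V \<Longrightarrow> cl (n + expo (XVar u) + expo (YVar v)) = cl (n + expo (YVar u) + expo (XVar v))"
  by (simp add: bei_class_add bei_class_expo finite_V plus_prod_def add.assoc)

text \<open>If \<open>v\<close> enters only through y_v, some x_u of the monomial can be traded: x_u
  y_v and y_u x_v are congruent.\<close>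

lemma multiples_XVar:
  assumes m: "supp m \<subseteq> bei_vars V" and v: "v \<in> V"
  shows "cl m \<in> cls.multiples (XVar v) \<longleftrightarrow> fst (cl m) v > 0 \<and> snd (cl m) > 0"
proof
  assume "cl m \<in> cls.multiples (XVar v)"
  then show "fst (cl m) v > 0 \<and> snd (cl m) > 0"
    unfolding cls.multiples_def using v finite_V by (auto simp: bei_class_add bei_class_expo)
next
  assume pos: "fst (cl m) v > 0 \<and> snd (cl m) > 0"
  show "cl m \<in> cls.multiples (XVar v)"
  proof (cases "XVar v \<in> supp m")
    case False
    then have Y: "YVar v \<in> supp m" using pos bei_class_fst_pos[of V m v] by simp
    obtain u where u: "u \<in> V" "XVar u \<in> supp m" using pos bei_class_snd_pos[OF finite_V, of m] by blast
    define n where "n = m - expo (YVar v) - expo (XVar u)"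
    have eq: "m = n + expo (XVar u) + expo (YVar v)"
    proof -
      have "XVar u \<in> supp (m - expo (YVar v))"
        using u by (auto simp: in_keys_iff lookup_minus coef_expo)
      then show ?thesis unfolding n_def using expo_minus_add[OF Y] by (simp add: expo_minus_add)
    qed
    then have "cl m = cl (n + expo (YVar u) + expo (XVar v))" using class_swap u(1) v by blast
    moreover have "supp n \<subseteq> bei_vars V" using m eq by (simp add: supp_add_nat)
    then have "supp (n + expo (YVar u)) \<subseteq> bei_vars V" using u(1) by (simp add: supp_add_nat)
    ultimately show ?thesis unfolding cls.multiples_def by blast
  qed (rule multiplesI[OF m])
qed

lemma multiples_YVar:
  assumes v: "v \<in> V" and "cl m \<in> cls.multiples (YVar v)"
  shows "fst (cl m) v > 0"
  using assms unfolding cls.multiples_def by (auto simp: bei_class_add bei_class_expo finite_V)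

lemma closed_bei_vars: "W \<subseteq> V \<Longrightarrow> cls.class_closed (supported (bei_vars W))"
  unfolding cls.class_closed_def
proof (intro ballI allI impI)
  fix a m assume "W \<subseteq> V" "a \<in> bei_vars V" "supp m \<subseteq> bei_vars V"
    and "cl (m + expo a) \<in> supported (bei_vars W)"
  then show "cl m \<in> supported (bei_vars W)"
    using supported_bei_vars[of "m + expo a" W] supported_bei_vars[of m W] by (simp add: supp_add_nat)
qed

lemma closed_YVar: "W \<subseteq> V \<Longrightarrow> cls.class_closed (supported (YVar ` W))"
  unfolding cls.class_closed_def
proof (intro ballI allI impI)
  fix a m assume "W \<subseteq> V" "a \<in> bei_vars V" "supp m \<subseteq> bei_vars V"
    and "cl (m + expo a) \<in> supported (YVar ` W)"
  then show "cl m \<in> supported (YVar ` W)"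
    using supported_YVar[of "m + expo a" W] supported_YVar[of m W] by (simp add: supp_add_nat)
qed

lemma class_cases:
  assumes "\<kappa> \<in> supported B" "B \<subseteq> bei_vars V"
  obtains m where "\<kappa> = cl m" "supp m \<subseteq> B" "supp m \<subseteq> bei_vars V"
  using assms unfolding supported_def by blast

text \<open>The quotient is the polynomial ring in the y_u with \<open>u \<in> U\<close>, built up
  from the field one regular variable at a time.\<close>

lemma vanishes_supported_YVar:
  assumes "i \<noteq> j" "finite U" "U \<subseteq> V"
  shows "vanishes S (cls.I (supported (YVar ` U))) i j"
  using assms(2,3)
proof (induction U)
  case empty
  have "supported (YVar ` {}) = {cl 0}" unfolding supported_def by auto
  then show ?case using cls.vanishes_class_irrelevant[OF assms(1)] by simp
next
  case (insert v U)
  have sub: "YVar ` insert v U \<subseteq> bei_vars V" "YVar ` U \<subseteq> bei_vars V" "v \<in> V"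
    using insert.prems by auto
  have "supported (YVar ` insert v U) - cls.multiples (YVar v) = supported (YVar ` U)" (is "?L = ?R")
  proof
    show "?L \<subseteq> ?R"
    proof
      fix \<kappa> assume \<kappa>: "\<kappa> \<in> ?L"
      then obtain m where m: "\<kappa> = cl m" "supp m \<subseteq> YVar ` insert v U" "supp m \<subseteq> bei_vars V"
        using class_cases[OF _ sub(1)] by blast
      then have "YVar v \<notin> supp m" using multiplesI[of m "YVar v"] \<kappa> by auto
      then show "\<kappa> \<in> ?R" using m unfolding supported_def by blast
    qed
    show "?R \<subseteq> ?L"
    proof
      fix \<kappa> assume \<kappa>: "\<kappa> \<in> ?R"
      then obtain m where m: "\<kappa> = cl m" "supp m \<subseteq> YVar ` U" "supp m \<subseteq> bei_vars V"
        using class_cases[OF _ sub(2)] by blast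
      then have "\<not> fst (cl m) v > 0" using insert.hyps unfolding bei_class_fst_pos by auto
      moreover have "cl m \<in> supported (YVar ` insert v U)" using m(2) unfolding supported_def by auto
      ultimately show "\<kappa> \<in> ?L" using m(1) multiples_YVar[OF sub(3), of m] by auto
    qed
  qed
  then have van: "vanishes S (cls.I (supported (YVar ` insert v U) - cls.multiples (YVar v))) i j"
    using insert sub by simp
  have reg: "cl (m + expo (YVar v)) \<in> supported (YVar ` insert v U)"
    if "supp m \<subseteq> bei_vars V" "cl m \<in> supported (YVar ` insert v U)" for m
    using that supported_YVar[OF that(1) insert.prems] unfolding supported_def by (auto simp: supp_add_nat)
  show ?case
    using sub(3) by (intro cls.vanishes_class_regular[OF closed_YVar[OF insert.prems] _ reg van]) simp
qed

text \<open>
  The ideal in question is \<open>J\<^sub>W\<close> plus all variables outside \<open>W\<close>. For \<open>W \<union> {v}\<close> it has \<open>x\<^sub>v\<close> as a regular element;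
  once \<open>x\<^sub>v\<close> is added, its colon by \<open>y\<^sub>v\<close> is generated by variables, and adding \<open>y\<^sub>v\<close> gives the ideal for \<open>W\<close>.
\<close>

lemma vanishes_supported_bei_vars:
  assumes "j > i + 1" "finite W" "W \<subseteq> V"
  shows "vanishes S (cls.I (supported (bei_vars W))) i j"
  using assms(2,3)
proof (induction W)
  case empty
  have "supported (bei_vars {}) = {cl 0}" unfolding supported_def bei_vars_def by auto
  then show ?case using cls.vanishes_class_irrelevant[of i j] assms(1) by simp
next
  case (insert v W)
  let ?C = "supported (bei_vars (insert v W))"
  let ?D = "?C - cls.multiples (XVar v)"
  have sub: "bei_vars (insert v W) \<subseteq> bei_vars V" "bei_vars W \<subseteq> bei_vars V" "v \<in> V" "W \<subseteq> V"
    using insert.prems unfolding bei_vars_def by auto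
  have "?D - cls.multiples (YVar v) = supported (bei_vars W)" (is "?L = ?R")
  proof
    show "?L \<subseteq> ?R"
    proof
      fix \<kappa> assume \<kappa>: "\<kappa> \<in> ?L"
      then obtain m where m: "\<kappa> = cl m" "supp m \<subseteq> bei_vars (insert v W)" "supp m \<subseteq> bei_vars V"
        using class_cases[OF _ sub(1)] by blast
      then have "YVar v \<notin> supp m" "XVar v \<notin> supp m"
        using multiplesI[of m "YVar v"] multiplesI[of m "XVar v"] \<kappa> by auto
      then have "supp m \<subseteq> bei_vars W" using m(2) unfolding bei_vars_def by blast
      then show "\<kappa> \<in> ?R" using m unfolding supported_def by blast
    qed
    show "?R \<subseteq> ?L"
    proof
      fix \<kappa> assume \<kappa>: "\<kappa> \<in> ?R"
      then obtain m where m: "\<kappa> = cl m" "supp m \<subseteq> bei_vars W" "supp m \<subseteq> bei_vars V"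
        using class_cases[OF _ sub(2)] by blast
      then have "\<not> fst (cl m) v > 0" using insert.hyps unfolding bei_class_fst_pos by auto
      moreover have "cl m \<in> ?C" using m(2) unfolding supported_def bei_vars_def by auto
      ultimately show "\<kappa> \<in> ?L"
        using m(1) multiples_YVar[OF sub(3), of m] multiples_XVar[OF m(3) sub(3)] by auto
    qed
  qed
  then have quot: "vanishes S (cls.I (?D - cls.multiples (YVar v))) i j" using insert sub by simp
  \<comment> \<open>The product y_v m escapes being congruent to a multiple of x_v exactly when
    \<open>m\<close> contains no x-variable at all.\<close>
  have "cls.class_colon (YVar v) ?D = supported (YVar ` insert v W)" (is "?L = ?R")
  proof
    show "?L \<subseteq> ?R"
    proof
      fix \<kappa> assume "\<kappa> \<in> ?L"
      then obtain m where m: "\<kappa> = cl m" "supp m \<subseteq> bei_vars V" "cl (m + expo (YVar v)) \<in> ?D"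
        unfolding cls.class_colon_def by blast
      have mY: "supp (m + expo (YVar v)) \<subseteq> bei_vars V" using m(2) sub(3) by (simp add: supp_add_nat)
      then have W: "supp m \<subseteq> bei_vars (insert v W)"
        using supported_bei_vars[OF mY insert.prems] m(3) by (simp add: supp_add_nat)
      have "\<not> snd (cl (m + expo (YVar v))) > 0"
        using multiples_XVar[OF mY sub(3)] m(3) sub(3) finite_V by (auto simp: bei_class_add bei_class_expo)
      then have "XVar w \<notin> supp m" for w
        using m(2) unfolding bei_class_snd_pos[OF finite_V] by (auto simp: supp_add_nat)
      then have "supp m \<subseteq> YVar ` insert v W" using W unfolding bei_vars_def by blast
      then show "\<kappa> \<in> ?R" using m(1) unfolding supported_def by blast
    qed
    show "?R \<subseteq> ?L"
    proof
      have Y: "YVar ` insert v W \<subseteq> bei_vars V" using insert.prems by auto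
      fix \<kappa> assume "\<kappa> \<in> ?R"
      then obtain m where m: "\<kappa> = cl m" "supp m \<subseteq> YVar ` insert v W" "supp m \<subseteq> bei_vars V"
        using class_cases[OF _ Y] by blast
      then have mY: "supp (m + expo (YVar v)) \<subseteq> bei_vars V" using sub(3) by (simp add: supp_add_nat)
      have "\<not> snd (cl (m + expo (YVar v))) > 0"
        using m(2) unfolding bei_class_snd_pos[OF finite_V] by (auto simp: supp_add_nat)
      then have "cl (m + expo (YVar v)) \<notin> cls.multiples (XVar v)"
        using multiples_XVar[OF mY sub(3)] by simp
      moreover have "supp (m + expo (YVar v)) \<subseteq> bei_vars (insert v W)"
        using m(2) by (auto simp: supp_add_nat)
      then have "cl (m + expo (YVar v)) \<in> ?C" unfolding supported_def by blast
      ultimately show "\<kappa> \<in> ?L" unfolding cls.class_colon_def using m by blast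
    qed
  qed
  \<comment> \<open>Division by y_v lowers the internal degree by one, so the off-diagonal condition
    reads \<open>i \<noteq> j - 1\<close>; this is the source of the bound
    \<open>j > i + 1\<close>.\<close>
  then have colon: "vanishes S (cls.I (cls.class_colon (YVar v) ?D)) i (j - 1)"
    using vanishes_supported_YVar[of i "j - 1" "insert v W"] assms(1) insert by simp
  have "cls.class_closed ?D"
    using sub(3) cls.class_closed_diff_multiples[OF closed_bei_vars[OF insert.prems]] by simp
  then have van: "vanishes S (cls.I ?D) i j"
    using sub(3) by (intro cls.vanishes_class_colon[OF _ _ colon quot]) simp_all
  have reg: "cl (m + expo (XVar v)) \<in> ?C" if "supp m \<subseteq> bei_vars V" "cl m \<in> ?C" for m
    using that supported_bei_vars[OF that(1) insert.prems] unfolding supported_def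
    by (auto simp: supp_add_nat)
  show ?case
    using sub(3) by (intro cls.vanishes_class_regular[OF closed_bei_vars[OF insert.prems] _ reg van]) simp
qed

section \<open>The ideal of the complete graph as a class ideal\<close>

abbreviation J_complete :: "('v bvar, 'k) mpoly set" where
  "J_complete \<equiv> binomial_edge_ideal V (complete_edges V)"

lemma edge_binomial_in_J_complete:
  "u \<in> V \<Longrightarrow> v \<in> V \<Longrightarrow> c \<in> poly_ring (bei_vars V) \<Longrightarrow> u \<noteq> v \<Longrightarrow> c * edge_binomial u v \<in> J_complete"
  unfolding binomial_edge_ideal_def by (rule ideal_gen_gen) (auto simp: complete_edges_def)

text \<open>
  Variables common to both monomials can be cancelled; if there are none, one exchange
  \<open>x\<^sub>u y\<^sub>v \<mapsto> y\<^sub>u x\<^sub>v\<close> in the second monomial creates one.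
\<close>

lemma monom_congruent:
  assumes "supp m \<subseteq> bei_vars V" "supp n \<subseteq> bei_vars V" "cl m = cl n"
  shows "monom m 1 - monom n 1 \<in> J_complete"
  using assms
proof (induction "mon_degree m" arbitrary: m n rule: less_induct)
  case less
  have common: "monom m 1 - monom n 1 \<in> J_complete"
    if a: "a \<in> supp m" "a \<in> supp n" and n: "supp n \<subseteq> bei_vars V" "cl m = cl n" for a n
  proof -
    have aV: "a \<in> bei_vars V" using a less.prems(1) by blast
    have eq: "(m - expo a) + expo a = m" "(n - expo a) + expo a = n"
      using a by (auto intro: expo_minus_add)
    then have "mon_degree m = mon_degree (m - expo a) + 1"
      by (metis mon_degree_add mon_degree_expo)
    moreover have "cl (m - expo a) = cl (n - expo a)"
      using cls.class_cancel[OF aV, of "m - expo a" "n - expo a"] eq n(2) by simp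
    ultimately have "monom (m - expo a) 1 - monom (n - expo a) 1 \<in> J_complete"
      using less.prems(1) n(1) supp_minus_nat[of m "expo a"] supp_minus_nat[of n "expo a"]
      by (intro less.hyps) auto
    then have "indet a * (monom (m - expo a) 1 - monom (n - expo a) 1) \<in> J_complete"
      unfolding binomial_edge_ideal_def by (rule ideal_gen_mult) (rule poly_ring_indet[OF aV])
    then show ?thesis
      by (simp add: indet_eq_monom right_diff_distrib mult_single add.commute[of "expo a"] eq)
  qed
  show ?case
  proof (cases "\<exists>a. a \<in> supp m \<and> a \<in> supp n")
    case True
    then show ?thesis using common less.prems by blast
  next
    case disjoint: False
    show ?thesis
    proof (cases "m = 0")
      case True
      then have "mon_degree n = 0" using cls.class_degree[OF less.prems] by simp
      then show ?thesis using True by (simp add: mon_degree_eq_zero binomial_edge_ideal_def ideal_gen_zero)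
    next
      case False
      then obtain a where a: "a \<in> supp m" by (metis in_keys_iff lookup_zero poly_mapping_eqI)
      have swap: "monom m 1 - monom n 1 \<in> J_complete"
        if uv: "u \<in> V" "v \<in> V" and n: "XVar u \<in> supp n" "YVar v \<in> supp n"
          and m: "YVar u \<in> supp m \<or> XVar v \<in> supp m" for u v
      proof -
        have "u \<noteq> v" using n m disjoint by blast
        define r where "r = n - expo (YVar v) - expo (XVar u)"
        have "XVar u \<in> supp (n - expo (YVar v))"
          using n by (auto simp: in_keys_iff lookup_minus coef_expo)
        then have eq: "n = r + expo (XVar u) + expo (YVar v)"
          unfolding r_def using expo_minus_add[OF n(2)] by (simp add: expo_minus_add)
        let ?n = "r + expo (YVar u) + expo (XVar v)"
        have r: "supp r \<subseteq> bei_vars V" using less.prems(2) unfolding eq by (simp add: supp_add_nat)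
        then have n': "supp ?n \<subseteq> bei_vars V" using uv by (simp add: supp_add_nat)
        have "cl ?n = cl n" unfolding eq using class_swap[OF uv] by simp
        moreover obtain b where "b \<in> supp m" "b \<in> supp ?n"
          using m by (auto simp: supp_add_nat)
        ultimately have "monom m 1 - monom ?n 1 \<in> J_complete"
          using common[of b ?n] less.prems(3) n' by simp
        moreover have "monom ?n 1 - monom n 1 = monom r (1 :: 'k) * edge_binomial v u"
          unfolding eq edge_binomial_def indet_eq_monom by (simp add: right_diff_distrib mult_single ac_simps)
        then have "monom ?n 1 - monom n 1 \<in> J_complete"
          using uv \<open>u \<noteq> v\<close> r edge_binomial_in_J_complete[of v u "monom r 1"]
          by (simp add: monom_in_poly_ring)
        ultimately have "(monom m 1 - monom ?n 1) + (monom ?n 1 - monom n 1) \<in> J_complete"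
          unfolding binomial_edge_ideal_def by (rule ideal_gen_add)
        then show ?thesis by simp
      qed
      show ?thesis
      proof (cases a)
        case (XVar v)
        then have v: "v \<in> V" using a less.prems(1) by auto
        have "fst (cl m) v > 0" using a XVar bei_class_fst_pos[of V m v] by blast
        then have "YVar v \<in> supp n"
          using less.prems(3) bei_class_fst_pos[of V n v] a XVar disjoint by auto
        moreover have "snd (cl m) > 0" using a XVar v bei_class_snd_pos[OF finite_V, of m] by blast
        then obtain u where "u \<in> V" "XVar u \<in> supp n"
          using less.prems(3) bei_class_snd_pos[OF finite_V, of n] by auto
        ultimately show ?thesis using swap v a XVar by blast
      next
        case (YVar u)
        then have u: "u \<in> V" using a less.prems(1) by auto
        have "fst (cl m) u > 0" using a YVar bei_class_fst_pos[of V m u] by blast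
        then have "XVar u \<in> supp n"
          using less.prems(3) bei_class_fst_pos[of V n u] a YVar disjoint by auto
        \<comment> \<open>The class also determines the number of y-variables, as degree minus
          number of x-variables, and \<open>m\<close> contains at least y_u.\<close>
        moreover have "\<exists>v\<in>V. YVar v \<in> supp n"
        proof (rule ccontr)
          assume "\<not> (\<exists>v\<in>V. YVar v \<in> supp n)"
          then have "(\<Sum>v\<in>V. coef n (YVar v)) = 0" by (simp add: in_keys_iff)
          moreover have "(\<Sum>v\<in>V. coef m (YVar v)) = (\<Sum>v\<in>V. coef n (YVar v))"
          proof -
            have "(\<Sum>v\<in>V. fst (cl m) v) - snd (cl m) = (\<Sum>v\<in>V. coef m (YVar v))" for m
              unfolding bei_class_def by (simp add: sum.distrib)
            from this[of m] this[of n] show ?thesis using less.prems(3) by simp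
          qed
          ultimately have "coef m (YVar u) = 0" using u finite_V by simp
          then show False using a YVar by (simp add: in_keys_iff)
        qed
        ultimately show ?thesis using swap u a YVar by blast
      qed
    qed
  qed
qed

text \<open>Replacing every monomial of \<open>p\<close> by a chosen representative of its class
  gives zero, as the class sums vanish; hence \<open>p\<close> is a combination of differences of
  congruent monomials.\<close>

lemma class_ideal_subset_J_complete: "class_ideal (bei_vars V) cl (supported (bei_vars V)) \<subseteq> J_complete"
proof
  fix p :: "('v bvar, 'k) mpoly" assume p: "p \<in> class_ideal (bei_vars V) cl (supported (bei_vars V))"
  then have supp: "supp m \<subseteq> bei_vars V" if "m \<in> supp p" for m
    using that unfolding class_ideal_def poly_ring_def by blast
  define rep where "rep \<kappa> = (SOME m. m \<in> supp p \<and> cl m = \<kappa>)" for \<kappa>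
  have rep: "rep (cl m) \<in> supp p" "cl (rep (cl m)) = cl m" if "m \<in> supp p" for m
    using someI[of "\<lambda>n. n \<in> supp p \<and> cl n = cl m" m] that unfolding rep_def by blast+
  have "(\<Sum>m\<in>supp p. monom (rep (cl m)) (coef p m))
      = (\<Sum>\<kappa>\<in>cl ` supp p. \<Sum>m\<in>{m \<in> supp p. cl m = \<kappa>}. monom (rep (cl m)) (coef p m))"
    by (rule sum.image_gen) simp
  also have "\<dots> = (\<Sum>\<kappa>\<in>cl ` supp p. monom (rep \<kappa>) (class_sum cl p \<kappa>))"
    unfolding class_sum_def
  proof (rule sum.cong)
    have monom_sum: "(\<Sum>m\<in>B. monom n (c m)) = monom n (\<Sum>m\<in>B. c m)" for B n and c :: "_ \<Rightarrow> 'k"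
      by (induction B rule: infinite_finite_induct) (auto simp: single_add)
    show "(\<Sum>m\<in>{m \<in> supp p. cl m = \<kappa>}. monom (rep (cl m)) (coef p m))
        = monom (rep \<kappa>) (\<Sum>m\<in>{m \<in> supp p. cl m = \<kappa>}. coef p m)" for \<kappa>
      unfolding monom_sum[symmetric] by (rule sum.cong) auto
  qed simp
  also have "\<dots> = 0"
    using p supp unfolding class_ideal_def supported_def by (intro sum.neutral) auto
  finally have zero: "(\<Sum>m\<in>supp p. monom (rep (cl m)) (coef p m)) = 0" .
  have "p = (\<Sum>m\<in>supp p. monom m (coef p m))" by (rule poly_sum_monom) auto
  also have "\<dots> = (\<Sum>m\<in>supp p. monom m (coef p m)) - (\<Sum>m\<in>supp p. monom (rep (cl m)) (coef p m))"
    using zero by simp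
  also have "\<dots> = (\<Sum>m\<in>supp p. monom 0 (coef p m) * (monom m 1 - monom (rep (cl m)) 1))"
    unfolding sum_subtractf[symmetric] by (simp add: right_diff_distrib mult_single)
  also have "\<dots> \<in> J_complete"
  proof -
    have "monom m 1 - monom (rep (cl m)) 1 \<in> J_complete" if "m \<in> supp p" for m
      using supp rep that by (intro monom_congruent) auto
    then show ?thesis
      unfolding binomial_edge_ideal_def by (intro ideal_gen_sum ideal_gen_mult monom_in_poly_ring) auto
  qed
  finally show "p \<in> J_complete" .
qed

lemma J_complete_subset_class_ideal: "J_complete \<subseteq> class_ideal (bei_vars V) cl (supported (bei_vars V))"
proof
  let ?I = "class_ideal (bei_vars V) cl (supported (bei_vars V)) :: ('v bvar, 'k) mpoly set"
  fix p :: "('v bvar, 'k) mpoly" assume "p \<in> J_complete"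
  then show "p \<in> ?I"
    unfolding binomial_edge_ideal_def
  proof (rule ideal_gen_closed)
    fix c b :: "('v bvar, 'k) mpoly"
    assume c: "c \<in> poly_ring (bei_vars V)" and "b \<in> {edge_binomial i j |i j. {i, j} \<in> complete_edges V}"
    then obtain u v where uv: "b = edge_binomial u v" "u \<in> V" "v \<in> V"
      unfolding complete_edges_def by (auto simp: doubleton_eq_iff)
    let ?m = "expo (XVar u) + expo (YVar v)" and ?n = "expo (XVar v) + expo (YVar u)"
    have b: "b = monom ?m 1 - monom ?n 1"
      unfolding uv edge_binomial_def indet_eq_monom by (simp add: mult_single)
    have "c * b = (\<Sum>m\<in>supp c. monom m (coef c m)) * b"
      using poly_sum_monom[of "supp c" c] by simp
    also have "\<dots> = (\<Sum>m\<in>supp c. monom (m + ?m) (coef c m) - monom (m + ?n) (coef c m))"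
      unfolding b by (simp add: sum_distrib_right right_diff_distrib mult_single sum_subtractf)
    finally have cb: "c * b = (\<Sum>m\<in>supp c. monom (m + ?m) (coef c m) - monom (m + ?n) (coef c m))" .
    have "cl (m + ?m) = cl (m + ?n)" for m
      using class_swap[OF uv(2,3), of m] by (simp add: ac_simps)
    then have "class_sum cl (c * b) \<kappa> = 0" for \<kappa>
      unfolding cb class_sum_sum class_sum_diff class_sum_monom by simp
    moreover have "c * b \<in> poly_ring (bei_vars V)"
      unfolding b using c uv
      by (intro poly_ring_mult poly_ring_diff monom_in_poly_ring) (auto simp: supp_add_nat)
    ultimately show "c * b \<in> ?I" unfolding class_ideal_def by blast
  qed (auto simp: class_ideal_def poly_ring_zero poly_ring_add class_sum_add)
qed

text \<open>In 0 -> J -> S -> S/J -> 0 the ring has no homology in these degrees, so Tor_i(J) is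
  controlled by Tor_{i+1}(S/J), for which the bound is \<open>j > (i + 1) + 1\<close>.\<close>

lemma vanishes_J_complete:
  assumes "j > i + 2"
  shows "vanishes (graded_part J_complete) Null i j"
proof -
  have "vanishes S (graded_part J_complete) (i + 1) j"
    using vanishes_supported_bei_vars[of "i + 1" j V] assms finite_V
      class_ideal_subset_J_complete J_complete_subset_class_ideal by (simp add: subset_antisym)
  moreover have "vanishes S Null i j"
  proof (cases "i < 0")
    case True
    then show ?thesis using vanishes_negative[OF graded_family_poly_ring] by blast
  next
    case False
    then show ?thesis using vanishes_ring[of i j] assms by simp
  qed
  moreover have "graded_part J_complete d \<subseteq> S d" for d
    using J_complete_subset_class_ideal unfolding class_ideal_def graded_part_def by blast
  moreover have "Null d \<subseteq> graded_part J_complete d" for d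
    unfolding graded_part_def binomial_edge_ideal_def using ideal_gen_zero by blast
  moreover have "graded (graded_part J_complete)"
    unfolding binomial_edge_ideal_def by (rule graded_family_ideal_gen)
  ultimately show ?thesis
    using vanishes_sub[of Null "graded_part J_complete" S i j]
    by (simp add: graded_family_zero graded_family_poly_ring)
qed

end

section \<open>Homogeneous components\<close>

text \<open>Serves twice: with a condition on degrees it gives homogeneous components
  (\<open>hcomp\<close>), with a condition on variables it sets variables to zero
  (\<open>proj\<close>).\<close>

definition restrict_supp :: "('a \<Rightarrow> bool) \<Rightarrow> ('a \<Rightarrow>\<^sub>0 'k::comm_monoid_add) \<Rightarrow> 'a \<Rightarrow>\<^sub>0 'k" where
  "restrict_supp P p = (\<Sum>m\<in>{m \<in> supp p. P m}. Poly_Mapping.single m (coef p m))"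

lemma coef_restrict_supp: "coef (restrict_supp P p) m = (if P m then coef p m else 0)"
proof -
  have "coef (restrict_supp P p) m = (\<Sum>n\<in>{n \<in> supp p. P n}. if n = m then coef p m else 0)"
    unfolding restrict_supp_def lookup_sum
    by (intro sum.cong refl) (auto simp: lookup_single)
  also have "\<dots> = (if P m then coef p m else 0)"
    by (auto simp: in_keys_iff)
  finally show ?thesis .
qed

lemma supp_restrict_supp: "supp (restrict_supp P p) = {m \<in> supp p. P m}"
  by (auto simp: in_keys_iff coef_restrict_supp split: if_splits)

lemma restrict_supp_zero [simp]: "restrict_supp P 0 = 0"
  by (rule poly_mapping_eqI) (simp add: coef_restrict_supp)

lemma restrict_supp_add: "restrict_supp P (p + q) = restrict_supp P p + restrict_supp P q"
  by (rule poly_mapping_eqI) (simp add: coef_restrict_supp lookup_add)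

lemma restrict_supp_sum: "restrict_supp P (sum f I) = (\<Sum>i\<in>I. restrict_supp P (f i))"
  by (induction I rule: infinite_finite_induct) (auto simp: restrict_supp_add)

lemma restrict_supp_id: "(\<And>m. m \<in> supp p \<Longrightarrow> P m) \<Longrightarrow> restrict_supp P p = p"
  by (rule poly_mapping_eqI) (auto simp: coef_restrict_supp in_keys_iff)

lemma restrict_supp_none: "(\<And>m. m \<in> supp p \<Longrightarrow> \<not> P m) \<Longrightarrow> restrict_supp P p = 0"
  by (rule poly_mapping_eqI) (auto simp: coef_restrict_supp in_keys_iff)

definition hcomp :: "int \<Rightarrow> ('x, 'k::comm_ring_1) mpoly \<Rightarrow> ('x, 'k) mpoly" where
  "hcomp d = restrict_supp (\<lambda>m. int (mon_degree m) = d)"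

lemma hcomp_homogeneous: "hcomp d p \<in> homogeneous d"
  unfolding hcomp_def homogeneous_def by (simp add: supp_restrict_supp)

lemma hcomp_of_homogeneous: "p \<in> homogeneous e \<Longrightarrow> hcomp d p = (if d = e then p else 0)"
  unfolding hcomp_def homogeneous_def by (auto intro: restrict_supp_id restrict_supp_none)

lemma hcomp_zero [simp]: "hcomp d 0 = 0"
  unfolding hcomp_def by simp

lemma hcomp_sum: "hcomp d (sum f I) = (\<Sum>i\<in>I. hcomp d (f i))"
  unfolding hcomp_def by (rule restrict_supp_sum)

lemma hcomp_add: "hcomp d (p + q) = hcomp d p + hcomp d q"
  unfolding hcomp_def by (rule restrict_supp_add)

lemma hcomp_poly_ring: "p \<in> poly_ring A \<Longrightarrow> hcomp d p \<in> poly_ring A"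
  unfolding hcomp_def poly_ring_def by (simp add: supp_restrict_supp)

lemma hcomp_mult:
  assumes q: "q \<in> homogeneous e"
  shows "hcomp d (p * q) = hcomp (d - e) p * q"
proof -
  have monom: "hcomp d (monom m c * q) = hcomp (d - e) (monom m c) * q" for m c
  proof -
    have "monom m c * q \<in> homogeneous (int (mon_degree m) + e)"
      using homogeneous_mult[OF homogeneous_monom q] by blast
    then have "hcomp d (monom m c * q) = (if d = int (mon_degree m) + e then monom m c * q else 0)"
      by (rule hcomp_of_homogeneous)
    moreover have "hcomp (d - e) (monom m c) = (if d - e = int (mon_degree m) then monom m c else 0)"
      by (rule hcomp_of_homogeneous) (simp add: homogeneous_monom)
    ultimately show ?thesis by auto
  qed
  have p: "p = (\<Sum>m\<in>supp p. monom m (coef p m))" by (rule poly_sum_monom) auto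
  have "hcomp d (p * q) = (\<Sum>m\<in>supp p. hcomp d (monom m (coef p m) * q))"
    by (subst p) (simp only: sum_distrib_right hcomp_sum)
  also have "\<dots> = hcomp (d - e) (\<Sum>m\<in>supp p. monom m (coef p m)) * q"
    by (simp only: monom hcomp_sum sum_distrib_right)
  finally show ?thesis unfolding p[symmetric] .
qed

lemma sum_hcomp:
  assumes "finite E" "(\<lambda>m. int (mon_degree m)) ` supp p \<subseteq> E"
  shows "(\<Sum>d\<in>E. hcomp d p) = p"
proof (rule poly_mapping_eqI)
  fix m
  have "coef (\<Sum>d\<in>E. hcomp d p) m = (\<Sum>d\<in>E. if int (mon_degree m) = d then coef p m else 0)"
    unfolding lookup_sum hcomp_def coef_restrict_supp ..
  also have "\<dots> = coef p m"
    using assms by (cases "m \<in> supp p") (auto simp: in_keys_iff)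
  finally show "coef (\<Sum>d\<in>E. hcomp d p) m = coef p m" .
qed

lemma hcomp_ideal_gen:
  fixes p :: "('x, 'k::comm_ring_1) mpoly"
  assumes "B \<subseteq> homogeneous e" "p \<in> ideal_gen A B"
  shows "hcomp d p \<in> ideal_gen A B"
proof -
  have "p \<in> {p. hcomp d p \<in> ideal_gen A B}"
    using assms(2)
  proof (rule ideal_gen_closed)
    fix c b :: "('x, 'k) mpoly" assume "c \<in> poly_ring A" "b \<in> B"
    then show "c * b \<in> {p. hcomp d p \<in> ideal_gen A B}"
      using hcomp_mult[of b e d c] assms(1) ideal_gen_gen[OF hcomp_poly_ring, of c A b B "d - e"] by auto
  qed (auto simp: ideal_gen_zero hcomp_add ideal_gen_add)
  then show ?thesis by blast
qed


section \<open>Graded submodules of free modules are finitely generated\<close>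

type_synonym ('x, 'k) pvec = "nat \<Rightarrow> ('x, 'k) mpoly"

definition smul :: "('x, 'k::comm_ring_1) mpoly \<Rightarrow> ('x, 'k) pvec \<Rightarrow> ('x, 'k) pvec" where
  "smul c u = (\<lambda>l. c * u l)"

definition vcomp :: "int list \<Rightarrow> int \<Rightarrow> ('x, 'k::comm_ring_1) pvec \<Rightarrow> ('x, 'k) pvec" where
  "vcomp ds d u = (\<lambda>l. if l < length ds then hcomp (d - ds ! l) (u l) else 0)"

definition vec_part :: "'x set \<Rightarrow> int list \<Rightarrow> int \<Rightarrow> ('x, 'k::comm_ring_1) pvec set" where
  "vec_part A ds d = {u \<in> free_mod A (length ds). \<forall>l<length ds. u l \<in> homogeneous (d - ds ! l)}"

definition graded_submodule :: "'x set \<Rightarrow> int list \<Rightarrow> ('x, 'k::comm_ring_1) pvec set \<Rightarrow> bool" where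
  "graded_submodule A ds Z \<longleftrightarrow> Z \<subseteq> free_mod A (length ds) \<and> 0 \<in> Z \<and> (\<forall>u\<in>Z. \<forall>v\<in>Z. u - v \<in> Z) \<and>
    (\<forall>c\<in>poly_ring A. \<forall>u\<in>Z. smul c u \<in> Z) \<and> (\<forall>d. \<forall>u\<in>Z. vcomp ds d u \<in> Z)"

text \<open>Generators are stored with their degrees: the zero vector is homogeneous of every
  degree, so the degree cannot be recovered from the vector, and the basis degrees of a cover are
  later read off as first components.\<close>

definition combination :: "(int \<times> ('x, 'k::comm_ring_1) pvec) set \<Rightarrow>
    (int \<times> ('x, 'k) pvec \<Rightarrow> ('x, 'k) mpoly) \<Rightarrow> ('x, 'k) pvec" where
  "combination G c = (\<lambda>l. \<Sum>g\<in>G. c g * snd g l)"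

definition combinations :: "'x set \<Rightarrow> (int \<times> ('x, 'k::comm_ring_1) pvec) set \<Rightarrow> ('x, 'k) pvec set" where
  "combinations A G = {combination G c |c. \<forall>g\<in>G. c g \<in> poly_ring A}"

lemma sum_fun_apply: "(sum f I) l = (\<Sum>i\<in>I. f i l)"
  by (induction I rule: infinite_finite_induct) auto

lemma combinations_zero: "0 \<in> combinations A G"
  unfolding combinations_def combination_def
  by (intro CollectI exI[of _ "\<lambda>_. 0"]) (auto simp: poly_ring_zero zero_fun_def)

lemma combinations_add:
  assumes "u \<in> combinations A G" "v \<in> combinations A G"
  shows "u + v \<in> combinations A G"
proof -
  obtain c e where c: "u = combination G c" "\<forall>g\<in>G. c g \<in> poly_ring A"
    and e: "v = combination G e" "\<forall>g\<in>G. e g \<in> poly_ring A"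
    using assms unfolding combinations_def by blast
  have "u + v = combination G (\<lambda>g. c g + e g)"
    unfolding c e combination_def by (simp add: fun_eq_iff algebra_simps sum.distrib)
  then show ?thesis unfolding combinations_def using c e poly_ring_add by blast
qed

lemma combinations_smul:
  assumes "u \<in> combinations A G" "a \<in> poly_ring A"
  shows "smul a u \<in> combinations A G"
proof -
  obtain c where c: "u = combination G c" "\<forall>g\<in>G. c g \<in> poly_ring A"
    using assms unfolding combinations_def by blast
  have "smul a u = combination G (\<lambda>g. a * c g)"
    unfolding c combination_def smul_def by (simp add: fun_eq_iff sum_distrib_left mult.assoc)
  then show ?thesis unfolding combinations_def using c assms poly_ring_mult by blast
qed

lemma combinations_gen:
  assumes "finite G" "(d, g) \<in> G"
  shows "g \<in> combinations A G"
proof -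
  have "g = combination G (\<lambda>h. if h = (d, g) then 1 else 0)"
    unfolding combination_def using assms by (simp add: fun_eq_iff if_distrib[of "\<lambda>x. x * _"] cong: if_cong)
  then show ?thesis
    unfolding combinations_def by (auto intro!: exI[of _ "\<lambda>h. if h = (d, g) then 1 else 0"]
      simp: poly_ring_one poly_ring_zero)
qed

lemma combinations_diff:
  assumes "u \<in> combinations A G" "v \<in> combinations A G"
  shows "u - v \<in> combinations A G"
proof -
  have "smul (- 1) v \<in> combinations A G"
    using assms by (intro combinations_smul poly_ring_minus poly_ring_one)
  moreover have "u - v = u + smul (- 1) v" by (simp add: smul_def fun_eq_iff)
  ultimately show ?thesis using combinations_add[OF assms(1)] by metis
qed

lemma combinations_sum: "(\<And>i. i \<in> I \<Longrightarrow> f i \<in> combinations A G) \<Longrightarrow> sum f I \<in> combinations A G"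
  by (induction I rule: infinite_finite_induct) (auto simp: combinations_zero combinations_add)

lemma combinations_subset:
  assumes "graded_submodule A ds Z" "\<And>d g. (d, g) \<in> G \<Longrightarrow> g \<in> Z"
  shows "combinations A G \<subseteq> Z"
proof
  fix u assume "u \<in> combinations A G"
  then obtain c where c: "u = combination G c" "\<forall>g\<in>G. c g \<in> poly_ring A"
    unfolding combinations_def by blast
  have add: "v + w \<in> Z" if "v \<in> Z" "w \<in> Z" for v w
  proof -
    have "0 - w \<in> Z" using assms(1) that unfolding graded_submodule_def by blast
    then have "v - (0 - w) \<in> Z" using assms(1) that unfolding graded_submodule_def by blast
    then show ?thesis by simp
  qed
  have "(\<Sum>g\<in>H. smul (c g) (snd g)) \<in> Z" if "H \<subseteq> G" for H
    using that
  proof (induction H rule: infinite_finite_induct)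
    case (insert g H)
    then have g: "smul (c g) (snd g) \<in> Z"
      using assms c(2) prod.collapse[of g] unfolding graded_submodule_def by (metis insert_subset)
    have "(\<Sum>h\<in>H. smul (c h) (snd h)) \<in> Z" using insert by blast
    from add[OF g this] show ?case by (simp only: sum.insert[OF insert.hyps])
  qed (use assms in \<open>auto simp: graded_submodule_def\<close>)
  moreover have "u = (\<Sum>g\<in>G. smul (c g) (snd g))"
    unfolding c combination_def by (simp add: fun_eq_iff sum_fun_apply smul_def)
  ultimately show "u \<in> Z" by blast
qed

lemma vcomp_vec_part:
  assumes "u \<in> free_mod A (length ds)"
  shows "vcomp ds d u \<in> vec_part A ds d"
  using assms unfolding vec_part_def free_mod_def vcomp_def
  by (auto simp: hcomp_poly_ring hcomp_homogeneous)

lemma vcomp_of_vec_part: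
  assumes "u \<in> vec_part A ds e"
  shows "vcomp ds d u = (if d = e then u else 0)"
  using assms unfolding vec_part_def free_mod_def vcomp_def
  by (auto simp: hcomp_of_homogeneous fun_eq_iff not_less)

lemma sum_vcomp:
  assumes "u \<in> free_mod A (length ds)"
  obtains E where "finite E" "u = (\<Sum>d\<in>E. vcomp ds d u)"
proof -
  define E where "E = (\<Union>l<length ds. (\<lambda>m. int (mon_degree m) + ds ! l) ` supp (u l))"
  have "u l = (\<Sum>d\<in>E. vcomp ds d u) l" for l
  proof (cases "l < length ds")
    case True
    have "(\<Sum>d\<in>E. vcomp ds d u) l = (\<Sum>d\<in>E. hcomp (d - ds ! l) (u l))"
      unfolding sum_fun_apply vcomp_def using True by simp
    also have "\<dots> = (\<Sum>d\<in>(\<lambda>d. d - ds ! l) ` E. hcomp d (u l))"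
      by (subst sum.reindex) (auto intro: inj_onI)
    also have "\<dots> = u l"
      using True unfolding E_def by (intro sum_hcomp) force+
    finally show ?thesis ..
  next
    case False
    then show ?thesis using assms unfolding sum_fun_apply vcomp_def free_mod_def by simp
  qed
  moreover have "finite E" unfolding E_def by simp
  ultimately show ?thesis using that by blast
qed

text \<open>Dickson's lemma, by passing to monotone subsequences one coordinate at a time.\<close>

lemma monotone_subsequences:
  fixes f :: "nat \<Rightarrow> 'c \<Rightarrow> nat"
  assumes "finite C"
  shows "\<exists>\<phi> :: nat \<Rightarrow> nat. strict_mono \<phi> \<and> (\<forall>c\<in>C. \<forall>i j. i \<le> j \<longrightarrow> f (\<phi> i) c \<le> f (\<phi> j) c)"
  using assms
proof (induction C)
  case empty
  then show ?case by (intro exI[of _ "\<lambda>n. n"]) (auto simp: strict_mono_def)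
next
  case (insert c C)
  then obtain \<phi> where \<phi>: "strict_mono (\<phi> :: nat \<Rightarrow> nat)" "\<forall>c\<in>C. \<forall>i j. i \<le> j \<longrightarrow> f (\<phi> i) c \<le> f (\<phi> j) c" by blast
  let ?s = "\<lambda>n. f (\<phi> n) c"
  obtain \<psi> :: "nat \<Rightarrow> nat" where \<psi>: "strict_mono \<psi>" "monoseq (\<lambda>n. ?s (\<psi> n))"
    using seq_monosub[of ?s] by blast
  \<comment> \<open>A decreasing sequence of naturals is constant from the position of its minimum
    on, so in either case some tail is increasing.\<close>
  have "\<exists>N. \<forall>i j. N \<le> i \<longrightarrow> i \<le> j \<longrightarrow> ?s (\<psi> i) \<le> ?s (\<psi> j)"
  proof (cases "\<forall>i j. i \<le> j \<longrightarrow> ?s (\<psi> i) \<le> ?s (\<psi> j)")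
    case False
    then have dec: "?s (\<psi> j) \<le> ?s (\<psi> i)" if "i \<le> j" for i j
      using \<psi>(2) that unfolding monoseq_def by blast
    define N where "N = (ARG_MIN (\<lambda>n. ?s (\<psi> n)) n. True)"
    have "?s (\<psi> N) \<le> ?s (\<psi> n)" for n
      unfolding N_def by (rule arg_min_nat_le) simp
    then show ?thesis using dec by (meson le_trans)
  qed blast
  then obtain N where N: "\<And>i j. N \<le> i \<Longrightarrow> i \<le> j \<Longrightarrow> ?s (\<psi> i) \<le> ?s (\<psi> j)" by blast
  have mono: "\<psi> (i + N) \<le> \<psi> (j + N)" if "i \<le> j" for i j
    using \<psi>(1) that by (simp add: strict_mono_less_eq)
  show ?case
  proof (intro exI[of _ "\<lambda>n. \<phi> (\<psi> (n + N))"] conjI ballI allI impI)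
    show "strict_mono (\<lambda>n. \<phi> (\<psi> (n + N)))"
      using \<phi>(1) \<psi>(1) by (simp add: strict_mono_def)
    fix d i j assume "d \<in> insert c C" "(i::nat) \<le> j"
    then show "f (\<phi> (\<psi> (i + N))) d \<le> f (\<phi> (\<psi> (j + N))) d"
      using N[of "i + N" "j + N"] mono[of i j] \<phi>(2) by auto
  qed
qed

lemma finite_monomials_of_degree:
  assumes "finite A"
  shows "finite {m :: 'x \<Rightarrow>\<^sub>0 nat. supp m \<subseteq> A \<and> mon_degree m = n}"
proof (induction n)
  case 0
  have "{m :: 'x \<Rightarrow>\<^sub>0 nat. supp m \<subseteq> A \<and> mon_degree m = 0} \<subseteq> {0}"
    by (auto simp: mon_degree_eq_zero)
  then show ?case using finite_subset by blast
next
  case (Suc n)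
  let ?M = "{m :: 'x \<Rightarrow>\<^sub>0 nat. supp m \<subseteq> A \<and> mon_degree m = n}"
  have "{m :: 'x \<Rightarrow>\<^sub>0 nat. supp m \<subseteq> A \<and> mon_degree m = Suc n} \<subseteq> (\<Union>a\<in>A. (\<lambda>m. m + expo a) ` ?M)"
  proof
    fix m :: "'x \<Rightarrow>\<^sub>0 nat" assume m: "m \<in> {m. supp m \<subseteq> A \<and> mon_degree m = Suc n}"
    then have "m \<noteq> 0" by auto
    then obtain a where a: "a \<in> supp m" by (metis in_keys_iff lookup_zero poly_mapping_eqI)
    then have eq: "m = (m - expo a) + expo a" by (simp add: expo_minus_add)
    then have "mon_degree m = mon_degree (m - expo a) + 1" by (metis mon_degree_add mon_degree_expo)
    then have "m - expo a \<in> ?M" using m supp_minus_nat[of m "expo a"] by auto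
    then show "m \<in> (\<Union>a\<in>A. (\<lambda>m. m + expo a) ` ?M)" using eq a m by blast
  qed
  then show ?case using Suc assms by (meson finite_UN_I finite_imageI finite_subset)
qed

context poly_koszul
begin

text \<open>
  Terms \<open>x\<^sup>m e\<^sub>k\<close> are ordered by the position \<open>k\<close> and then lexicographically, through an
  additive encoding in \<open>nat \<Rightarrow>\<^sub>0 nat\<close>, whose linear order compares the first differing entry.
\<close>

definition encode_monomial :: "('x \<Rightarrow>\<^sub>0 nat) \<Rightarrow> nat \<Rightarrow>\<^sub>0 nat" where
  "encode_monomial m = (\<Sum>a\<in>A. Poly_Mapping.single (Suc (ord a)) (coef m a))"

definition encode_term :: "nat \<times> ('x \<Rightarrow>\<^sub>0 nat) \<Rightarrow> nat \<Rightarrow>\<^sub>0 nat" where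
  "encode_term t = Poly_Mapping.single 0 (fst t) + encode_monomial (snd t)"

definition terms :: "int list \<Rightarrow> ('x, 'k) pvec \<Rightarrow> (nat \<times> ('x \<Rightarrow>\<^sub>0 nat)) set" where
  "terms ds u = (SIGMA l:{..<length ds}. supp (u l))"

lemma encode_term_add: "encode_term (l, m + t) = encode_term (l, m) + encode_monomial t"
  unfolding encode_term_def encode_monomial_def by (simp add: lookup_add single_add sum.distrib add.assoc)

lemma encode_term_inj:
  assumes "supp m \<subseteq> A" "supp m' \<subseteq> A" "encode_term (l, m) = encode_term (l', m')"
  shows "l = l' \<and> m = m'"
proof -
  have zero: "coef (encode_term (l, m)) 0 = l" for l m
    unfolding encode_term_def encode_monomial_def by (simp add: lookup_add lookup_sum lookup_single)
  have suc: "coef (encode_term (l, m)) (Suc (ord a)) = coef m a" if a: "a \<in> A" for l m a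
  proof -
    have "coef (encode_term (l, m)) (Suc (ord a)) = (\<Sum>b\<in>A. if b = a then coef m a else 0)"
      unfolding encode_term_def encode_monomial_def lookup_add lookup_sum
      using inj_on_ord a by (auto simp: lookup_single when_def inj_on_def intro!: sum.cong)
    then show ?thesis using a finite_vars by simp
  qed
  have "coef m a = coef m' a" for a
  proof (cases "a \<in> A")
    case True
    then show ?thesis using suc[of a l m] suc[of a l' m'] assms(3) by simp
  next
    case False
    then have "a \<notin> supp m" "a \<notin> supp m'" using assms by blast+
    then show ?thesis by (simp add: in_keys_iff)
  qed
  then show ?thesis using zero[of l m] zero[of l' m'] assms(3) by (auto intro: poly_mapping_eqI)
qed

lemma finite_terms: "finite (terms ds u)"
  unfolding terms_def by simp

lemma terms_nonempty:
  assumes "u \<in> free_mod A (length ds)" "u \<noteq> 0"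
  shows "terms ds u \<noteq> {}"
proof
  assume empty: "terms ds u = {}"
  have "u l = 0" for l
  proof (cases "l < length ds")
    case True
    then have "supp (u l) = {}" using empty unfolding terms_def by blast
    then show ?thesis by (metis in_keys_iff empty_iff lookup_zero poly_mapping_eqI)
  qed (use assms(1) in \<open>simp add: free_mod_def\<close>)
  then show False using assms(2) by (simp add: fun_eq_iff)
qed

definition leading :: "int list \<Rightarrow> ('x, 'k) pvec \<Rightarrow> nat \<Rightarrow>\<^sub>0 nat" where
  "leading ds u = Max (encode_term ` terms ds u)"

lemma leading_term:
  assumes "u \<in> free_mod A (length ds)" "u \<noteq> 0"
  obtains l m where "l < length ds" "m \<in> supp (u l)" "leading ds u = encode_term (l, m)"
proof -
  have "leading ds u \<in> encode_term ` terms ds u"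
    unfolding leading_def using terms_nonempty[OF assms] finite_terms by (intro Max_in) auto
  then show ?thesis using that unfolding terms_def by auto
qed

lemma leading_ge: "l < length ds \<Longrightarrow> m \<in> supp (u l) \<Longrightarrow> encode_term (l, m) \<le> leading ds u"
  unfolding leading_def using finite_terms by (intro Max_ge) (auto simp: terms_def)

text \<open>One division step: the multiplier is the quotient of the leading coefficients, and
  homogeneity gives \<open>t\<close> the degree d - e, so the difference stays in degree
  \<open>d\<close>. As the encoding is additive, no term of the multiple of \<open>v\<close> exceeds
  the cancelled one.\<close>

lemma leading_reduce:
  assumes u: "u \<in> vec_part A ds d" and v: "v \<in> vec_part A ds e"
    and l: "l < length ds" and m: "m \<in> supp (v l)" "leading ds v = encode_term (l, m)"
    and mt: "m + t \<in> supp (u l)" "leading ds u = encode_term (l, m + t)"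
  obtains c where "u - smul (monom t c) v \<in> vec_part A ds d" "monom t c \<in> poly_ring A"
    "u - smul (monom t c) v \<noteq> 0 \<Longrightarrow> leading ds (u - smul (monom t c) v) < leading ds u"
proof -
  define c where "c = coef (u l) (m + t) / coef (v l) m"
  define w where "w = u - smul (monom t c) v"
  have "supp (m + t) \<subseteq> A"
    using u mt(1) l unfolding vec_part_def free_mod_def poly_ring_def by blast
  then have t: "supp t \<subseteq> A" by (simp add: supp_add_nat)
  have "int (mon_degree m) = e - ds ! l" "int (mon_degree (m + t)) = d - ds ! l"
    using u v m(1) mt(1) l unfolding vec_part_def homogeneous_def by blast+
  then have deg: "int (mon_degree t) = d - e" by (simp add: mon_degree_add)
  have w: "w \<in> vec_part A ds d"
  proof -
    have "w k \<in> homogeneous (d - ds ! k)" "w k \<in> poly_ring A" if "k < length ds" for k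
    proof -
      have "monom t c * v k \<in> homogeneous (int (mon_degree t) + (e - ds ! k))"
        using v that unfolding vec_part_def by (intro homogeneous_mult homogeneous_monom) auto
      then show "w k \<in> homogeneous (d - ds ! k)"
        unfolding w_def smul_def using u that deg
        by (auto simp: vec_part_def intro: homogeneous_diff)
      show "w k \<in> poly_ring A"
        unfolding w_def smul_def using u v that t
        by (auto simp: vec_part_def free_mod_def intro!: poly_ring_diff poly_ring_mult monom_in_poly_ring)
    qed
    moreover have "w k = 0" if "k \<ge> length ds" for k
      using u v that unfolding w_def smul_def vec_part_def free_mod_def by auto
    ultimately show ?thesis unfolding vec_part_def free_mod_def by auto
  qed
  have "leading ds w < leading ds u" if w0: "w \<noteq> 0"
  proof -
    obtain k n where k: "k < length ds" "n \<in> supp (w k)" "leading ds w = encode_term (k, n)"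
      using leading_term[of w ds] w0 w unfolding vec_part_def by blast
    have "encode_term (k, n) \<le> leading ds u"
    proof -
      consider "n \<in> supp (u k)" | "n \<in> supp (monom t c * v k)"
        using k(2) keys_diff[of "u k" "monom t c * v k"] unfolding w_def smul_def by auto
      then show ?thesis
      proof cases
        case 2
        then obtain n' where n': "n' \<in> supp (v k)" "n = n' + t"
          using supp_monom_mult[of t c "v k"] by blast
        then have "encode_term (k, n) \<le> leading ds v + encode_monomial t"
          using leading_ge[of k ds n' v, OF k(1) n'(1)] encode_term_add by (simp add: add_right_mono)
        then show ?thesis using m(2) mt(2) encode_term_add by simp
      qed (use leading_ge k in auto)
    qed
    moreover have "encode_term (k, n) \<noteq> leading ds u"
    proof
      assume "encode_term (k, n) = leading ds u"
      moreover have "supp n \<subseteq> A"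
        using w k(1,2) unfolding vec_part_def free_mod_def poly_ring_def by blast
      ultimately have "k = l \<and> n = m + t"
        using encode_term_inj[of n "m + t" k l] mt(2) \<open>supp (m + t) \<subseteq> A\<close> by simp
      then have "coef (w k) n = coef (u l) (m + t) - c * coef (v l) m"
        unfolding w_def smul_def by (simp add: lookup_minus coef_monom_mult)
      also have "\<dots> = 0" using m(1) unfolding c_def by (simp add: in_keys_iff)
      finally show False using k(2) by (simp add: in_keys_iff)
    qed
    ultimately show ?thesis using k(3) by simp
  qed
  moreover have "monom t c \<in> poly_ring A" using t by (rule monom_in_poly_ring)
  ultimately show ?thesis using that w unfolding w_def by blast
qed

text \<open>
  Otherwise choose successively homogeneous elements outside the span of the previous ones, each with
  the least possible leading term in its degree. By Dickson's lemma some leading term divides a later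
  one, and the later element can be reduced.
\<close>

lemma graded_submodule_finitely_generated:
  fixes Z :: "('x, 'k) pvec set"
  assumes Z: "graded_submodule A ds Z"
  obtains G where "finite G" "\<And>d g. (d, g) \<in> G \<Longrightarrow> g \<in> Z \<inter> vec_part A ds d" "Z \<subseteq> combinations A G"
proof (rule ccontr)
  note gen = that
  assume none: "\<not> thesis"
  define good where "good G \<longleftrightarrow> finite G \<and> (\<forall>(d, g)\<in>G. g \<in> Z \<inter> vec_part A ds d)"
    for G :: "(int \<times> ('x, 'k) pvec) set"
  define best where "best G p \<longleftrightarrow> snd p \<in> Z \<inter> vec_part A ds (fst p) \<and> snd p \<notin> combinations A G \<and>
      (\<forall>w\<in>Z \<inter> vec_part A ds (fst p). w \<notin> combinations A G \<longrightarrow> leading ds (snd p) \<le> leading ds w)"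
    for G and p :: "int \<times> ('x, 'k) pvec"
  have "\<exists>p. best G p" if "good G" for G
  proof -
    have "\<not> Z \<subseteq> combinations A G"
    proof
      assume "Z \<subseteq> combinations A G"
      then have thesis using that unfolding good_def by (intro gen[of G]) auto
      then show False using none by blast
    qed
    then obtain u where u: "u \<in> Z" "u \<notin> combinations A G" by blast
    have uF: "u \<in> free_mod A (length ds)" using u Z unfolding graded_submodule_def by blast
    obtain E where E: "u = (\<Sum>d\<in>E. vcomp ds d u)" using sum_vcomp[OF uF] .
    have "\<exists>d. vcomp ds d u \<notin> combinations A G"
    proof (rule ccontr)
      assume "\<not> ?thesis"
      then have "(\<Sum>d\<in>E. vcomp ds d u) \<in> combinations A G" by (intro combinations_sum) blast
      then show False using u(2) unfolding E[symmetric] by blast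
    qed
    then obtain d where d: "vcomp ds d u \<notin> combinations A G" by blast
    let ?W = "{w \<in> Z \<inter> vec_part A ds d. w \<notin> combinations A G}"
    have "vcomp ds d u \<in> Z" using u Z unfolding graded_submodule_def by blast
    then have "vcomp ds d u \<in> ?W" using d vcomp_vec_part[OF uF] by blast
    \<comment> \<open>Only finitely many terms exist in a given degree, hence a least leading term
      exists.\<close>
    moreover have "finite (leading ds ` ?W)"
    proof (rule finite_subset)
      let ?T = "SIGMA l:{..<length ds}. {m. supp m \<subseteq> A \<and> mon_degree m = nat (d - ds ! l)}"
      show "finite (encode_term ` ?T)" using finite_monomials_of_degree[OF finite_vars] by blast
      show "leading ds ` ?W \<subseteq> encode_term ` ?T"
      proof
        fix x assume "x \<in> leading ds ` ?W"
        then obtain w where w: "w \<in> ?W" "x = leading ds w" by blast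
        then have "w \<noteq> 0" using combinations_zero by auto
        moreover have "w \<in> free_mod A (length ds)" using w unfolding vec_part_def by blast
        ultimately obtain l m where lm: "l < length ds" "m \<in> supp (w l)" "x = encode_term (l, m)"
          using leading_term w(2) by metis
        then have "supp m \<subseteq> A" "int (mon_degree m) = d - ds ! l"
          using w unfolding vec_part_def free_mod_def poly_ring_def homogeneous_def by blast+
        then have "(l, m) \<in> ?T" using lm(1) by auto
        then show "x \<in> encode_term ` ?T" using lm(3) by blast
      qed
    qed
    ultimately have min: "Min (leading ds ` ?W) \<in> leading ds ` ?W"
      and le: "\<And>w. w \<in> ?W \<Longrightarrow> Min (leading ds ` ?W) \<le> leading ds w"
      by (blast intro: Min_in Min_le)+
    from min obtain w where w: "w \<in> ?W" "leading ds w = Min (leading ds ` ?W)" by (rule imageE) simp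
    then have "\<And>w'. w' \<in> ?W \<Longrightarrow> leading ds w \<le> leading ds w'" using le by simp
    with w(1) have "best G (d, w)" unfolding best_def by auto
    then show ?thesis by blast
  qed
  then obtain pick where pick: "\<And>G. good G \<Longrightarrow> best G (pick G)" by metis
  define gs where "gs = rec_nat {} (\<lambda>n G. insert (pick G) G)"
  define z where "z n = pick (gs n)" for n
  have gs: "gs (Suc n) = insert (z n) (gs n)" "gs 0 = {}" for n unfolding gs_def z_def by auto
  have good: "good (gs n)" for n
  proof (induction n)
    case (Suc n)
    from pick[OF Suc] Suc show ?case unfolding gs z_def[symmetric] best_def good_def by auto
  qed (simp add: gs good_def)
  have best: "best (gs n) (z n)" for n using pick[OF good] unfolding z_def by blast
  have earlier: "z i \<in> gs j" if "i < j" for i j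
    using that by (induction j) (auto simp: gs less_Suc_eq)
  have vec: "snd (z n) \<in> vec_part A ds (fst (z n))" "snd (z n) \<in> Z" "snd (z n) \<noteq> 0" for n
    using best[of n] combinations_zero[of A "gs n"] unfolding best_def by auto
  have "\<exists>l m. l < length ds \<and> m \<in> supp (snd (z n) l) \<and> leading ds (snd (z n)) = encode_term (l, m)" for n
    using leading_term[of "snd (z n)" ds] vec[of n] unfolding vec_part_def by blast
  then obtain l m where lm: "\<And>n. l n < length ds \<and> m n \<in> supp (snd (z n) (l n)) \<and>
      leading ds (snd (z n)) = encode_term (l n, m n)" by metis
  have m: "supp (m n) \<subseteq> A" for n
    using vec(1)[of n] lm[of n] unfolding vec_part_def free_mod_def poly_ring_def by blast
  \<comment> \<open>Making both \<open>l n\<close> and \<open>length ds - l n\<close> increase along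
    the subsequence forces the position of the leading term to be constant there.\<close>
  define f where "f n c = (case c of Inl a \<Rightarrow> coef (m n) a | Inr b \<Rightarrow> if b then l n else length ds - l n)"
    for n c
  have "finite (Inl ` A \<union> {Inr True, Inr False} :: ('x + bool) set)" using finite_vars by simp
  then obtain \<phi> :: "nat \<Rightarrow> nat" where \<phi>: "strict_mono \<phi>"
      "\<forall>c\<in>Inl ` A \<union> {Inr True, Inr False}. \<forall>i j. i \<le> j \<longrightarrow> f (\<phi> i) c \<le> f (\<phi> j) c"
    using monotone_subsequences[of _ f] by blast
  define i j where "i = \<phi> 0" and "j = \<phi> 1"
  have ij: "i < j" using \<phi>(1) unfolding i_def j_def strict_mono_def by simp
  have coef_le: "coef (m i) a \<le> coef (m j) a" for a
  proof (cases "a \<in> A")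
    case True
    then have "f (\<phi> 0) (Inl a) \<le> f (\<phi> 1) (Inl a)" using \<phi>(2) by blast
    then show ?thesis unfolding f_def i_def j_def by simp
  next
    case False
    then show ?thesis using m[of i] by (metis in_keys_iff le0 subsetD)
  qed
  have l: "l i = l j"
  proof -
    have "f (\<phi> 0) (Inr b) \<le> f (\<phi> 1) (Inr b)" for b using \<phi>(2) by (cases b) blast+
    from this[of True] this[of False] have "l i \<le> l j" "length ds - l i \<le> length ds - l j"
      unfolding f_def i_def j_def by auto
    then show ?thesis using lm[of i] lm[of j] by linarith
  qed
  define t where "t = m j - m i"
  have t: "m j = m i + t"
    unfolding t_def using coef_le by (intro poly_mapping_eqI) (simp add: lookup_add lookup_minus)
  obtain c where c: "snd (z j) - smul (monom t c) (snd (z i)) \<in> vec_part A ds (fst (z j))"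
      "monom t c \<in> poly_ring A"
      "snd (z j) - smul (monom t c) (snd (z i)) \<noteq> 0 \<Longrightarrow>
        leading ds (snd (z j) - smul (monom t c) (snd (z i))) < leading ds (snd (z j))"
  proof (rule leading_reduce[OF vec(1)[of j] vec(1)[of i], of "l i" "m i" t])
    show "m i + t \<in> supp (snd (z j) (l i))" "leading ds (snd (z j)) = encode_term (l i, m i + t)"
      using lm[of j] l t by auto
  qed (use lm[of i] in auto)
  \<comment> \<open>This lies in the degree of \<open>z j\<close> and outside the span of the first
    \<open>j\<close> elements, but has a smaller leading term, against the choice of
    \<open>z j\<close>.\<close>
  define w where "w = snd (z j) - smul (monom t c) (snd (z i))"
  have span: "smul (monom t c) (snd (z i)) \<in> combinations A (gs j)"
  proof -
    have "snd (z i) \<in> combinations A (gs j)"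
      using good[of j] earlier[OF ij] combinations_gen[of "gs j" "fst (z i)" "snd (z i)"] by (simp add: good_def)
    then show ?thesis using c(2) by (rule combinations_smul)
  qed
  have "w \<in> Z" unfolding w_def using Z vec(2) c(2) unfolding graded_submodule_def by blast
  have notin: "w \<notin> combinations A (gs j)"
  proof
    assume "w \<in> combinations A (gs j)"
    from combinations_add[OF this span] have "snd (z j) \<in> combinations A (gs j)" unfolding w_def by simp
    then show False using best[of j] unfolding best_def by blast
  qed
  then have "w \<noteq> 0" using combinations_zero[of A "gs j"] by auto
  then have "leading ds w < leading ds (snd (z j))" using c(3) unfolding w_def by blast
  moreover have "leading ds (snd (z j)) \<le> leading ds w"
    using best[of j] \<open>w \<in> Z\<close> notin c(1) unfolding best_def w_def by blast
  ultimately show False by simp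
qed

end

section \<open>Minimal covers and resolutions\<close>

text \<open>The last condition puts the kernel inside the irrelevant ideal times the free module.
  Minimality thereby becomes a property of a single cover, independent of the map chosen onto its
  kernel.\<close>

definition minimal_cover ::
  "'x set \<Rightarrow> int list \<Rightarrow> ('x, 'k::comm_ring_1) pvec set \<Rightarrow> int list \<Rightarrow> (nat \<Rightarrow> ('x, 'k) pvec) \<Rightarrow> bool" where
  "minimal_cover A ds Z es D \<longleftrightarrow>
    (\<forall>k<length es. D k \<in> vec_part A ds (es ! k)) \<and>
    Z = free_map (length es) D ` free_mod A (length es) \<and>
    (\<forall>u\<in>free_mod A (length es). free_map (length es) D u = 0 \<longrightarrow> (\<forall>k<length es. coef (u k) 0 = 0))"

definition syzygies :: "'x set \<Rightarrow> int list \<Rightarrow> (nat \<Rightarrow> ('x, 'k::comm_ring_1) pvec) \<Rightarrow> ('x, 'k) pvec set" where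
  "syzygies A es D = {u \<in> free_mod A (length es). free_map (length es) D u = 0}"

lemma free_mod_diff: "u \<in> free_mod A r \<Longrightarrow> v \<in> free_mod A r \<Longrightarrow> u - v \<in> free_mod A r"
  unfolding free_mod_def by (auto intro: poly_ring_diff)

lemma free_mod_smul: "c \<in> poly_ring A \<Longrightarrow> u \<in> free_mod A r \<Longrightarrow> smul c u \<in> free_mod A r"
  unfolding free_mod_def smul_def by (auto intro: poly_ring_mult)

lemma free_mod_zero: "0 \<in> free_mod A r"
  unfolding free_mod_def by (simp add: poly_ring_zero)

lemma free_mod_vcomp: "u \<in> free_mod A (length ds) \<Longrightarrow> vcomp ds d u \<in> free_mod A (length ds)"
  using vcomp_vec_part[of u A ds d] unfolding vec_part_def by blast

lemma free_map_diff: "free_map r D (u - v) = free_map r D u - free_map r D v"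
  unfolding free_map_def by (simp add: fun_eq_iff left_diff_distrib sum_subtractf)

lemma free_map_add: "free_map r D (u + v) = free_map r D u + free_map r D v"
  unfolding free_map_def by (simp add: fun_eq_iff distrib_right sum.distrib)

lemma free_map_smul: "free_map r D (smul c u) = smul c (free_map r D u)"
  unfolding free_map_def smul_def by (simp add: fun_eq_iff sum_distrib_left mult.assoc)

lemma free_map_zero: "free_map r D 0 = 0"
  unfolding free_map_def by (simp add: fun_eq_iff)

lemma free_map_unit:
  assumes "k < r"
  shows "free_map r D (\<lambda>l. if l = k then 1 else 0) = D k"
  using assms unfolding free_map_def
  by (simp add: fun_eq_iff if_distrib[of "\<lambda>x. x * _"] cong: if_cong)

lemma homogeneous_zero_eq_zero:
  assumes "p \<in> homogeneous 0" "coef p 0 = 0"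
  shows "p = 0"
proof (rule poly_mapping_eqI)
  fix m
  have "m \<notin> supp p" if "m \<noteq> 0"
    using assms(1) that unfolding homogeneous_def by (auto simp: mon_degree_eq_zero)
  then show "coef p m = coef 0 m" using assms(2) by (cases "m = 0") (auto simp: in_keys_iff)
qed

lemma unit_in_vec_part:
  assumes "k < length es"
  shows "(\<lambda>l. if l = k then 1 else 0 :: ('x, 'k::comm_ring_1) mpoly) \<in> vec_part A es (es ! k)"
proof -
  have "(1 :: ('x, 'k) mpoly) \<in> homogeneous 0" unfolding homogeneous_def by simp
  then show ?thesis
    using assms unfolding vec_part_def free_mod_def
    by (auto simp: poly_ring_one poly_ring_zero homogeneous_zero)
qed

lemma vcomp_free_map:
  assumes "\<And>k. k < length es \<Longrightarrow> D k \<in> vec_part A ds (es ! k)"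
  shows "vcomp ds d (free_map (length es) D u) = free_map (length es) D (vcomp es d u)"
proof
  fix l
  show "vcomp ds d (free_map (length es) D u) l = free_map (length es) D (vcomp es d u) l"
  proof (cases "l < length ds")
    case True
    have "hcomp (d - ds ! l) (u k * D k l) = vcomp es d u k * D k l" if "k < length es" for k
    proof -
      have "D k l \<in> homogeneous (es ! k - ds ! l)" using assms[OF that] True unfolding vec_part_def by blast
      from hcomp_mult[OF this, of "d - ds ! l" "u k"] show ?thesis using that by (simp add: vcomp_def)
    qed
    then show ?thesis using True unfolding vcomp_def[of ds] free_map_def by (simp add: hcomp_sum)
  next
    case False
    then have "D k l = 0" if "k < length es" for k
      using assms[OF that] unfolding vec_part_def free_mod_def by auto
    then show ?thesis using False unfolding vcomp_def[of ds] free_map_def by simp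
  qed
qed

lemma graded_submodule_syzygies:
  fixes D :: "nat \<Rightarrow> ('x, 'k::comm_ring_1) pvec"
  assumes "\<And>k. k < length es \<Longrightarrow> D k \<in> vec_part A ds (es ! k)"
  shows "graded_submodule A es (syzygies A es D)"
  unfolding graded_submodule_def
proof (intro conjI ballI allI)
  fix d u assume "u \<in> syzygies A es D"
  then have u: "u \<in> free_mod A (length es)" "free_map (length es) D u = 0" unfolding syzygies_def by auto
  have "free_map (length es) D (vcomp es d u) = vcomp ds d 0"
    using vcomp_free_map[OF assms, of d u] u(2) by simp
  also have "\<dots> = 0" by (simp add: vcomp_def fun_eq_iff)
  finally show "vcomp es d u \<in> syzygies A es D" using u(1) unfolding syzygies_def by (simp add: free_mod_vcomp)
next
  fix c :: "('x, 'k) mpoly" and u assume c: "c \<in> poly_ring A" and u: "u \<in> syzygies A es D"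
  have "smul c 0 = 0" by (simp add: smul_def fun_eq_iff)
  then show "smul c u \<in> syzygies A es D"
    using c u unfolding syzygies_def by (simp add: free_mod_smul free_map_smul)
qed (auto simp: syzygies_def free_map_zero free_mod_zero free_map_diff free_mod_diff)

lemma vcomp_combination:
  assumes "\<And>g. g \<in> G \<Longrightarrow> snd g \<in> vec_part A ds (fst g)"
  shows "vcomp ds d (combination G c) = combination G (\<lambda>g. hcomp (d - fst g) (c g))"
proof
  fix l
  show "vcomp ds d (combination G c) l = combination G (\<lambda>g. hcomp (d - fst g) (c g)) l"
  proof (cases "l < length ds")
    case True
    have "hcomp (d - ds ! l) (c g * snd g l) = hcomp (d - fst g) (c g) * snd g l" if "g \<in> G" for g
    proof -
      have "snd g l \<in> homogeneous (fst g - ds ! l)" using assms[OF that] True unfolding vec_part_def by blast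
      from hcomp_mult[OF this, of "d - ds ! l" "c g"] show ?thesis by simp
    qed
    then show ?thesis using True unfolding vcomp_def combination_def by (simp add: hcomp_sum)
  next
    case False
    then have "snd g l = 0" if "g \<in> G" for g
      using assms[OF that] unfolding vec_part_def free_mod_def by auto
    then show ?thesis using False unfolding vcomp_def combination_def by simp
  qed
qed

lemma free_map_eq_combination:
  assumes "distinct gs" "\<And>k. k < length gs \<Longrightarrow> u k = c (gs ! k)"
  shows "free_map (length gs) (\<lambda>k. snd (gs ! k)) u = combination (set gs) c"
proof
  fix l
  have "(\<Sum>k<length gs. u k * snd (gs ! k) l) = (\<Sum>k<length gs. c (gs ! k) * snd (gs ! k) l)"
    using assms(2) by (intro sum.cong) auto
  also have "\<dots> = (\<Sum>g\<in>set gs. c g * snd g l)"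
    by (rule sum.reindex_bij_betw[OF bij_betw_nth[OF assms(1) refl refl]])
  finally show "free_map (length gs) (\<lambda>k. snd (gs ! k)) u l = combination (set gs) c l"
    unfolding free_map_def combination_def .
qed

lemma combination_remove:
  assumes "finite G" "h \<in> G"
  shows "combination G c = smul (c h) (snd h) + combination (G - {h}) c"
  using assms unfolding combination_def smul_def by (simp add: fun_eq_iff sum.remove)

context poly_koszul
begin

text \<open>Take a generating set of least cardinality. In a relation with nonzero constant
  coefficient at \<open>h\<close>, the component in the degree of \<open>h\<close> has a unit there,
  so \<open>h\<close> lies in the span of the others.\<close>

lemma minimal_generating_set:
  fixes Z :: "('x, 'k) pvec set"
  assumes Z: "graded_submodule A ds Z"
  obtains G where "finite G" "\<And>g. g \<in> G \<Longrightarrow> snd g \<in> Z \<and> snd g \<in> vec_part A ds (fst g)"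
    "Z = combinations A G"
    "\<And>c h. \<lbrakk>\<And>g. g \<in> G \<Longrightarrow> c g \<in> poly_ring A; combination G c = 0; h \<in> G\<rbrakk> \<Longrightarrow> coef (c h) 0 = 0"
proof -
  define gens where "gens G \<longleftrightarrow> finite G \<and> (\<forall>g\<in>G. snd g \<in> Z \<and> snd g \<in> vec_part A ds (fst g)) \<and>
      Z \<subseteq> combinations A G" for G
  have "\<exists>G. gens G"
    using graded_submodule_finitely_generated[OF Z] unfolding gens_def by (metis Int_iff prod.collapse)
  then obtain G where G: "gens G" "\<And>H. gens H \<Longrightarrow> card G \<le> card H"
    using ex_has_least_nat[of gens _ card] by blast
  have fin: "finite G" and vec: "\<And>g. g \<in> G \<Longrightarrow> snd g \<in> vec_part A ds (fst g)"
    using G(1) unfolding gens_def by auto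
  have minimal: "coef (c h) 0 = 0"
    if c: "\<And>g. g \<in> G \<Longrightarrow> c g \<in> poly_ring A" "combination G c = 0" and h: "h \<in> G" for c h
  proof (rule ccontr)
    assume nz: "coef (c h) 0 \<noteq> 0"
    define e where "e g = hcomp (fst h - fst g) (c g)" for g
    have e: "e g \<in> poly_ring A" if "g \<in> G" for g
      unfolding e_def using c(1)[OF that] by (rule hcomp_poly_ring)
    have "combination G e = vcomp ds (fst h) 0"
      unfolding e_def using vcomp_combination[of G A ds "fst h" c] vec c(2) by simp
    then have "combination G e = 0" by (simp add: vcomp_def fun_eq_iff)
    then have "smul (e h) (snd h) + combination (G - {h}) e = 0"
      using combination_remove[OF fin h, of e] by simp
    moreover have "e h = monom 0 (coef (c h) 0)"
      unfolding e_def by (rule poly_mapping_eqI)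
        (simp add: hcomp_def coef_restrict_supp lookup_single when_def mon_degree_eq_zero)
    ultimately have eq: "smul (monom 0 (coef (c h) 0)) (snd h) = - combination (G - {h}) e"
      by (simp add: eq_neg_iff_add_eq_0)
    let ?b = "monom 0 (1 / coef (c h) 0) :: ('x, 'k) mpoly"
    have "combination (G - {h}) e \<in> combinations A (G - {h})"
      unfolding combinations_def using e by blast
    then have "smul ?b (0 - combination (G - {h}) e) \<in> combinations A (G - {h})"
      by (intro combinations_smul combinations_diff combinations_zero monom_in_poly_ring) simp_all
    moreover have "smul ?b (0 - combination (G - {h}) e) = snd h"
    proof -
      have "smul ?b (smul (monom 0 (coef (c h) 0)) (snd h)) = snd h"
        using nz by (simp add: smul_def mult.assoc[symmetric] mult_single)
      then show ?thesis using eq by simp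
    qed
    ultimately have h': "snd h \<in> combinations A (G - {h})" by simp
    have "Z \<subseteq> combinations A (G - {h})"
    proof
      fix u assume "u \<in> Z"
      then obtain b where b: "u = combination G b" "\<forall>g\<in>G. b g \<in> poly_ring A"
        using G(1) unfolding gens_def combinations_def by blast
      have "combination (G - {h}) b \<in> combinations A (G - {h})"
        unfolding combinations_def using b(2) by blast
      moreover have "smul (b h) (snd h) \<in> combinations A (G - {h})"
        using h' b(2) h by (intro combinations_smul) auto
      ultimately show "u \<in> combinations A (G - {h})"
        unfolding b(1) combination_remove[OF fin h] by (intro combinations_add)
    qed
    then have "gens (G - {h})" using G(1) unfolding gens_def by blast
    then show False using G(2)[of "G - {h}"] card_Diff1_less[OF fin h] by simp
  qed
  have "combinations A G \<subseteq> Z"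
    using G(1) unfolding gens_def by (intro combinations_subset[OF Z]) force
  then have "Z = combinations A G" using G(1) unfolding gens_def by blast
  then show ?thesis using fin G(1) minimal unfolding gens_def by (intro that[of G]) blast+
qed

lemma minimal_cover_exists:
  fixes Z :: "('x, 'k) pvec set"
  assumes Z: "graded_submodule A ds Z"
  shows "\<exists>es D. minimal_cover A ds Z es D"
proof -
  obtain G where G: "finite G" "\<And>g. g \<in> G \<Longrightarrow> snd g \<in> Z \<and> snd g \<in> vec_part A ds (fst g)"
    "Z = combinations A G"
    "\<And>c h. \<lbrakk>\<And>g. g \<in> G \<Longrightarrow> c g \<in> poly_ring A; combination G c = 0; h \<in> G\<rbrakk> \<Longrightarrow> coef (c h) 0 = 0"
    using minimal_generating_set[OF Z] by metis
  obtain gs where gs: "distinct gs" "set gs = G" using finite_distinct_list[OF G(1)] by blast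
  define es where "es = map fst gs"
  define D where "D k = snd (gs ! k)" for k
  have len: "length es = length gs" unfolding es_def by simp
  define tofun where "tofun u g = u (SOME k. k < length gs \<and> gs ! k = g)"
    for u :: "('x, 'k) pvec" and g :: "int \<times> ('x, 'k) pvec"
  have tofun: "tofun u (gs ! k) = u k" if "k < length gs" for u k
  proof -
    have "(SOME k'. k' < length gs \<and> gs ! k' = gs ! k) = k"
      using that gs(1) by (intro some_equality) (auto simp: nth_eq_iff_index_eq)
    then show ?thesis unfolding tofun_def by simp
  qed
  have map_tofun: "free_map (length es) D u = combination G (tofun u)" for u
    unfolding len D_def gs(2)[symmetric] by (rule free_map_eq_combination[OF gs(1)]) (simp add: tofun)
  have tofun_ring: "tofun u g \<in> poly_ring A" if "u \<in> free_mod A (length es)" "g \<in> G" for u g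
    using that gs(2) tofun[of _ u] len unfolding free_mod_def by (metis (no_types, lifting) in_set_conv_nth mem_Collect_eq)
  have "minimal_cover A ds Z es D"
    unfolding minimal_cover_def
  proof (intro conjI ballI allI impI)
    show "D k \<in> vec_part A ds (es ! k)" if "k < length es" for k
      using that G(2)[of "gs ! k"] gs(2) nth_mem[of k gs] unfolding D_def es_def by simp
    show "Z = free_map (length es) D ` free_mod A (length es)"
    proof
      show "free_map (length es) D ` free_mod A (length es) \<subseteq> Z"
        unfolding G(3) combinations_def using map_tofun tofun_ring by blast
      show "Z \<subseteq> free_map (length es) D ` free_mod A (length es)"
      proof
        fix u assume "u \<in> Z"
        then obtain c where c: "u = combination G c" "\<forall>g\<in>G. c g \<in> poly_ring A"
          unfolding G(3) combinations_def by blast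
        define w where "w k = (if k < length gs then c (gs ! k) else 0)" for k
        have "free_map (length es) D w = u"
          unfolding c(1) len D_def gs(2)[symmetric]
          by (rule free_map_eq_combination[OF gs(1)]) (simp add: w_def)
        moreover have "w \<in> free_mod A (length es)"
          unfolding free_mod_def w_def len using c(2) gs(2) by auto
        ultimately show "u \<in> free_map (length es) D ` free_mod A (length es)" by blast
      qed
    qed
    show "coef (u k) 0 = 0"
      if "u \<in> free_mod A (length es)" "free_map (length es) D u = 0" "k < length es" for u k
      using G(4)[of "tofun u" "gs ! k"] that tofun_ring map_tofun tofun[of k u] gs(2) len nth_mem[of k gs] by simp
  qed
  then show ?thesis by blast
qed

end

lemma minimal_coverD:
  assumes "minimal_cover A ds Z es D"
  shows "k < length es \<Longrightarrow> D k \<in> vec_part A ds (es ! k)"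
    and "Z = free_map (length es) D ` free_mod A (length es)"
    and "u \<in> syzygies A es D \<Longrightarrow> k < length es \<Longrightarrow> coef (u k) 0 = 0"
  using assms unfolding minimal_cover_def syzygies_def by auto

section \<open>Koszul homology of graded submodules of free modules\<close>

abbreviation vec_op :: "'x \<Rightarrow> ('x, 'k::comm_ring_1) pvec \<Rightarrow> ('x, 'k) pvec" where
  "vec_op a u \<equiv> smul (indet a) u"

sublocale poly_koszul \<subseteq> vec: koszul A ord "vec_op :: 'x \<Rightarrow> ('x, 'k) pvec \<Rightarrow> ('x, 'k) pvec"
  by unfold_locales (auto simp: finite_vars inj_on_ord smul_def algebra_simps fun_eq_iff)

context poly_koszul
begin

abbreviation zero_family :: "int \<Rightarrow> ('x, 'k) pvec set" where "zero_family \<equiv> \<lambda>_. {0}"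

abbreviation part :: "int list \<Rightarrow> ('x, 'k) pvec set \<Rightarrow> int \<Rightarrow> ('x, 'k) pvec set" where
  "part ds Z \<equiv> \<lambda>d. Z \<inter> vec_part A ds d"

lemma vec_part_diff: "u \<in> vec_part A ds d \<Longrightarrow> v \<in> vec_part A ds d \<Longrightarrow> u - v \<in> vec_part A ds d"
  unfolding vec_part_def by (auto simp: free_mod_diff homogeneous_diff)

lemma vec_part_zero: "0 \<in> vec_part A ds d"
  unfolding vec_part_def by (auto simp: free_mod_zero homogeneous_zero)

lemma vec_part_op:
  assumes "a \<in> A" "u \<in> vec_part A ds d"
  shows "vec_op a u \<in> vec_part A ds (d + 1)"
proof -
  have "indet a * u l \<in> homogeneous (d + 1 - ds ! l)" if "l < length ds" for l
    using homogeneous_indet_mult[of "u l" "d - ds ! l" a] assms that unfolding vec_part_def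
    by (simp add: algebra_simps)
  then show ?thesis
    using assms free_mod_smul[OF poly_ring_indet[OF assms(1)]] unfolding vec_part_def by (auto simp: smul_def)
qed

lemma graded_vec_part: "vec.graded (vec_part A ds :: int \<Rightarrow> ('x, 'k) pvec set)"
  by (intro graded_familyI vec_part_zero vec_part_diff vec_part_op)

lemma graded_zero_family: "vec.graded zero_family"
  by (intro graded_familyI) (auto simp: smul_def fun_eq_iff)

lemma graded_part_submodule: "graded_submodule A ds Z \<Longrightarrow> vec.graded (part ds Z)"
  unfolding graded_submodule_def
  by (intro graded_familyI) (auto intro: vec_part_zero vec_part_diff vec_part_op poly_ring_indet)

lemma vec_bd_apply: "vec.bd u T k = bd (\<lambda>T. u T k) T"
  unfolding koszul_bd_def sum_fun_apply
  by (rule sum.cong) (auto simp: koszul_sign_def smul_def)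

lemma vec_chains_apply:
  assumes "u \<in> vec.kchains (vec_part A ds) i j" "k < length ds"
  shows "(\<lambda>T. u T k) \<in> kchains S i (j - ds ! k)"
proof -
  have "u T k \<in> S (j - ds ! k - i)" if "T \<subseteq> A" "int (card T) = i" for T
  proof -
    have "u T \<in> vec_part A ds (j - i)" using assms(1) that unfolding koszul_chains_def by blast
    then have "u T k \<in> poly_ring A" "u T k \<in> homogeneous (j - i - ds ! k)"
      using assms(2) unfolding vec_part_def free_mod_def by blast+
    then show ?thesis unfolding graded_part_def by (simp add: algebra_simps)
  qed
  then show ?thesis unfolding koszul_chains_def by blast
qed

lemma vec_chains_assemble:
  assumes "\<And>k. k < length ds \<Longrightarrow> v k \<in> kchains S i (j - ds ! k)"
  shows "(\<lambda>T k. if k < length ds then v k T else 0) \<in> vec.kchains (vec_part A ds) i j"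
proof -
  have "(\<lambda>k. if k < length ds then v k T else 0) \<in> vec_part A ds (j - i)"
    if "T \<subseteq> A" "int (card T) = i" for T
  proof -
    have "v k T \<in> S (j - ds ! k - i)" if "k < length ds" for k
      using assms[OF that] \<open>T \<subseteq> A\<close> \<open>int (card T) = i\<close> unfolding koszul_chains_def by blast
    then show ?thesis
      unfolding vec_part_def free_mod_def graded_part_def by (auto simp: algebra_simps)
  qed
  then show ?thesis unfolding koszul_chains_def by blast
qed

lemma vec_boundary:
  assumes u: "u \<in> vec.kchains (vec_part A ds) i j"
    and ex: "\<And>k. k < length ds \<Longrightarrow>
      \<exists>v\<in>kchains S (i + 1) (j - ds ! k). (\<lambda>T. u T k) - bd v \<in> kchains Null i (j - ds ! k)"
  obtains v where "v \<in> vec.kchains (vec_part A ds) (i + 1) j"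
    "\<And>T. T \<subseteq> A \<Longrightarrow> int (card T) = i \<Longrightarrow> u T = vec.bd v T"
proof -
  obtain v where v: "\<And>k. k < length ds \<Longrightarrow> v k \<in> kchains S (i + 1) (j - ds ! k) \<and>
      (\<lambda>T. u T k) - bd (v k) \<in> kchains Null i (j - ds ! k)"
    using ex by metis
  define w where "w = (\<lambda>T k. if k < length ds then v k T else 0)"
  have "u T k = vec.bd w T k" if T: "T \<subseteq> A" "int (card T) = i" for T k
  proof (cases "k < length ds")
    case True
    have "((\<lambda>T. u T k) - bd (v k)) T = 0"
      using v[OF True] T unfolding koszul_chains_def graded_part_def by blast
    then show ?thesis using True unfolding vec_bd_apply w_def by simp
  next
    case False
    have "u T \<in> vec_part A ds (j - i)" using u T unfolding koszul_chains_def by blast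
    then have "u T k = 0" using False unfolding vec_part_def free_mod_def by simp
    then show ?thesis using False unfolding vec_bd_apply unfolding w_def koszul_bd_def by (simp add: koszul_sign_def cong: if_cong)
  qed
  moreover have "w \<in> vec.kchains (vec_part A ds) (i + 1) j"
    unfolding w_def using v by (intro vec_chains_assemble) simp
  ultimately show ?thesis by (intro that[of w]) (auto simp: fun_eq_iff)
qed

text \<open>Coordinate \<open>k\<close> is the ring with its generator moved to degree
  \<open>ds ! k\<close>, so homology occurs only for \<open>i = 0\<close> and in these
  degrees.\<close>

lemma vanishes_vec_part:
  assumes "i \<noteq> 0 \<or> j \<notin> set ds"
  shows "vec.vanishes (vec_part A ds) zero_family i j"
proof (rule vec.vanishesI)
  fix u :: "'x set \<Rightarrow> ('x, 'k) pvec"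
  assume u: "u \<in> vec.kchains (vec_part A ds) i j" and bdu: "vec.bd u \<in> vec.kchains zero_family (i - 1) j"
  have "\<exists>v\<in>kchains S (i + 1) (j - ds ! k). (\<lambda>T. u T k) - bd v \<in> kchains Null i (j - ds ! k)"
    if k: "k < length ds" for k
  proof -
    have "vanishes S Null i (j - ds ! k)"
      using assms k by (intro vanishes_ring) auto
    moreover have "bd (\<lambda>T. u T k) \<in> kchains Null (i - 1) (j - ds ! k)"
      using bdu unfolding koszul_chains_def graded_part_def
      by (simp add: vec_bd_apply[symmetric] homogeneous_zero)
    ultimately show ?thesis
      using vec_chains_apply[OF u k] unfolding koszul_vanishes_def by blast
  qed
  from vec_boundary[OF u this] obtain v where "v \<in> vec.kchains (vec_part A ds) (i + 1) j"
    "\<And>T. T \<subseteq> A \<Longrightarrow> int (card T) = i \<Longrightarrow> u T = vec.bd v T" by metis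
  then show "\<exists>v\<in>vec.kchains (vec_part A ds) (i + 1) j. u - vec.bd v \<in> vec.kchains zero_family i j"
    unfolding koszul_chains_def by auto
qed

section \<open>Dimension shifting along a minimal cover\<close>

context
  fixes ds es :: "int list" and Z :: "('x, 'k) pvec set" and D :: "nat \<Rightarrow> ('x, 'k) pvec"
  assumes cover: "minimal_cover A ds Z es D" and Z: "graded_submodule A ds Z"
begin

abbreviation "Y \<equiv> syzygies A es D"

lemma graded_Y: "graded_submodule A es Y"
  by (rule graded_submodule_syzygies) (rule minimal_coverD(1)[OF cover])

lemma graded_part_Y: "vec.graded (part es Y)"
  by (rule graded_part_submodule[OF graded_Y])

lemma cover_vanishes_iff:
  "vec.vanishes (vec_part A es) (part es Y) i j \<longleftrightarrow> vec.vanishes (part ds Z) zero_family i j"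
proof -
  let ?\<epsilon> = "free_map (length es) D"
  have comp: "vcomp ds d (?\<epsilon> u) = ?\<epsilon> (vcomp es d u)" for d u
    by (rule vcomp_free_map[OF minimal_coverD(1)[OF cover]])
  interpret koszul_map A ord vec_op vec_op ?\<epsilon> "vec_part A es" "part es Y" "part ds Z" zero_family
  proof unfold_locales
    show "?\<epsilon> (u + v) = ?\<epsilon> u + ?\<epsilon> v" for u v by (rule free_map_add)
    show "?\<epsilon> (vec_op a u) = vec_op a (?\<epsilon> u)" for a u by (rule free_map_smul)
    show "\<exists>u\<in>vec_part A es d. m - ?\<epsilon> u \<in> {0}" if m: "m \<in> part ds Z d" for d m
    proof -
      obtain u where u: "u \<in> free_mod A (length es)" "m = ?\<epsilon> u"
        using m minimal_coverD(2)[OF cover] by blast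
      have "?\<epsilon> (vcomp es d u) = m"
        using comp[of d u] vcomp_of_vec_part[of m A ds d d] m u(2) by simp
      then show ?thesis using vcomp_vec_part[OF u(1)] by force
    qed
    show "?\<epsilon> u \<in> part ds Z d" if u: "u \<in> vec_part A es d" for d u
    proof -
      have uF: "u \<in> free_mod A (length es)" using u unfolding vec_part_def by blast
      then have "?\<epsilon> u \<in> Z" using minimal_coverD(2)[OF cover] by blast
      moreover have "?\<epsilon> u = vcomp ds d (?\<epsilon> u)"
        using comp[of d u] vcomp_of_vec_part[OF u, of d] by simp
      ultimately show ?thesis
        using vcomp_vec_part[of "?\<epsilon> u" A ds d] Z unfolding graded_submodule_def by auto
    qed
    show "part es Y d = {u \<in> vec_part A es d. ?\<epsilon> u \<in> {0}}" for d
      unfolding syzygies_def vec_part_def by auto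
    show "{0} \<subseteq> part ds Z d" for d
      using Z vec_part_zero unfolding graded_submodule_def by auto
  qed (rule graded_vec_part graded_zero_family graded_part_submodule[OF Z])+
  show ?thesis by (rule vanishes_iff)
qed

lemma zero_subset_Y: "zero_family d \<subseteq> part es Y d"
  using graded_Y vec_part_zero unfolding graded_submodule_def by auto

text \<open>Tor_0 of \<open>Z\<close> is F/(Y + mF), and minimality gives Y inside mF: the unit
  vector of degree \<open>j\<close> has constant coefficient 1, which neither a syzygy nor a
  boundary can supply.\<close>

lemma vanishes_zero_iff: "vec.vanishes (part ds Z) zero_family 0 j \<longleftrightarrow> j \<notin> set es"
proof
  assume j: "j \<notin> set es"
  have "vec.vanishes (part es Y) zero_family (0 - 1) j"
    by (rule vec.vanishes_negative[OF graded_part_Y]) simp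
  moreover have "vec.vanishes (vec_part A es) zero_family 0 j"
    using j by (intro vanishes_vec_part) blast
  ultimately have "vec.vanishes (vec_part A es) (part es Y) 0 j"
    using vec.vanishes_quotient[OF graded_zero_family graded_part_Y graded_vec_part zero_subset_Y, of es 0 j] by blast
  then show "vec.vanishes (part ds Z) zero_family 0 j" unfolding cover_vanishes_iff .
next
  assume "vec.vanishes (part ds Z) zero_family 0 j"
  then have van: "vec.vanishes (vec_part A es) (part es Y) 0 j" unfolding cover_vanishes_iff .
  show "j \<notin> set es"
  proof
    assume "j \<in> set es"
    then obtain k where k: "k < length es" "j = es ! k" by (metis in_set_conv_nth)
    define e :: "('x, 'k) pvec" where "e = (\<lambda>l. if l = k then 1 else 0)"
    have "e \<in> vec_part A es j"
      unfolding e_def k(2) by (rule unit_in_vec_part[OF k(1)])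
    then have "(\<lambda>_. e) \<in> vec.kchains (vec_part A es) 0 j"
      unfolding koszul_chains_def by simp
    moreover have "vec.bd (\<lambda>_. e) \<in> vec.kchains (part es Y) (0 - 1) j"
      unfolding koszul_chains_def by simp
    ultimately obtain v where "(\<lambda>_. e) - vec.bd v \<in> vec.kchains (part es Y) 0 j"
      using vec.vanishesE[OF van] by blast
    then have "e - vec.bd v {} \<in> Y" unfolding koszul_chains_def by auto
    then have "coef ((e - vec.bd v {}) k) 0 = 0" using minimal_coverD(3)[OF cover] k(1) by blast
    moreover have "coef (vec.bd v {} k) 0 = 0"
      unfolding vec_bd_apply unfolding koszul_bd_def lookup_sum
      by (rule sum.neutral) (auto simp: koszul_sign_def coef_indet_mult_outside)
    ultimately show False unfolding e_def by (simp add: lookup_minus)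
  qed
qed

text \<open>For \<open>i > 0\<close> the free module contributes no homology. For
  \<open>i = 0\<close> it does, but Tor_0(Y) -> Tor_0(F) is zero because minimality puts
  \<open>Y\<close> inside mF.\<close>

lemma vanishes_suc_iff:
  assumes i: "i \<ge> 0"
  shows "vec.vanishes (part ds Z) zero_family (i + 1) j \<longleftrightarrow> vec.vanishes (part es Y) zero_family i j"
proof
  have YF: "part es Y d \<subseteq> vec_part A es d" for d by blast
  note les = graded_zero_family graded_part_Y graded_vec_part zero_subset_Y YF
  assume "vec.vanishes (part es Y) zero_family i j"
  moreover have "vec.vanishes (vec_part A es) zero_family (i + 1) j"
    using i by (intro vanishes_vec_part) simp
  ultimately have "vec.vanishes (vec_part A es) (part es Y) (i + 1) j"
    using vec.vanishes_quotient[OF les, of "i + 1" j] by simp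
  then show "vec.vanishes (part ds Z) zero_family (i + 1) j" unfolding cover_vanishes_iff .
next
  have YF: "part es Y d \<subseteq> vec_part A es d" for d by blast
  note les = graded_zero_family graded_part_Y graded_vec_part zero_subset_Y YF
  assume "vec.vanishes (part ds Z) zero_family (i + 1) j"
  then have van: "vec.vanishes (vec_part A es) (part es Y) (i + 1) j" unfolding cover_vanishes_iff .
  show "vec.vanishes (part es Y) zero_family i j"
  proof (cases "i = 0")
    case False
    then have "vec.vanishes (vec_part A es) zero_family i j" by (intro vanishes_vec_part) simp
    then show ?thesis using vec.vanishes_sub[OF les, of i j] van by blast
  next
    case True
    show ?thesis
      unfolding True
    proof (rule vec.vanishesI)
      fix u assume u: "u \<in> vec.kchains (part es Y) 0 j"
      have uF: "u \<in> vec.kchains (vec_part A es) 0 j" by (rule koszul_chains_mono[OF YF u])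
      have "\<exists>v\<in>kchains S (0 + 1) (j - es ! k). (\<lambda>T. u T k) - bd v \<in> kchains Null 0 (j - es ! k)"
        if k: "k < length es" for k
      proof (cases "j = es ! k")
        case False
        have "vanishes S Null 0 (j - es ! k)" using False by (intro vanishes_ring) simp
        moreover have "bd (\<lambda>T. u T k) \<in> kchains Null (0 - 1) (j - es ! k)"
          unfolding koszul_chains_def by simp
        ultimately show ?thesis
          using vec_chains_apply[OF uF k] unfolding koszul_vanishes_def by blast
      next
        \<comment> \<open>In this coordinate the entries are constants, hence zero for a syzygy of a
          minimal cover.\<close>
        case True
        have "u T k = 0" if T: "T \<subseteq> A" "int (card T) = 0" for T
        proof -
          have "u T \<in> part es Y j" using u T unfolding koszul_chains_def by auto
          then have "coef (u T k) 0 = 0" "u T k \<in> homogeneous 0"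
            using minimal_coverD(3)[OF cover] k True unfolding vec_part_def by auto
          then show ?thesis by (intro homogeneous_zero_eq_zero)
        qed
        moreover have "bd 0 = 0" using bd_diff[of 0 0] by simp
        ultimately show ?thesis
          by (intro bexI[of _ 0]) (auto simp: koszul_chains_def graded_part_def homogeneous_zero poly_ring_zero)
      qed
      from vec_boundary[OF uF this] obtain w where w: "w \<in> vec.kchains (vec_part A es) 1 j"
        "\<And>T. T \<subseteq> A \<Longrightarrow> int (card T) = 0 \<Longrightarrow> u T = vec.bd w T" by (metis add_0)
      have "vec.bd w \<in> vec.kchains (part es Y) (1 - 1) j"
        using u w(2) unfolding koszul_chains_def by auto
      then obtain x where x: "w - vec.bd x \<in> vec.kchains (part es Y) 1 j"
        using vec.vanishesE[OF van[unfolded True add_0] w(1)] by auto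
      have "(u - vec.bd (w - vec.bd x)) T = 0" if "T \<subseteq> A" "int (card T) = 0" for T
        using w(2)[OF that] vec.bd_bd[OF that(1), of x] unfolding vec.bd_diff by simp
      then have "u - vec.bd (w - vec.bd x) \<in> vec.kchains zero_family 0 j"
        unfolding koszul_chains_def by blast
      then show "\<exists>v\<in>vec.kchains (part es Y) (0 + 1) j. u - vec.bd v \<in> vec.kchains zero_family 0 j"
        using x by auto
    qed
  qed
qed

end

end

section \<open>Minimal resolutions of graded ideals and their degrees\<close>

definition graded_ideal :: "'x set \<Rightarrow> ('x, 'k::comm_ring_1) mpoly set \<Rightarrow> bool" where
  "graded_ideal A I \<longleftrightarrow> I \<subseteq> poly_ring A \<and> 0 \<in> I \<and> (\<forall>p\<in>I. \<forall>q\<in>I. p - q \<in> I) \<and>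
    (\<forall>c\<in>poly_ring A. \<forall>p\<in>I. c * p \<in> I) \<and> (\<forall>d. \<forall>p\<in>I. hcomp d p \<in> I)"

lemma graded_ideal_ideal_gen:
  "B \<subseteq> poly_ring A \<Longrightarrow> B \<subseteq> homogeneous e \<Longrightarrow> graded_ideal A (ideal_gen A B)"
  unfolding graded_ideal_def
  by (simp add: ideal_gen_subset_poly_ring ideal_gen_zero ideal_gen_diff ideal_gen_mult hcomp_ideal_gen)

text \<open>Placing the ideal in the free module of rank one with generator in degree 0 gives it the
  same type as its syzygy modules, so that dimension shifting applies uniformly.\<close>

definition as_vectors :: "'x set \<Rightarrow> ('x, 'k::comm_ring_1) mpoly set \<Rightarrow> ('x, 'k) pvec set" where
  "as_vectors A I = {u \<in> free_mod A 1. u 0 \<in> I}"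

definition as_vector :: "('x, 'k::comm_ring_1) mpoly \<Rightarrow> ('x, 'k) pvec" where
  "as_vector p = (\<lambda>l. if l = 0 then p else 0)"

lemma graded_submodule_as_vectors:
  "graded_ideal A I \<Longrightarrow> graded_submodule A [0] (as_vectors A I)"
  using free_mod_vcomp[of _ A "[0]"]
  unfolding graded_submodule_def as_vectors_def graded_ideal_def
  by (auto simp: free_mod_zero free_mod_diff free_mod_smul)
    (auto simp: smul_def vcomp_def)

lemma as_vector_in_as_vectors: "as_vector p \<in> as_vectors A I \<longleftrightarrow> p \<in> poly_ring A \<and> p \<in> I"
  unfolding as_vectors_def as_vector_def free_mod_def by auto

lemma as_vector_of_mem: "u \<in> as_vectors A I \<Longrightarrow> u = as_vector (u 0)"
  unfolding as_vectors_def as_vector_def free_mod_def by (auto simp: fun_eq_iff)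

lemma free_map_as_vector: "free_map r (\<lambda>k. as_vector (g k)) u = as_vector (lin_map (*) r g u)"
  unfolding free_map_def lin_map_def as_vector_def by (auto simp: fun_eq_iff)

lemma as_vector_eq_zero: "as_vector p = 0 \<longleftrightarrow> p = 0"
  unfolding as_vector_def by (auto simp: fun_eq_iff)

lemma coef_mult_zero:
  assumes "coef q 0 = 0"
  shows "coef (p * q :: ('x, 'k::comm_ring_1) mpoly) 0 = 0"
proof (rule ccontr)
  assume "coef (p * q) 0 \<noteq> 0"
  then obtain m n where "(0 :: 'x \<Rightarrow>\<^sub>0 nat) = m + n" "n \<in> supp q"
    using keys_mult[of p q] by (auto simp: in_keys_iff[symmetric])
  moreover from this have "mon_degree n = 0" using mon_degree_add[of m n] by simp
  ultimately show False using assms by (simp add: mon_degree_eq_zero in_keys_iff)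
qed

text \<open>The kernel of the map leaving F_i, which for \<open>i = 0\<close> is the augmentation
  onto the ideal; \<open>D i\<close> covers it from F_{i+1}.\<close>

definition syzygy_module ::
  "'x set \<Rightarrow> (nat \<Rightarrow> int list) \<Rightarrow> (nat \<Rightarrow> ('x, 'k::comm_ring_1) mpoly)
    \<Rightarrow> (nat \<Rightarrow> nat \<Rightarrow> ('x, 'k) pvec) \<Rightarrow> nat \<Rightarrow> ('x, 'k) pvec set" where
  "syzygy_module A ds g D i =
    (case i of 0 \<Rightarrow> syzygies A (ds 0) (\<lambda>k. as_vector (g k)) | Suc n \<Rightarrow> syzygies A (ds (Suc n)) (D n))"

text \<open>\<open>graded_free_resolution\<close> speaks about homogeneous components only; every
  element of a graded ideal is the finite sum of its own.\<close>

lemma graded_part_generate: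
  assumes I: "graded_ideal A I" and J: "\<And>d. graded_part I d \<subseteq> J" "0 \<in> J"
    and add: "\<And>p q. p \<in> J \<Longrightarrow> q \<in> J \<Longrightarrow> p + q \<in> J"
  shows "I \<subseteq> J"
proof
  fix p assume p: "p \<in> I"
  have "(\<Sum>d\<in>E. hcomp d p) \<in> J" for E
  proof (induction E rule: infinite_finite_induct)
    case (insert d E)
    have "hcomp d p \<in> graded_part I d"
      using I p hcomp_homogeneous unfolding graded_ideal_def graded_part_def by blast
    then show ?case using insert J(1) add by auto
  qed (use J(2) in auto)
  from this[of "(\<lambda>m. int (mon_degree m)) ` supp p"] show "p \<in> J"
    using sum_hcomp[of "(\<lambda>m. int (mon_degree m)) ` supp p" p] by simp
qed

text \<open>Exactness turns the condition that the entries of \<open>D i\<close> have no constant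
  term into the same condition on the kernel in F_i, whose elements are combinations of the vectors
  \<open>D i k\<close>.\<close>

lemma resolution_covers:
  fixes I :: "('x, 'k::field) mpoly set"
  assumes I: "graded_ideal A I"
    and res: "minimal_graded_free_resolution A (*) (graded_part I) ds g D"
  shows "minimal_cover A [0] (as_vectors A I) (ds 0) (\<lambda>k. as_vector (g k))"
    and "\<And>i. minimal_cover A (ds i) (syzygy_module A ds g D i) (ds (Suc i)) (D i)"
proof -
  let ?r = "\<lambda>i. length (ds i)"
  let ?F = "\<lambda>i. free_mod A (?r i) :: ('x, 'k) pvec set"
  have g: "\<And>k. k < ?r 0 \<Longrightarrow> g k \<in> graded_part I (ds 0 ! k)"
    and D: "\<And>i k. k < ?r (Suc i) \<Longrightarrow> D i k \<in> vec_part A (ds i) (ds (Suc i) ! k)"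
    and onto: "\<And>d. graded_part I d \<subseteq> lin_map (*) (?r 0) g ` ?F 0"
    and exact0: "{u \<in> ?F 0. lin_map (*) (?r 0) g u = 0} = free_map (?r 1) (D 0) ` ?F 1"
    and exact: "\<And>i. {u \<in> ?F (Suc i). free_map (?r (Suc i)) (D i) u = (\<lambda>l. 0)}
        = free_map (?r (Suc (Suc i))) (D (Suc i)) ` ?F (Suc (Suc i))"
    and min: "\<And>i k l. k < ?r (Suc i) \<Longrightarrow> l < ?r i \<Longrightarrow> D i k l \<in> irrelevant_ideal A"
    using res unfolding minimal_graded_free_resolution_def graded_free_resolution_def Let_def
    by (auto simp: vec_part_def)
  have syz0: "syzygy_module A ds g D 0 = free_map (?r 1) (D 0) ` ?F 1"
    unfolding syzygy_module_def syzygies_def exact0[symmetric]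
    by (simp add: free_map_as_vector as_vector_eq_zero)
  have image: "syzygy_module A ds g D i = free_map (?r (Suc i)) (D i) ` ?F (Suc i)" for i
  proof (cases i)
    case (Suc n)
    then show ?thesis
      unfolding syzygy_module_def syzygies_def using exact[of n] by (simp add: zero_fun_def)
  qed (use syz0 in simp)
  have const: "coef (u l) 0 = 0" if u: "u \<in> syzygy_module A ds g D i" and l: "l < ?r i" for u i l
  proof -
    obtain w where "u = free_map (?r (Suc i)) (D i) w" using u unfolding image by blast
    then have "coef (u l) 0 = (\<Sum>k<?r (Suc i). coef (w k * D i k l) 0)"
      by (simp add: free_map_def lookup_sum)
    also have "\<dots> = 0"
      using min l by (intro sum.neutral) (auto simp: irrelevant_ideal_def intro!: coef_mult_zero)
    finally show ?thesis .
  qed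
  have gI: "g k \<in> I" "g k \<in> homogeneous (ds 0 ! k)" "g k \<in> poly_ring A" if "k < ?r 0" for k
    using g[OF that] I unfolding graded_part_def graded_ideal_def by auto
  have I_eq: "I = lin_map (*) (?r 0) g ` ?F 0"
  proof
    have add: "p + q \<in> I" if "p \<in> I" "q \<in> I" for p q
    proof -
      have "0 - q \<in> I" using that I unfolding graded_ideal_def by blast
      then have "p - (0 - q) \<in> I" using that I unfolding graded_ideal_def by blast
      then show ?thesis by simp
    qed
    show "I \<subseteq> lin_map (*) (?r 0) g ` ?F 0"
    proof (rule graded_part_generate[OF I onto])
      show "0 \<in> lin_map (*) (?r 0) g ` ?F 0"
        using free_mod_zero by (rule image_eqI[rotated]) (simp add: lin_map_def)
      fix p q assume "p \<in> lin_map (*) (?r 0) g ` ?F 0" "q \<in> lin_map (*) (?r 0) g ` ?F 0"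
      then obtain u v where "u \<in> ?F 0" "v \<in> ?F 0" "p = lin_map (*) (?r 0) g u" "q = lin_map (*) (?r 0) g v"
        by blast
      moreover from this have "u + v \<in> ?F 0" unfolding free_mod_def by (auto intro: poly_ring_add)
      ultimately show "p + q \<in> lin_map (*) (?r 0) g ` ?F 0"
        by (intro image_eqI[of _ _ "u + v"]) (simp_all add: lin_map_def distrib_right sum.distrib)
    qed
    have "(\<Sum>k\<in>E. u k * g k) \<in> I" if u: "u \<in> ?F 0" and E: "E \<subseteq> {..<?r 0}" for u E
      using E
    proof (induction E rule: infinite_finite_induct)
      case (insert k E)
      then have "u k * g k \<in> I" using u gI I unfolding graded_ideal_def free_mod_def by auto
      then show ?case using insert add by simp
    qed (use I in \<open>auto simp: graded_ideal_def\<close>)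
    then show "lin_map (*) (?r 0) g ` ?F 0 \<subseteq> I" unfolding lin_map_def by blast
  qed
  show "minimal_cover A [0] (as_vectors A I) (ds 0) (\<lambda>k. as_vector (g k))"
    unfolding minimal_cover_def
  proof (intro conjI ballI allI impI)
    show "as_vector (g k) \<in> vec_part A [0] (ds 0 ! k)" if "k < ?r 0" for k
      using gI[OF that] unfolding vec_part_def free_mod_def as_vector_def by simp
    have "as_vectors A I = as_vector ` I"
      using I as_vector_of_mem[of _ A I] as_vector_in_as_vectors[of _ A I]
      unfolding graded_ideal_def by (auto simp: as_vectors_def)
    then show "as_vectors A I = free_map (?r 0) (\<lambda>k. as_vector (g k)) ` ?F 0"
      unfolding free_map_as_vector using I_eq by (simp add: image_image)
    show "coef (u k) 0 = 0"
      if "u \<in> ?F 0" "free_map (?r 0) (\<lambda>k. as_vector (g k)) u = 0" "k < ?r 0" for u k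
      using const[of u 0 k] that unfolding syzygy_module_def syzygies_def by simp
  qed
  show "minimal_cover A (ds i) (syzygy_module A ds g D i) (ds (Suc i)) (D i)" for i
    unfolding minimal_cover_def
  proof (intro conjI ballI allI impI)
    show "coef (u k) 0 = 0"
      if "u \<in> ?F (Suc i)" "free_map (?r (Suc i)) (D i) u = 0" "k < ?r (Suc i)" for u k
      using const[of u "Suc i" k] that unfolding syzygy_module_def syzygies_def by simp
  qed (use D image in auto)
qed

context poly_koszul
begin

text \<open>Minimal covers are chained by dependent choice: a state is a graded submodule, the
  degrees of its ambient free module and a cover; the next submodule consists of the syzygies of
  that cover. This gives the \<open>SOME\<close> in \<open>betti\<close> its meaning.\<close>

lemma minimal_resolution_exists:
  fixes I :: "('x, 'k) mpoly set"
  assumes I: "graded_ideal A I"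
  shows "\<exists>ds g D. minimal_graded_free_resolution A (*) (graded_part I) ds g D"
proof -
  define P :: "nat \<Rightarrow> (int list \<times> ('x, 'k) pvec set) \<times> int list \<times> (nat \<Rightarrow> ('x, 'k) pvec) \<Rightarrow> bool"
    where "P n x \<longleftrightarrow> (case x of ((ds, Z), es, D) \<Rightarrow> graded_submodule A ds Z \<and> minimal_cover A ds Z es D \<and>
      (n = 0 \<longrightarrow> ds = [0] \<and> Z = as_vectors A I))" for n x
  define Q :: "nat \<Rightarrow> (int list \<times> ('x, 'k) pvec set) \<times> int list \<times> (nat \<Rightarrow> ('x, 'k) pvec) \<Rightarrow> _ \<Rightarrow> bool"
    where "Q n x y \<longleftrightarrow> (case x of (_, es, D) \<Rightarrow> fst y = (es, syzygies A es D))" for n x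
      and y :: "(int list \<times> ('x, 'k) pvec set) \<times> int list \<times> (nat \<Rightarrow> ('x, 'k) pvec)"
  have "\<exists>f. \<forall>n. P n (f n) \<and> Q n (f n) (f (Suc n))"
  proof (rule dependent_nat_choice)
    show "\<exists>x. P 0 x"
      using graded_submodule_as_vectors[OF I] minimal_cover_exists unfolding P_def by fastforce
    fix x n assume "P n x"
    obtain ds Z es D where eq: "x = ((ds, Z), es, D)" by (metis surj_pair)
    with \<open>P n x\<close> have x: "x = ((ds, Z), es, D)" "minimal_cover A ds Z es D" unfolding P_def by auto
    have "graded_submodule A es (syzygies A es D)"
      by (rule graded_submodule_syzygies[OF minimal_coverD(1)[OF x(2)]])
    moreover from this obtain es' D' where "minimal_cover A es (syzygies A es D) es' D'"
      using minimal_cover_exists by blast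
    ultimately have "P (Suc n) ((es, syzygies A es D), es', D')" unfolding P_def by simp
    moreover have "Q n x ((es, syzygies A es D), es', D')" unfolding Q_def x by simp
    ultimately show "\<exists>y. P (Suc n) y \<and> Q n x y" by blast
  qed
  then obtain f where f: "\<And>n. P n (f n)" "\<And>n. Q n (f n) (f (Suc n))" by blast
  define ds where "ds n = fst (snd (f n))" for n
  define D' where "D' n = snd (snd (f n))" for n
  define g where "g k = D' 0 k 0" for k
  have cover0: "minimal_cover A [0] (as_vectors A I) (ds 0) (D' 0)"
    using f(1)[of 0] unfolding P_def ds_def D'_def by (auto split: prod.splits)
  have cover: "minimal_cover A (ds n) (syzygies A (ds n) (D' n)) (ds (Suc n)) (D' (Suc n))" for n
    using f(1)[of "Suc n"] f(2)[of n] unfolding P_def Q_def ds_def D'_def by (auto split: prod.splits)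
  have D'0: "D' 0 k = as_vector (g k)" and gI: "g k \<in> graded_part I (ds 0 ! k)"
    if k: "k < length (ds 0)" for k
  proof -
    have "free_map (length (ds 0)) (D' 0) (\<lambda>l. if l = k then 1 else 0) \<in> as_vectors A I"
      using minimal_coverD(2)[OF cover0] unit_in_vec_part[OF k] unfolding vec_part_def by blast
    then have mem: "D' 0 k \<in> as_vectors A I" unfolding free_map_unit[OF k] .
    then show "D' 0 k = as_vector (g k)" unfolding g_def by (rule as_vector_of_mem)
    have "D' 0 k \<in> vec_part A [0] (ds 0 ! k)" using minimal_coverD(1)[OF cover0 k] .
    then show "g k \<in> graded_part I (ds 0 ! k)"
      using mem unfolding g_def graded_part_def as_vectors_def vec_part_def by simp
  qed
  have eps: "free_map (length (ds 0)) (D' 0) u = as_vector (lin_map (*) (length (ds 0)) g u)" for u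
    unfolding free_map_as_vector[symmetric] free_map_def using D'0 by (intro ext sum.cong) auto
  \<comment> \<open>Each vector \<open>D' (Suc i) k\<close> is a syzygy of the preceding minimal
    cover.\<close>
  have irr: "D' (Suc i) k l \<in> irrelevant_ideal A" if k: "k < length (ds (Suc i))" and l: "l < length (ds i)" for i k l
  proof -
    have "free_map (length (ds (Suc i))) (D' (Suc i)) (\<lambda>l. if l = k then 1 else 0) \<in> syzygies A (ds i) (D' i)"
      using minimal_coverD(2)[OF cover[of i]] unit_in_vec_part[OF k] unfolding vec_part_def by blast
    then have mem: "D' (Suc i) k \<in> syzygies A (ds i) (D' i)" unfolding free_map_unit[OF k] .
    have "coef (D' (Suc i) k l) 0 = 0"
    proof (cases i)
      case 0
      then show ?thesis using minimal_coverD(3)[OF cover0] mem l by blast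
    next
      case (Suc n)
      then show ?thesis using minimal_coverD(3)[OF cover[of n]] mem l by blast
    qed
    then show ?thesis using mem l unfolding irrelevant_ideal_def syzygies_def free_mod_def by blast
  qed
  have "minimal_graded_free_resolution A (*) (graded_part I) ds g (\<lambda>i. D' (Suc i))"
    unfolding minimal_graded_free_resolution_def graded_free_resolution_def Let_def
  proof (intro conjI allI impI)
    fix i k assume k: "k < length (ds (Suc i))"
    have vec: "D' (Suc i) k \<in> vec_part A (ds i) (ds (Suc i) ! k)" using minimal_coverD(1)[OF cover[of i] k] .
    then show "D' (Suc i) k \<in> free_mod A (length (ds i))" unfolding vec_part_def by blast
    show "D' (Suc i) k l \<in> homogeneous (ds (Suc i) ! k - ds i ! l)" if "l < length (ds i)" for l
      using vec that unfolding vec_part_def by blast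
  next
    fix d
    show "graded_part I d \<subseteq> lin_map (*) (length (ds 0)) g ` free_mod A (length (ds 0))"
    proof
      fix p assume "p \<in> graded_part I d"
      then have "as_vector p \<in> as_vectors A I"
        using I unfolding as_vector_in_as_vectors graded_part_def graded_ideal_def by blast
      then obtain u where u: "u \<in> free_mod A (length (ds 0))" "as_vector p = free_map (length (ds 0)) (D' 0) u"
        using minimal_coverD(2)[OF cover0] by blast
      then have "p = lin_map (*) (length (ds 0)) g u"
        unfolding eps as_vector_def by (metis (full_types))
      then show "p \<in> lin_map (*) (length (ds 0)) g ` free_mod A (length (ds 0))" using u(1) by blast
    qed
  next
    show "{u \<in> free_mod A (length (ds 0)). lin_map (*) (length (ds 0)) g u = 0}
        = free_map (length (ds (Suc 0))) (D' (Suc 0)) ` free_mod A (length (ds 1))"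
      using minimal_coverD(2)[OF cover[of 0]] unfolding syzygies_def eps as_vector_eq_zero by simp
    show "{u \<in> free_mod A (length (ds (Suc i))). free_map (length (ds (Suc i))) (D' (Suc i)) u = (\<lambda>l. 0)}
        = free_map (length (ds (Suc (Suc i)))) (D' (Suc (Suc i))) ` free_mod A (length (ds (Suc (Suc i))))" for i
      using minimal_coverD(2)[OF cover[of "Suc i"]] unfolding syzygies_def zero_fun_def by simp
  qed (use gI irr in auto)
  then show ?thesis by blast
qed

lemma vanishes_as_vectors_iff:
  fixes I :: "('x, 'k) mpoly set"
  assumes I: "graded_ideal A I"
  shows "vec.vanishes (part [0] (as_vectors A I)) zero_family i j \<longleftrightarrow> vanishes (graded_part I) Null i j"
proof -
  have I': "I \<subseteq> poly_ring A" using I unfolding graded_ideal_def by blast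
  interpret koszul_map A ord vec_op "\<lambda>a p. indet a * p" "\<lambda>u. u 0"
    "part [0] (as_vectors A I)" zero_family "graded_part I" Null
  proof unfold_locales
    show "vec.graded (part [0] (as_vectors A I))"
      by (rule graded_part_submodule[OF graded_submodule_as_vectors[OF I]])
    show "graded Null" by (rule graded_family_zero)
    show "graded (graded_part I)"
      using I unfolding graded_ideal_def by (intro graded_family_graded_part) (auto intro: poly_ring_indet)
    show "Null d \<subseteq> graded_part I d" for d
      using I unfolding graded_ideal_def graded_part_def by auto
    show "\<exists>u\<in>part [0] (as_vectors A I) d. m - u 0 \<in> Null d" if m: "m \<in> graded_part I d" for d m
    proof
      show "as_vector m \<in> part [0] (as_vectors A I) d"
        using m I' as_vector_in_as_vectors[of m A I] unfolding graded_part_def vec_part_def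
        by (auto simp: as_vectors_def) (simp add: as_vector_def)
      show "m - as_vector m 0 \<in> Null d" by (simp add: as_vector_def graded_part_def homogeneous_zero)
    qed
    show "u 0 \<in> graded_part I d" if "u \<in> part [0] (as_vectors A I) d" for d u
      using that unfolding graded_part_def vec_part_def as_vectors_def by auto
    show "{0} = {u \<in> part [0] (as_vectors A I) d. u 0 \<in> Null d}" for d
    proof
      show "{u \<in> part [0] (as_vectors A I) d. u 0 \<in> Null d} \<subseteq> {0}"
      proof
        fix u assume "u \<in> {u \<in> part [0] (as_vectors A I) d. u 0 \<in> Null d}"
        then have "u = as_vector (u 0)" "u 0 = 0"
          using as_vector_of_mem[of u A I] unfolding graded_part_def by auto
        then show "u \<in> {0}" using as_vector_eq_zero[of "u 0"] by simp
      qed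
      show "{0} \<subseteq> {u \<in> part [0] (as_vectors A I) d. u 0 \<in> Null d}"
        using graded_submodule_as_vectors[OF I] vec_part_zero
        by (auto simp: graded_submodule_def graded_part_def homogeneous_zero)
    qed
  qed (auto simp: smul_def)
  show ?thesis by (rule vanishes_iff)
qed

text \<open>Dimension shifting carries Tor_i of the ideal to Tor_0 of a syzygy module whose minimal
  cover is F_i. Hence the set of degrees does not depend on the chosen resolution.\<close>

lemma vanishes_iff_degrees:
  fixes I :: "('x, 'k) mpoly set"
  assumes I: "graded_ideal A I"
    and res: "minimal_graded_free_resolution A (*) (graded_part I) ds g D"
  shows "vanishes (graded_part I) Null (int i) j \<longleftrightarrow> j \<notin> set (ds i)"
proof -
  let ?Z = "syzygy_module A ds g D"
  note cover0 = resolution_covers(1)[OF I res] and cover = resolution_covers(2)[OF I res]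
  note vec0 = graded_submodule_as_vectors[OF I]
  have Z: "graded_submodule A (ds m) (?Z m)" for m
    using graded_submodule_syzygies[OF minimal_coverD(1)[OF cover0]]
      graded_submodule_syzygies[OF minimal_coverD(1)[OF cover]]
    by (cases m) (simp_all add: syzygy_module_def)
  \<comment> \<open>The syzygy module of index \<open>m\<close> lies in F_m and is covered by
    F_{m+1}, hence the index \<open>Suc (m + n)\<close>.\<close>
  have later: "vec.vanishes (part (ds m) (?Z m)) zero_family (int n) j \<longleftrightarrow> j \<notin> set (ds (Suc (m + n)))" for m n
  proof (induction n arbitrary: m)
    case 0
    then show ?case using vanishes_zero_iff[OF cover Z, of m j] by (simp only: of_nat_0 add_0_right)
  next
    case (Suc n)
    have "vec.vanishes (part (ds m) (?Z m)) zero_family (int n + 1) j \<longleftrightarrow>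
        vec.vanishes (part (ds (Suc m)) (?Z (Suc m))) zero_family (int n) j"
      using vanishes_suc_iff[OF cover Z, of "int n" m j] unfolding syzygy_module_def by simp
    then show ?case using Suc[of "Suc m"] by (simp only: of_nat_Suc add.commute[of 1] add_Suc add_Suc_right)
  qed
  show ?thesis
  proof (cases i)
    case 0
    then show ?thesis
      using vanishes_zero_iff[OF cover0 vec0, of j] vanishes_as_vectors_iff[OF I, of 0 j]
      by (simp only: of_nat_0)
  next
    case (Suc n)
    have "vec.vanishes (part [0] (as_vectors A I)) zero_family (int n + 1) j \<longleftrightarrow>
        vec.vanishes (part (ds 0) (?Z 0)) zero_family (int n) j"
      using vanishes_suc_iff[OF cover0 vec0, of "int n" j] unfolding syzygy_module_def by simp
    then show ?thesis
      using later[of 0 n] vanishes_as_vectors_iff[OF I, of "int n + 1" j] unfolding Suc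
      by (simp only: of_nat_Suc add.commute[of 1] add_0)
  qed
qed

text \<open>\<open>Max\<close> needs a finite nonempty set: Koszul chains stop at the number of
  variables, so F_i is zero beyond it, and a nonzero ideal needs a generator. Ranging over all
  integers \<open>i\<close> adds only negative ones, where there are no chains.\<close>

lemma regularity_le_iff:
  fixes I :: "('x, 'k) mpoly set"
  assumes I: "graded_ideal A I" and nz: "I \<noteq> {0}"
  shows "regularity A (*) (graded_part I) \<le> r \<longleftrightarrow>
    (\<forall>i j. j > r + i \<longrightarrow> vanishes (graded_part I) Null i j)"
proof -
  define ds where "ds = (SOME ds. \<exists>g D. minimal_graded_free_resolution A (*) (graded_part I) ds g D)"
  have "\<exists>g D. minimal_graded_free_resolution A (*) (graded_part I) ds g D"
    unfolding ds_def by (rule someI_ex[OF minimal_resolution_exists[OF I]])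
  then obtain g D where res: "minimal_graded_free_resolution A (*) (graded_part I) ds g D" by blast
  note van = vanishes_iff_degrees[OF I res]
  let ?R = "{j - int i |i j. betti A (*) (graded_part I) i j \<noteq> 0}"
  have R: "?R = {j - int i |i j. j \<in> set (ds i)}"
    unfolding betti_def ds_def[symmetric] by (auto simp: count_list_0_iff)
  have neg: "graded (graded_part I)"
    using I unfolding graded_ideal_def by (intro graded_family_graded_part) (auto intro: poly_ring_indet)
  have "ds i = []" if i: "i > card A" for i
  proof -
    have "vanishes (graded_part I) Null (int i) j" for j
    proof (rule vanishesI, rule bexI[of _ 0])
      have "card T \<noteq> i" if "T \<subseteq> A" for T using card_mono[OF finite_vars that] i by simp
      then show "u - bd 0 \<in> kchains Null (int i) j" for u unfolding koszul_chains_def by simp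
    qed (auto simp: koszul_chains_def graded_zero[OF neg])
    then have "j \<notin> set (ds i)" for j using van by blast
    then show ?thesis by (metis last_in_set)
  qed
  then have "?R \<subseteq> (\<Union>i\<le>card A. (\<lambda>j. j - int i) ` set (ds i))"
    unfolding R by (force simp: not_less[symmetric])
  then have fin: "finite ?R" by (rule finite_subset) simp
  have "ds 0 \<noteq> []"
  proof
    assume "ds 0 = []"
    then have onto: "graded_part I d \<subseteq> {0}" for d
      using res unfolding minimal_graded_free_resolution_def graded_free_resolution_def Let_def lin_map_def by auto
    have "I \<subseteq> {0}" by (rule graded_part_generate[OF I onto]) auto
    then show False using nz I unfolding graded_ideal_def by blast
  qed
  then have ne: "?R \<noteq> {}" unfolding R by (metis (mono_tags, lifting) empty_iff hd_in_set mem_Collect_eq)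
  have "regularity A (*) (graded_part I) \<le> r \<longleftrightarrow> (\<forall>i j. j \<in> set (ds i) \<longrightarrow> j - int i \<le> r)"
    unfolding regularity_def Max_le_iff[OF fin ne] unfolding R by blast
  also have "\<dots> \<longleftrightarrow> (\<forall>i j. j > r + int i \<longrightarrow> vanishes (graded_part I) Null (int i) j)"
    unfolding van by force
  also have "\<dots> \<longleftrightarrow> (\<forall>i j. j > r + i \<longrightarrow> vanishes (graded_part I) Null i j)"
    using vanishes_negative[OF neg] by (metis nonneg_int_cases not_less)
  finally show ?thesis .
qed

end

section \<open>Setting variables to zero\<close>

abbreviation poly_vanishes ::
  "'x set \<Rightarrow> ('x \<Rightarrow> nat) \<Rightarrow> ('x, 'k::field) mpoly set \<Rightarrow> ('x, 'k) mpoly set \<Rightarrow> int \<Rightarrow> int \<Rightarrow> bool" where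
  "poly_vanishes A ord I J \<equiv> koszul_vanishes A ord (\<lambda>a p. indet a * p) (graded_part I) (graded_part J)"

definition proj :: "'x set \<Rightarrow> ('x, 'k::comm_ring_1) mpoly \<Rightarrow> ('x, 'k) mpoly" where
  "proj B = restrict_supp (\<lambda>m. supp m \<subseteq> B)"

lemma proj_zero [simp]: "proj B 0 = 0"
  unfolding proj_def by simp

lemma proj_add: "proj B (p + q) = proj B p + proj B q"
  unfolding proj_def by (rule restrict_supp_add)

lemma proj_diff: "proj B (p - q) = proj B p - proj B q"
  using proj_add[of B "p - q" q] by (simp add: algebra_simps)

lemma proj_minus: "proj B (- p) = - proj B p"
  using proj_diff[of B 0 p] by simp

lemma proj_sum: "proj B (sum f I) = (\<Sum>i\<in>I. proj B (f i))"
  unfolding proj_def by (rule restrict_supp_sum)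

lemma proj_sign: "proj B (koszul_sign ord a T p) = koszul_sign ord a T (proj B p)"
  unfolding koszul_sign_def by (simp add: proj_minus)

lemma proj_monom: "proj B (monom m c) = (if supp m \<subseteq> B then monom m c else 0)"
  unfolding proj_def by (auto intro!: restrict_supp_id restrict_supp_none split: if_splits)

lemma proj_mult: "proj B (p * q) = proj B p * proj B q"
proof -
  have mono: "proj B (monom m c * q) = proj B (monom m c) * proj B q" for m c
  proof -
    have "proj B (monom m c * (\<Sum>n\<in>supp q. monom n (coef q n)))
        = proj B (monom m c) * (\<Sum>n\<in>supp q. proj B (monom n (coef q n)))"
      by (auto simp: sum_distrib_left proj_sum mult_single proj_monom supp_add_nat intro!: sum.cong)
    then show ?thesis
      unfolding proj_sum[symmetric] using poly_sum_monom[of "supp q" q] by simp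
  qed
  have p: "p = (\<Sum>m\<in>supp p. monom m (coef p m))" by (rule poly_sum_monom) auto
  have "proj B (p * q) = (\<Sum>m\<in>supp p. proj B (monom m (coef p m) * q))"
    by (subst p) (simp only: sum_distrib_right proj_sum)
  also have "\<dots> = proj B (\<Sum>m\<in>supp p. monom m (coef p m)) * proj B q"
    by (simp only: mono proj_sum sum_distrib_right)
  finally show ?thesis unfolding p[symmetric] .
qed

lemma proj_indet: "proj B (indet a) = (if a \<in> B then indet a else 0)"
  unfolding indet_eq_monom proj_monom by simp

lemma proj_in_poly_ring: "proj B p \<in> poly_ring B"
  unfolding proj_def poly_ring_def by (auto simp: supp_restrict_supp)

lemma proj_id: "p \<in> poly_ring B \<Longrightarrow> proj B p = p"
  unfolding proj_def poly_ring_def by (rule restrict_supp_id) blast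

lemma proj_homogeneous: "p \<in> homogeneous d \<Longrightarrow> proj B p \<in> homogeneous d"
  unfolding proj_def homogeneous_def by (simp add: supp_restrict_supp)

lemma proj_koszul_bd:
  fixes u :: "'x set \<Rightarrow> ('x, 'k::comm_ring_1) mpoly"
  assumes "finite A" "B \<subseteq> A" "T \<subseteq> A"
  shows "proj B (koszul_bd A ord (\<lambda>a p. indet a * p) u T)
    = (\<Sum>a\<in>B - T. koszul_sign ord a T (indet a * proj B (u (insert a T))))"
proof -
  have "proj B (koszul_bd A ord (\<lambda>a p. indet a * p) u T)
      = (\<Sum>a\<in>A - T. if a \<in> B then koszul_sign ord a T (indet a * proj B (u (insert a T))) else 0)"
    unfolding koszul_bd_def proj_sum proj_sign proj_mult proj_indet
    by (intro sum.cong) (auto simp: koszul_sign_def)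
  also have "\<dots> = (\<Sum>a\<in>B - T. koszul_sign ord a T (indet a * proj B (u (insert a T))))"
    using assms by (intro sum.mono_neutral_cong_right) auto
  finally show ?thesis .
qed


section \<open>Regularity and binomial edge ideals of subgraphs of a complete graph\<close>

lemma edge_binomial_monom:
  "edge_binomial i j = monom (expo (XVar i) + expo (YVar j)) 1 - monom (expo (XVar j) + expo (YVar i)) 1"
  unfolding edge_binomial_def indet_eq_monom by (simp add: mult_single)

lemma edge_binomial_homogeneous: "edge_binomial i j \<in> homogeneous 2"
  unfolding edge_binomial_monom
  by (intro homogeneous_diff homogeneous_monom) (simp_all add: mon_degree_add)

lemma edge_binomial_in_poly_ring: "i \<in> V \<Longrightarrow> j \<in> V \<Longrightarrow> edge_binomial i j \<in> poly_ring (bei_vars V)"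
  unfolding edge_binomial_def by (auto intro!: poly_ring_diff poly_ring_mult poly_ring_indet)

lemma proj_edge_binomial:
  "proj (bei_vars V) (edge_binomial i j) = (if i \<in> V \<and> j \<in> V then edge_binomial i j else 0)"
  unfolding edge_binomial_monom proj_diff proj_monom by (auto simp: supp_add_nat)

lemma binomial_edge_ideal_gen:
  "{i, j} \<in> E \<Longrightarrow> c \<in> poly_ring (bei_vars V) \<Longrightarrow> c * edge_binomial i j \<in> binomial_edge_ideal V E"
  unfolding binomial_edge_ideal_def by (rule ideal_gen_gen) auto

lemma binomial_edge_ideal_closed:
  assumes "p \<in> binomial_edge_ideal V E" "0 \<in> J" "\<And>p q. p \<in> J \<Longrightarrow> q \<in> J \<Longrightarrow> p + q \<in> J"
    and "\<And>c i j. c \<in> poly_ring (bei_vars V) \<Longrightarrow> {i, j} \<in> E \<Longrightarrow> c * edge_binomial i j \<in> J"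
  shows "p \<in> J"
  using assms(1) unfolding binomial_edge_ideal_def
  by (rule ideal_gen_closed) (use assms(2-4) in auto)

lemma binomial_edge_ideal_add:
  "p \<in> binomial_edge_ideal V E \<Longrightarrow> q \<in> binomial_edge_ideal V E \<Longrightarrow> p + q \<in> binomial_edge_ideal V E"
  unfolding binomial_edge_ideal_def by (rule ideal_gen_add)

lemma binomial_edge_ideal_diff:
  "p \<in> binomial_edge_ideal V E \<Longrightarrow> q \<in> binomial_edge_ideal V E \<Longrightarrow> p - q \<in> binomial_edge_ideal V E"
  unfolding binomial_edge_ideal_def by (rule ideal_gen_diff)

lemma binomial_edge_ideal_mult:
  "p \<in> binomial_edge_ideal V E \<Longrightarrow> c \<in> poly_ring (bei_vars V) \<Longrightarrow> c * p \<in> binomial_edge_ideal V E"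
  unfolding binomial_edge_ideal_def by (rule ideal_gen_mult)

lemma binomial_edge_ideal_zero: "0 \<in> binomial_edge_ideal V E"
  unfolding binomial_edge_ideal_def by (rule ideal_gen_zero)

lemma binomial_edge_ideal_mono:
  assumes "V' \<subseteq> V" "E' \<subseteq> E"
  shows "binomial_edge_ideal V' E' \<subseteq> binomial_edge_ideal V E"
proof
  fix p assume "p \<in> binomial_edge_ideal V' E'"
  then show "p \<in> binomial_edge_ideal V E"
  proof (rule binomial_edge_ideal_closed)
    show "c * edge_binomial i j \<in> binomial_edge_ideal V E"
      if "c \<in> poly_ring (bei_vars V')" "{i, j} \<in> E'" for c i j
      using that assms poly_ring_mono[of "bei_vars V'" "bei_vars V" c]
      by (intro binomial_edge_ideal_gen) (auto simp: bei_vars_def)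
  qed (auto intro: binomial_edge_ideal_zero binomial_edge_ideal_add)
qed

lemma graded_family_binomial_edge_ideal:
  "bei_vars W \<subseteq> bei_vars V \<Longrightarrow> graded_family (bei_vars W) (\<lambda>a p. indet a * p) (graded_part (binomial_edge_ideal V E))"
  using graded_family_ideal_gen[of "bei_vars V"] unfolding binomial_edge_ideal_def graded_family_def by blast

text \<open>Setting the variables outside \<open>W\<close> to zero keeps f_ij when both ends lie in
  \<open>W\<close> and kills it otherwise, so the ideal maps into that of the induced
  subgraph.\<close>

lemma proj_binomial_edge_ideal:
  assumes "p \<in> binomial_edge_ideal V E" and "\<And>e. e \<in> E \<Longrightarrow> e \<subseteq> W \<Longrightarrow> e \<in> F"
  shows "proj (bei_vars W) p \<in> binomial_edge_ideal W F"
proof -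
  have "p \<in> {p. proj (bei_vars W) p \<in> binomial_edge_ideal W F}"
    using assms(1)
  proof (rule binomial_edge_ideal_closed)
    show "c * edge_binomial i j \<in> {p. proj (bei_vars W) p \<in> binomial_edge_ideal W F}"
      if "{i, j} \<in> E" for c i j
      using assms(2)[OF that]
      by (auto simp: proj_mult proj_edge_binomial binomial_edge_ideal_zero
        intro!: binomial_edge_ideal_gen proj_in_poly_ring)
  qed (auto simp: binomial_edge_ideal_zero proj_add binomial_edge_ideal_add)
  then show ?thesis by blast
qed

lemma simple_graph_edges:
  assumes "fin_simple_graph V E"
  shows "E \<subseteq> complete_edges V" and "{i, j} \<in> E \<Longrightarrow> i \<in> V \<and> j \<in> V \<and> i \<noteq> j"
proof -
  show "{i, j} \<in> E \<Longrightarrow> i \<in> V \<and> j \<in> V \<and> i \<noteq> j" for i j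
    using assms unfolding fin_simple_graph_def by (cases "i = j") force+
  show "E \<subseteq> complete_edges V"
  proof
    fix e assume "e \<in> E"
    then have "e \<subseteq> V" "card e = 2" using assms unfolding fin_simple_graph_def by auto
    then show "e \<in> complete_edges V" unfolding complete_edges_def card_2_iff by blast
  qed
qed

lemma quadric_supp_eq:
  "expo (XVar i) + expo (YVar j) = expo (XVar k) + expo (YVar l) \<longleftrightarrow> i = k \<and> j = l"
proof
  assume "expo (XVar i) + expo (YVar j) = expo (XVar k) + expo (YVar l)"
  then have "{XVar i, YVar j} = {XVar k, YVar l}"
    using supp_add_nat[of "expo (XVar i)" "expo (YVar j)"] supp_add_nat[of "expo (XVar k)" "expo (YVar l)"]
    by (simp add: insert_commute)
  then show "i = k \<and> j = l" by (auto simp: doubleton_eq_iff)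
qed simp

lemma coef_edge_binomial:
  "coef (edge_binomial i j) (expo (XVar k) + expo (YVar l)) =
    (if i = k \<and> j = l then 1 else 0) - (if j = k \<and> i = l then 1 else 0)"
  unfolding edge_binomial_monom lookup_minus lookup_single when_def quadric_supp_eq ..

lemma edge_binomial_nonzero:
  assumes "i \<noteq> j"
  shows "(edge_binomial i j :: ('v bvar, 'k::comm_ring_1) mpoly) \<noteq> 0"
proof
  assume "edge_binomial i j = (0 :: ('v bvar, 'k) mpoly)"
  then have "coef (edge_binomial i j :: ('v bvar, 'k) mpoly) (expo (XVar i) + expo (YVar j)) = 0" by simp
  then show False unfolding coef_edge_binomial using assms by simp
qed

lemma graded_ideal_binomial_edge_ideal:
  assumes "fin_simple_graph V E"
  shows "graded_ideal (bei_vars V) (binomial_edge_ideal V E)"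
  unfolding binomial_edge_ideal_def
  using simple_graph_edges(2)[OF assms]
  by (intro graded_ideal_ideal_gen[of _ _ 2]) (auto intro: edge_binomial_homogeneous edge_binomial_in_poly_ring)

text \<open>For a graph without edges the ideal is zero and all its Koszul homology vanishes; the
  convention of regularity 1 agrees with this criterion exactly for
  \<open>r \<ge> 1\<close>.\<close>

lemma bei_reg_le_iff:
  fixes V :: "'v set" and K :: "'k::field itself"
  assumes G: "fin_simple_graph V E" and ord: "inj_on ord (bei_vars V)" and r: "r \<ge> 1"
  shows "bei_reg K V E \<le> r \<longleftrightarrow>
    (\<forall>i j. j > r + i \<longrightarrow> poly_vanishes (bei_vars V) ord (binomial_edge_ideal V E :: ('v bvar, 'k) mpoly set) {0} i j)"
proof -
  let ?J = "binomial_edge_ideal V E :: ('v bvar, 'k) mpoly set"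
  have finV: "finite V" using G unfolding fin_simple_graph_def by blast
  interpret poly_koszul "bei_vars V" ord K
    using finV ord by unfold_locales (auto simp: finite_bei_vars)
  show ?thesis
  proof (cases "E = {}")
    case True
    have "?J = {0}" unfolding binomial_edge_ideal_def ideal_gen_def True by auto
    moreover have "vanishes Null Null i j" for i j
    proof (rule vanishesI, rule bexI[of _ 0])
      have "bd 0 = 0" using bd_diff[of 0 0] by simp
      then show "u - bd 0 \<in> kchains Null i j" if "u \<in> kchains Null i j" for u using that by simp
    qed (simp add: koszul_chains_def graded_part_def homogeneous_zero)
    ultimately show ?thesis using True r by (simp add: bei_reg_def)
  next
    case False
    then obtain e where "e \<in> E" by blast
    then obtain i j where ij: "{i, j} \<in> E" "i \<noteq> j"
      using simple_graph_edges(1)[OF G] unfolding complete_edges_def by blast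
    have "1 * edge_binomial i j \<in> ?J" by (rule binomial_edge_ideal_gen[OF ij(1) poly_ring_one])
    then have "?J \<noteq> {0}" using edge_binomial_nonzero[OF ij(2)] by auto
    then show ?thesis
      using regularity_le_iff[OF graded_ideal_binomial_edge_ideal[OF G], of r] False
      unfolding bei_reg_def graded_part_def by simp
  qed
qed

context complete_bei
begin

text \<open>
  Since \<open>J_complete\<close> is generated in degree 2 with linear resolution, above the linear strand the Koszul
  homology of \<open>J\<close> is that of \<open>J_complete / J\<close>, shifted by one homological degree.
\<close>

lemma regularity_quotient_iff:
  fixes E :: "'v set set"
  assumes E: "E \<subseteq> complete_edges V" and r: "r \<ge> 3"
  defines "J \<equiv> binomial_edge_ideal V E :: ('v bvar, 'k) mpoly set"
  shows "(\<forall>i j. j > r + i \<longrightarrow> vanishes (graded_part J) Null i j) \<longleftrightarrow>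
    (\<forall>i j. j > r - 1 + i \<longrightarrow> vanishes (graded_part J_complete) (graded_part J) i j)"
proof -
  have fams: "graded Null" "graded (graded_part J)" "graded (graded_part J_complete)"
    unfolding J_def by (auto intro: graded_family_zero graded_family_binomial_edge_ideal)
  have subs: "Null d \<subseteq> graded_part J d" "graded_part J d \<subseteq> graded_part J_complete d" for d
    using binomial_edge_ideal_mono[OF subset_refl E] binomial_edge_ideal_zero
    unfolding J_def graded_part_def by blast+
  show ?thesis
  proof (intro iffI allI impI)
    fix i j assume J: "\<forall>i j. j > r + i \<longrightarrow> vanishes (graded_part J) Null i j" and ij: "j > r - 1 + i"
    have "vanishes (graded_part J_complete) Null i j" using ij r by (intro vanishes_J_complete) simp
    moreover have "vanishes (graded_part J) Null (i - 1) j" using J ij by simp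
    ultimately show "vanishes (graded_part J_complete) (graded_part J) i j"
      by (rule vanishes_quotient[OF fams subs])
  next
    fix i j assume Q: "\<forall>i j. j > r - 1 + i \<longrightarrow> vanishes (graded_part J_complete) (graded_part J) i j"
      and ij: "j > r + i"
    have "vanishes (graded_part J_complete) Null i j" using ij r by (intro vanishes_J_complete) simp
    moreover have "vanishes (graded_part J_complete) (graded_part J) (i + 1) j" using Q ij by simp
    ultimately show "vanishes (graded_part J) Null i j"
      by (rule vanishes_sub[OF fams subs])
  qed
qed

end


section \<open>Restricting the Koszul complex to the variables of an induced subgraph\<close>

text \<open>I'/J' is a retract of I/J: the inclusion followed by \<open>proj B\<close> is the
  identity, since \<open>I'\<close> lies in the ring of \<open>B\<close>.\<close>

locale koszul_subring =
  fixes A B :: "'x set" and ord :: "'x \<Rightarrow> nat" and I J I' J' :: "('x, 'k::field) mpoly set"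
  assumes finite_A: "finite A" and subset: "B \<subseteq> A" and inj_ord: "inj_on ord A"
    and ideal_I: "graded_family A (\<lambda>a p. indet a * p) (graded_part I)"
    and ideal_J: "graded_family A (\<lambda>a p. indet a * p) (graded_part J)"
    and I'_ring: "I' \<subseteq> poly_ring B" and I'_I: "I' \<subseteq> I" and J'_J: "J' \<subseteq> J"
    and proj_I: "p \<in> I \<Longrightarrow> proj B p \<in> I'" and proj_J: "p \<in> J \<Longrightarrow> proj B p \<in> J'"
begin

abbreviation "bd_A \<equiv> koszul_bd A ord (\<lambda>a (p :: ('x, 'k) mpoly). indet a * p)"
abbreviation "bd_B \<equiv> koszul_bd B ord (\<lambda>a (p :: ('x, 'k) mpoly). indet a * p)"

lemma finite_B: "finite B"
  using finite_A subset finite_subset by blast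

lemma proj_graded_part: "p \<in> graded_part I d \<Longrightarrow> proj B p \<in> graded_part I' d"
  and proj_graded_part': "p \<in> graded_part J d \<Longrightarrow> proj B p \<in> graded_part J' d"
  unfolding graded_part_def using proj_I proj_J proj_homogeneous by blast+

text \<open>Extend a chain by zero to the sets not contained in \<open>B\<close>, bound it over
  \<open>A\<close>, and project the bounding chain back.\<close>

lemma vanishes_subring:
  assumes van: "poly_vanishes A ord I J i j"
  shows "poly_vanishes B ord I' J' i j"
  unfolding koszul_vanishes_def
proof (intro ballI impI)
  fix u assume u: "u \<in> koszul_chains B (graded_part I') i j"
    and bdu: "bd_B u \<in> koszul_chains B (graded_part J') (i - 1) j"
  have zeroI: "0 \<in> graded_part I d" and zeroJ: "0 \<in> graded_part J d" for d
    using graded_zero[OF ideal_I] graded_zero[OF ideal_J] by auto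
  define w where "w T = (if T \<subseteq> B then u T else 0)" for T
  have w: "w \<in> koszul_chains A (graded_part I) i j"
    using u I'_I zeroI unfolding koszul_chains_def w_def graded_part_def by auto
  have bdw: "bd_A w T = (if T \<subseteq> B then bd_B u T else 0)" for T
  proof -
    have "bd_A w T = (\<Sum>a\<in>A - T. if insert a T \<subseteq> B then koszul_sign ord a T (indet a * u (insert a T)) else 0)"
      unfolding koszul_bd_def w_def by (intro sum.cong) (auto simp: koszul_sign_def)
    also have "\<dots> = (if T \<subseteq> B then bd_B u T else 0)"
    proof (cases "T \<subseteq> B")
      case True
      then show ?thesis
        unfolding koszul_bd_def using finite_A subset by (auto intro!: sum.mono_neutral_cong_right split: if_splits)
    qed (auto intro!: sum.neutral)
    finally show ?thesis .
  qed
  have "bd_A w \<in> koszul_chains A (graded_part J) (i - 1) j"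
    using bdu J'_J zeroJ unfolding koszul_chains_def bdw graded_part_def by auto
  then obtain v where v: "v \<in> koszul_chains A (graded_part I) (i + 1) j"
      "w - bd_A v \<in> koszul_chains A (graded_part J) i j"
    using van w unfolding koszul_vanishes_def by blast
  define v' where "v' T = proj B (v T)" for T
  have "v' \<in> koszul_chains B (graded_part I') (i + 1) j"
    using v(1) subset proj_graded_part unfolding koszul_chains_def v'_def by blast
  moreover have "(u - bd_B v') T \<in> graded_part J' (j - i)" if T: "T \<subseteq> B" "int (card T) = i" for T
  proof -
    have TA: "T \<subseteq> A" using T subset by blast
    have "u T \<in> poly_ring B" using u T I'_ring unfolding koszul_chains_def graded_part_def by blast
    then have "proj B ((w - bd_A v) T) = (u - bd_B v') T"
      unfolding fun_diff_def proj_diff proj_koszul_bd[OF finite_A subset TA] w_def using T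
      by (simp add: proj_id koszul_bd_def v'_def)
    moreover have "proj B ((w - bd_A v) T) \<in> graded_part J' (j - i)"
      using v(2) T TA by (intro proj_graded_part') (auto simp: koszul_chains_def)
    ultimately show ?thesis by simp
  qed
  ultimately show "\<exists>v\<in>koszul_chains B (graded_part I') (i + 1) j. u - bd_B v \<in> koszul_chains B (graded_part J') i j"
    unfolding koszul_chains_def by blast
qed

text \<open>
  When the variables outside \<open>B\<close> act as zero, the Koszul complex over \<open>A\<close> splits, for each set \<open>R\<close> of these
  variables, into a copy of the one over \<open>B\<close>, up to the sign \<open>\<sigma> R\<close>.
\<close>

lemma solve_over_subring:
  fixes \<sigma> :: "'x set \<Rightarrow> ('x, 'k) mpoly"
  assumes sign: "\<And>a T R p. a \<in> B \<Longrightarrow> T \<subseteq> B \<Longrightarrow> R \<subseteq> A - B \<Longrightarrow> a \<notin> T \<Longrightarrow>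
      koszul_sign ord a (T \<union> R) p = \<sigma> R * koszul_sign ord a T (p :: ('x, 'k) mpoly)"
    and \<sigma>: "\<And>R. \<sigma> R = 1 \<or> \<sigma> R = - 1"
    and ideal_I': "graded_family B (\<lambda>a p. indet a * p) (graded_part I')"
    and ideal_J': "graded_family B (\<lambda>a p. indet a * p) (graded_part J')"
    and van: "\<And>t :: nat. poly_vanishes B ord I' J' (i - t) (j - t)"
    and u: "u \<in> koszul_chains A (graded_part I) i j"
    and bdu: "bd_A u \<in> koszul_chains A (graded_part J) (i - 1) j"
  obtains v where "v \<in> koszul_chains A (graded_part I') (i + 1) j"
    "\<And>T. T \<subseteq> A \<Longrightarrow> int (card T) = i \<Longrightarrow> proj B (u T) - proj B (bd_A v T) \<in> graded_part J' (j - i)"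
proof -
  have card_union: "int (card (T \<union> R)) = int (card T) + int (card R)" if "T \<subseteq> B" "R \<subseteq> A - B" for T R
    using that finite_A finite_B finite_subset by (subst card_Un_disjoint) (auto intro: finite_subset)
  have sigma_sq: "\<sigma> R * (\<sigma> R * p) = p" for R p using \<sigma>[of R] by auto
  have sigma_mem: "\<sigma> R * p \<in> graded_part M d"
    if "p \<in> graded_part M d" "graded_family B (\<lambda>a p. indet a * p) (graded_part M)" for R p M d
    using \<sigma>[of R] graded_minus[OF that(2) that(1)] that(1) by auto
  have diff: "B - (T \<union> R) = B - T" if "R \<subseteq> A - B" for T R using that by blast
  \<comment> \<open>The slice at \<open>R\<close> is a chain over \<open>B\<close> with homological
    and internal degree both lowered by \<open>card R\<close>; therefore \<open>van\<close> is used
    at the pairs (i - t, j - t).\<close>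
  define uu where "uu R T = proj B (u (T \<union> R))" for R T
  have "\<exists>w. w \<in> koszul_chains B (graded_part I') (i - int (card R) + 1) (j - int (card R)) \<and>
      uu R - bd_B w \<in> koszul_chains B (graded_part J') (i - int (card R)) (j - int (card R))"
    if R: "R \<subseteq> A - B" for R
  proof -
    have "uu R T \<in> graded_part I' (j - int (card R) - (i - int (card R)))"
      if T: "T \<subseteq> B" "int (card T) = i - int (card R)" for T
    proof -
      have "T \<union> R \<subseteq> A" "int (card (T \<union> R)) = i" using T R card_union[OF T(1) R] subset by auto
      then have "u (T \<union> R) \<in> graded_part I (j - i)" using u unfolding koszul_chains_def by blast
      then show ?thesis unfolding uu_def using proj_graded_part by simp
    qed
    then have chain: "uu R \<in> koszul_chains B (graded_part I') (i - int (card R)) (j - int (card R))"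
      unfolding koszul_chains_def by blast
    have "bd_B (uu R) T \<in> graded_part J' (j - int (card R) - (i - int (card R) - 1))"
      if T: "T \<subseteq> B" "int (card T) = i - int (card R) - 1" for T
    proof -
      have TR: "T \<union> R \<subseteq> A" "int (card (T \<union> R)) = i - 1" using T R card_union[OF T(1) R] subset by auto
      have "proj B (bd_A u (T \<union> R)) = (\<Sum>a\<in>B - T. \<sigma> R * koszul_sign ord a T (indet a * uu R (insert a T)))"
        unfolding proj_koszul_bd[OF finite_A subset TR(1)] diff[OF R] uu_def
        using sign T R by (intro sum.cong) auto
      also have "\<dots> = \<sigma> R * bd_B (uu R) T"
        unfolding koszul_bd_def sum_distrib_left ..
      finally have "bd_B (uu R) T = \<sigma> R * proj B (bd_A u (T \<union> R))" by (simp add: sigma_sq)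
      moreover have "bd_A u (T \<union> R) \<in> graded_part J (j - (i - 1))"
        using bdu TR unfolding koszul_chains_def by blast
      then have "\<sigma> R * proj B (bd_A u (T \<union> R)) \<in> graded_part J' (j - (i - 1))"
        by (intro sigma_mem ideal_J' proj_graded_part')
      moreover have "j - int (card R) - (i - int (card R) - 1) = j - (i - 1)" by simp
      ultimately show ?thesis by (simp only:)
    qed
    then have "bd_B (uu R) \<in> koszul_chains B (graded_part J') (i - int (card R) - 1) (j - int (card R))"
      unfolding koszul_chains_def by blast
    with chain van[of "card R"] show ?thesis unfolding koszul_vanishes_def by blast
  qed
  then obtain w where w: "\<And>R. R \<subseteq> A - B \<Longrightarrow>
      w R \<in> koszul_chains B (graded_part I') (i - int (card R) + 1) (j - int (card R)) \<and>
      uu R - bd_B (w R) \<in> koszul_chains B (graded_part J') (i - int (card R)) (j - int (card R))"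
    by metis
  \<comment> \<open>The slices are reassembled, with \<open>\<sigma>\<close> compensating the sign
    caused by \<open>R\<close>. The relevant values lie in \<open>I'\<close>, where
    \<open>proj B\<close> is the identity.\<close>
  define v where "v T = \<sigma> (T - B) * w (T - B) (T \<inter> B)" for T
  have split: "T - B \<subseteq> A - B" "T \<inter> B \<subseteq> B" "(T \<inter> B) \<union> (T - B) = T"
    "int (card T) = int (card (T \<inter> B)) + int (card (T - B))" if "T \<subseteq> A" for T
    using card_union[of "T \<inter> B" "T - B"] that by (auto simp: Int_Diff_Un)
  have "v T \<in> graded_part I' (j - (i + 1))" if T: "T \<subseteq> A" "int (card T) = i + 1" for T
  proof -
    have "int (card (T \<inter> B)) = i - int (card (T - B)) + 1" using split(4)[OF T(1)] T(2) by simp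
    then have "w (T - B) (T \<inter> B) \<in> graded_part I' (j - int (card (T - B)) - (i - int (card (T - B)) + 1))"
      using w[OF split(1)[OF T(1)]] split(2)[OF T(1)] unfolding koszul_chains_def by blast
    then show ?thesis unfolding v_def by (intro sigma_mem ideal_I') (simp add: algebra_simps)
  qed
  then have vI: "v \<in> koszul_chains A (graded_part I') (i + 1) j" unfolding koszul_chains_def by blast
  moreover have "proj B (u T) - proj B (bd_A v T) \<in> graded_part J' (j - i)"
    if T: "T \<subseteq> A" "int (card T) = i" for T
  proof -
    let ?R = "T - B" and ?S = "T \<inter> B"
    have "proj B (bd_A v T) = (\<Sum>a\<in>B - T. koszul_sign ord a T (indet a * proj B (v (insert a T))))"
      by (rule proj_koszul_bd[OF finite_A subset T(1)])
    also have "\<dots> = (\<Sum>a\<in>B - ?S. koszul_sign ord a ?S (indet a * w ?R (insert a ?S)))"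
    proof (rule sum.cong)
      show "B - T = B - ?S" by blast
      fix a assume "a \<in> B - ?S"
      then have a: "a \<in> B" "a \<notin> ?S" "a \<notin> T" by auto
      have parts: "insert a T - B = ?R" "insert a T \<inter> B = insert a ?S" using a by auto
      have aT: "insert a T \<subseteq> A" "int (card (insert a T)) = i + 1"
        using a T subset finite_subset[OF T(1) finite_A] by auto
      then have "v (insert a T) \<in> poly_ring B"
        using vI I'_ring unfolding koszul_chains_def graded_part_def by blast
      then have "proj B (v (insert a T)) = \<sigma> ?R * w ?R (insert a ?S)"
        by (subst proj_id) (simp_all add: v_def parts)
      moreover have "koszul_sign ord a T p = \<sigma> ?R * koszul_sign ord a ?S p" for p :: "('x, 'k) mpoly"
        using sign[OF a(1) split(2)[OF T(1)] split(1)[OF T(1)] a(2)] split(3)[OF T(1)] by simp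
      ultimately have "koszul_sign ord a T (indet a * proj B (v (insert a T)))
          = \<sigma> ?R * koszul_sign ord a ?S (\<sigma> ?R * (indet a * w ?R (insert a ?S)))"
        by (simp add: mult.left_commute)
      also have "\<dots> = \<sigma> ?R * (\<sigma> ?R * koszul_sign ord a ?S (indet a * w ?R (insert a ?S)))"
        by (simp add: koszul_sign_def)
      finally show "koszul_sign ord a T (indet a * proj B (v (insert a T)))
          = koszul_sign ord a ?S (indet a * w ?R (insert a ?S))" unfolding sigma_sq .
    qed
    also have "\<dots> = bd_B (w ?R) ?S" unfolding koszul_bd_def ..
    finally have "proj B (u T) - proj B (bd_A v T) = (uu ?R - bd_B (w ?R)) ?S"
      unfolding uu_def using split(3)[OF T(1)] by simp
    moreover have "int (card ?S) = i - int (card ?R)" using split(4)[OF T(1)] T(2) by simp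
    then have "(uu ?R - bd_B (w ?R)) ?S \<in> graded_part J' (j - int (card ?R) - (i - int (card ?R)))"
      using w[OF split(1)[OF T(1)]] split(2)[OF T(1)] unfolding koszul_chains_def by blast
    ultimately show ?thesis by simp
  qed
  ultimately show ?thesis using that by blast
qed

end

section \<open>Joins\<close>

lemma bei_vars_Un: "bei_vars (V1 \<union> V2) = bei_vars V1 \<union> bei_vars V2"
  unfolding bei_vars_def by blast

lemma join_edges_commute: "join_edges V1 E1 V2 E2 = join_edges V2 E2 V1 E1"
  unfolding join_edges_def by (auto simp: insert_commute)

lemma fin_simple_graph_join:
  assumes "fin_simple_graph V1 E1" "fin_simple_graph V2 E2" "V1 \<inter> V2 = {}"
  shows "fin_simple_graph (V1 \<union> V2) (join_edges V1 E1 V2 E2)"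
  using assms unfolding fin_simple_graph_def join_edges_def by (fastforce simp: card_2_iff)

lemma edges_subset_join:
  assumes "fin_simple_graph V1 E1" "fin_simple_graph V2 E2" "V1 \<inter> V2 = {}"
    and "e \<in> join_edges V1 E1 V2 E2" "e \<subseteq> V1"
  shows "e \<in> E1"
proof -
  have "e \<notin> E2"
  proof
    assume "e \<in> E2"
    then have "e \<subseteq> V2" "card e = 2" using assms(2) unfolding fin_simple_graph_def by auto
    then show False using assms(3,5) by (metis card.empty inf.absorb_iff2 inf_mono subset_empty zero_neq_numeral le_inf_iff)
  qed
  moreover have "e \<noteq> {v, w}" if "w \<in> V2" for v w using that assms(3,5) by blast
  ultimately show ?thesis using assms(4) unfolding join_edges_def by blast
qed

text \<open>The relations \<open>x\<^sub>w f\<^bsub>uv\<^esub> = x\<^sub>u f\<^bsub>wv\<^esub> - x\<^sub>v f\<^bsub>wu\<^esub>\<close> and their analogues for \<open>y\<^sub>w\<close>.\<close>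

lemma indet_mult_edge_binomial:
  fixes V1 V2 :: "'v set"
  assumes uv: "u \<in> V1" "v \<in> V1" and b: "b \<in> bei_vars V2"
  shows "indet b * edge_binomial u v
    \<in> (binomial_edge_ideal (V1 \<union> V2) (join_edges V1 E1 V2 E2) :: ('v bvar, 'k::comm_ring_1) mpoly set)"
proof -
  let ?J = "binomial_edge_ideal (V1 \<union> V2) (join_edges V1 E1 V2 E2) :: ('v bvar, 'k) mpoly set"
  obtain w where w: "w \<in> V2" "b = XVar w \<or> b = YVar w" using b unfolding bei_vars_def by blast
  have cross: "{w, u} \<in> join_edges V1 E1 V2 E2" if "u \<in> V1" for u
    using that w(1) unfolding join_edges_def by (auto simp: insert_commute)
  have J: "indet a * edge_binomial w v - indet c * edge_binomial w u \<in> ?J"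
    if "a \<in> bei_vars (V1 \<union> V2)" "c \<in> bei_vars (V1 \<union> V2)" for a c
    using that uv by (intro binomial_edge_ideal_diff binomial_edge_ideal_gen cross poly_ring_indet)
  have "indet (XVar w) * (edge_binomial u v :: ('v bvar, 'k) mpoly)
      = indet (XVar u) * edge_binomial w v - indet (XVar v) * edge_binomial w u"
    "indet (YVar w) * (edge_binomial u v :: ('v bvar, 'k) mpoly)
      = indet (YVar u) * edge_binomial w v - indet (YVar v) * edge_binomial w u"
    unfolding edge_binomial_def by (simp_all add: algebra_simps)
  then show ?thesis using w(2) J uv by auto
qed

text \<open>A monomial of \<open>c\<close> that is not in the variables of \<open>V1\<close>
  contains a variable of \<open>V2\<close>, and that variable already multiplies f_uv into the ideal
  of the join.\<close>

lemma mult_edge_binomial_minus_proj: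
  fixes c :: "('v bvar, 'k::comm_ring_1) mpoly"
  assumes uv: "u \<in> V1" "v \<in> V1" and c: "c \<in> poly_ring (bei_vars (V1 \<union> V2))"
  shows "c * edge_binomial u v - proj (bei_vars V1) (c * edge_binomial u v)
    \<in> binomial_edge_ideal (V1 \<union> V2) (join_edges V1 E1 V2 E2)" (is "_ \<in> ?J")
proof -
  have monom: "(monom m \<alpha> - proj (bei_vars V1) (monom m \<alpha>)) * edge_binomial u v \<in> ?J"
    if m: "supp m \<subseteq> bei_vars (V1 \<union> V2)" for m and \<alpha> :: 'k
  proof (cases "supp m \<subseteq> bei_vars V1")
    case True
    then show ?thesis by (simp add: proj_monom binomial_edge_ideal_zero)
  next
    case False
    then obtain b where b: "b \<in> supp m" "b \<in> bei_vars V2" using m unfolding bei_vars_Un by blast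
    have "(monom m \<alpha> - proj (bei_vars V1) (monom m \<alpha>)) * edge_binomial u v
        = monom (m - expo b) \<alpha> * (indet b * edge_binomial u v)"
      using False expo_minus_add[OF b(1)]
      by (simp add: proj_monom indet_eq_monom mult_single mult.assoc[symmetric])
    moreover have "monom (m - expo b) \<alpha> * (indet b * edge_binomial u v) \<in> ?J"
      using m supp_minus_nat[of m "expo b"]
      by (intro binomial_edge_ideal_mult indet_mult_edge_binomial uv b monom_in_poly_ring) blast
    ultimately show ?thesis by (simp only:)
  qed
  have "c * edge_binomial u v - proj (bei_vars V1) (c * edge_binomial u v)
      = (c - proj (bei_vars V1) c) * edge_binomial u v"
    using uv by (simp add: proj_mult proj_edge_binomial left_diff_distrib)
  also have "\<dots> = (\<Sum>m\<in>supp c. (monom m (coef c m) - proj (bei_vars V1) (monom m (coef c m))) * edge_binomial u v)"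
    unfolding sum_distrib_right[symmetric] sum_subtractf proj_sum[symmetric]
    using poly_sum_monom[of "supp c" c] by simp
  also have "\<dots> \<in> ?J"
    unfolding binomial_edge_ideal_def
    using monom c unfolding poly_ring_def binomial_edge_ideal_def by (intro ideal_gen_sum) blast
  finally show ?thesis .
qed

text \<open>The decomposition of J_V / J_G, checked on generators: a pair inside one side differs
  from its projection by an element of J_G and projects to zero on the other side; a pair across is
  an edge of the join with both projections zero.\<close>

lemma complete_minus_projections:
  fixes p :: "('v bvar, 'k::comm_ring_1) mpoly"
  assumes V: "V1 \<inter> V2 = {}" and p: "p \<in> binomial_edge_ideal (V1 \<union> V2) (complete_edges (V1 \<union> V2))"
  shows "p - proj (bei_vars V1) p - proj (bei_vars V2) p
    \<in> binomial_edge_ideal (V1 \<union> V2) (join_edges V1 E1 V2 E2)" (is "_ \<in> ?J")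
proof -
  have "p \<in> {p. p - proj (bei_vars V1) p - proj (bei_vars V2) p \<in> ?J}"
    using p
  proof (rule binomial_edge_ideal_closed)
    fix p q :: "('v bvar, 'k) mpoly" assume "p \<in> {p. p - proj (bei_vars V1) p - proj (bei_vars V2) p \<in> ?J}"
      "q \<in> {p. p - proj (bei_vars V1) p - proj (bei_vars V2) p \<in> ?J}"
    then have "(p - proj (bei_vars V1) p - proj (bei_vars V2) p)
        + (q - proj (bei_vars V1) q - proj (bei_vars V2) q) \<in> ?J"
      by (auto intro: binomial_edge_ideal_add)
    then show "p + q \<in> {p. p - proj (bei_vars V1) p - proj (bei_vars V2) p \<in> ?J}"
      by (simp add: proj_add algebra_simps)
  next
    fix c :: "('v bvar, 'k) mpoly" and i j
    assume c: "c \<in> poly_ring (bei_vars (V1 \<union> V2))" and "{i, j} \<in> complete_edges (V1 \<union> V2)"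
    then have "i \<in> V1 \<union> V2" "j \<in> V1 \<union> V2" unfolding complete_edges_def by (auto simp: doubleton_eq_iff)
    then consider "i \<in> V1" "j \<in> V1" | "i \<in> V2" "j \<in> V2" | "{i, j} \<in> join_edges V1 E1 V2 E2" "i \<in> V1 \<longleftrightarrow> j \<in> V2" "j \<in> V1 \<longleftrightarrow> i \<in> V2"
      using V unfolding join_edges_def by blast
    then have "c * edge_binomial i j - proj (bei_vars V1) (c * edge_binomial i j)
        - proj (bei_vars V2) (c * edge_binomial i j) \<in> ?J"
    proof cases
      case 1
      then have "proj (bei_vars V2) (c * edge_binomial i j) = 0"
        using V by (auto simp: proj_mult proj_edge_binomial)
      then show ?thesis using mult_edge_binomial_minus_proj[OF 1 c] by simp
    next
      case 2
      then have "proj (bei_vars V1) (c * edge_binomial i j) = 0"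
        using V by (auto simp: proj_mult proj_edge_binomial)
      then show ?thesis
        using mult_edge_binomial_minus_proj[OF 2, of c V1 E2 E1] c
        by (simp add: Un_commute join_edges_commute[of V2 E2])
    next
      case 3
      then have "proj (bei_vars V1) (c * edge_binomial i j) = 0" "proj (bei_vars V2) (c * edge_binomial i j) = 0"
        using V by (auto simp: proj_mult proj_edge_binomial)
      then show ?thesis using binomial_edge_ideal_gen[OF 3(1) c] by simp
    qed
    then show "c * edge_binomial i j \<in> {p. p - proj (bei_vars V1) p - proj (bei_vars V2) p \<in> ?J}" by simp
  qed (simp add: binomial_edge_ideal_zero)
  then show ?thesis by blast
qed

lemma coef_zero_binomial_edge_ideal: "p \<in> binomial_edge_ideal V E \<Longrightarrow> coef p 0 = 0"
proof -
  assume "p \<in> binomial_edge_ideal V E"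
  then have "p \<in> {p. coef p 0 = 0}"
  proof (rule binomial_edge_ideal_closed)
    show "c * edge_binomial i j \<in> {p. coef p 0 = 0}" for c i j
      using homogeneous_coef_zero[OF edge_binomial_homogeneous[of i j]] coef_mult_zero by auto
  qed (auto simp: lookup_add)
  then show ?thesis by simp
qed

text \<open>Elements of the ideal have no constant term, so each of their monomials contains a
  variable of \<open>V2\<close>.\<close>

lemma proj_disjoint_binomial_edge_ideal:
  assumes "V1 \<inter> V2 = {}" and "p \<in> binomial_edge_ideal V2 E" "p \<in> poly_ring (bei_vars V2)"
  shows "proj (bei_vars V1) p = 0"
  unfolding proj_def
proof (rule restrict_supp_none)
  fix m assume m: "m \<in> supp p"
  then have "m \<noteq> 0" using coef_zero_binomial_edge_ideal[OF assms(2)] by (auto simp: in_keys_iff)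
  then obtain b where "b \<in> supp m" by (metis in_keys_iff lookup_zero poly_mapping_eqI)
  then show "\<not> supp m \<subseteq> bei_vars V1"
    using m assms(1,3) unfolding poly_ring_def bei_vars_def by blast
qed

lemma complete_edges_mono: "W \<subseteq> V \<Longrightarrow> complete_edges W \<subseteq> complete_edges V"
  unfolding complete_edges_def by blast

lemma binomial_edge_ideal_complete_subset:
  "binomial_edge_ideal V (complete_edges V) \<subseteq> poly_ring (bei_vars V)"
proof
  fix p assume "p \<in> binomial_edge_ideal V (complete_edges V)"
  then show "p \<in> poly_ring (bei_vars V)"
    by (rule binomial_edge_ideal_closed)
      (auto simp: complete_edges_def doubleton_eq_iff poly_ring_zero poly_ring_add
        intro!: poly_ring_mult edge_binomial_in_poly_ring)
qed

lemma koszul_subring_join: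
  fixes V1 V2 :: "'v set" and ord :: "'v bvar \<Rightarrow> nat"
  assumes G1: "fin_simple_graph V1 E1" and G2: "fin_simple_graph V2 E2" and V: "V1 \<inter> V2 = {}"
    and ord: "inj_on ord (bei_vars (V1 \<union> V2))"
  shows "koszul_subring (bei_vars (V1 \<union> V2)) (bei_vars V1) ord
    (binomial_edge_ideal (V1 \<union> V2) (complete_edges (V1 \<union> V2)) :: ('v bvar, 'k::field) mpoly set)
    (binomial_edge_ideal (V1 \<union> V2) (join_edges V1 E1 V2 E2))
    (binomial_edge_ideal V1 (complete_edges V1)) (binomial_edge_ideal V1 E1)"
proof
  show "finite (bei_vars (V1 \<union> V2))"
    using G1 G2 unfolding fin_simple_graph_def by (intro finite_bei_vars) simp
  show "inj_on ord (bei_vars (V1 \<union> V2))" by (rule ord)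
  show "bei_vars V1 \<subseteq> bei_vars (V1 \<union> V2)" unfolding bei_vars_def by blast
  show "binomial_edge_ideal V1 (complete_edges V1)
      \<subseteq> (binomial_edge_ideal (V1 \<union> V2) (complete_edges (V1 \<union> V2)) :: ('v bvar, 'k) mpoly set)"
    by (intro binomial_edge_ideal_mono complete_edges_mono) auto
  show "binomial_edge_ideal V1 E1
      \<subseteq> (binomial_edge_ideal (V1 \<union> V2) (join_edges V1 E1 V2 E2) :: ('v bvar, 'k) mpoly set)"
    by (intro binomial_edge_ideal_mono) (auto simp: join_edges_def)
  show "proj (bei_vars V1) p \<in> binomial_edge_ideal V1 (complete_edges V1)"
    if "p \<in> binomial_edge_ideal (V1 \<union> V2) (complete_edges (V1 \<union> V2))" for p :: "('v bvar, 'k) mpoly"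
    using that by (rule proj_binomial_edge_ideal) (auto simp: complete_edges_def)
  show "proj (bei_vars V1) p \<in> binomial_edge_ideal V1 E1"
    if "p \<in> binomial_edge_ideal (V1 \<union> V2) (join_edges V1 E1 V2 E2)" for p :: "('v bvar, 'k) mpoly"
    using that by (rule proj_binomial_edge_ideal) (rule edges_subset_join[OF G1 G2 V])
qed (auto intro: graded_family_binomial_edge_ideal binomial_edge_ideal_complete_subset[THEN subsetD])

text \<open>With one block of variables before the other, the sign of \<open>a\<close> in
  \<open>T \<union> R\<close> ignores \<open>R\<close> when \<open>a\<close> is in the first block
  and is multiplied by (-1)^|R| when it is in the second. This is the sign rule under which the
  Koszul complex splits.\<close>

lemma block_order_exists:
  assumes "finite A" "finite B" "A \<inter> B = {}"
  obtains ord :: "'x \<Rightarrow> nat" where "inj_on ord (A \<union> B)" "\<And>a b. a \<in> A \<Longrightarrow> b \<in> B \<Longrightarrow> ord a < ord b"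
proof -
  obtain f g where f: "bij_betw f A {0..<card A}" and g: "bij_betw g B {0..<card B}"
    using ex_bij_betw_finite_nat assms by metis
  define ord where "ord x = (if x \<in> A then f x else card A + g x)" for x
  have less: "ord a < ord b" if "a \<in> A" "b \<in> B" for a b
  proof -
    have "b \<notin> A" using that assms(3) by blast
    moreover have "f a < card A" using f that(1) unfolding bij_betw_def by force
    ultimately show ?thesis using that unfolding ord_def by simp
  qed
  have "inj_on ord A" using f unfolding bij_betw_def inj_on_def ord_def by auto
  moreover have "inj_on ord B"
    using g assms(3) unfolding bij_betw_def inj_on_def ord_def by auto
  ultimately have "inj_on ord (A \<union> B)"
    using less unfolding inj_on_Un by (fastforce simp: disjoint_iff)
  then show ?thesis using that less by blast
qed

text \<open>Forward by retraction to each side; backward by bounding the two projections of a cycle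
  separately and adding the bounding chains.\<close>

lemma vanishes_join_quotient_iff:
  fixes V1 V2 :: "'v set" and ord :: "'v bvar \<Rightarrow> nat" and K :: "'k::field itself" and r :: int
  assumes G1: "fin_simple_graph V1 E1" and G2: "fin_simple_graph V2 E2" and V: "V1 \<inter> V2 = {}"
    and ord: "inj_on ord (bei_vars (V1 \<union> V2))"
    and block: "\<And>a b. a \<in> bei_vars V1 \<Longrightarrow> b \<in> bei_vars V2 \<Longrightarrow> ord a < ord b"
  defines "Q \<equiv> \<lambda>V E i j. poly_vanishes (bei_vars V) ord
    (binomial_edge_ideal V (complete_edges V) :: ('v bvar, 'k) mpoly set) (binomial_edge_ideal V E) i j"
  shows "(\<forall>i j. j > r + i \<longrightarrow> Q (V1 \<union> V2) (join_edges V1 E1 V2 E2) i j) \<longleftrightarrow>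
    (\<forall>i j. j > r + i \<longrightarrow> Q V1 E1 i j) \<and> (\<forall>i j. j > r + i \<longrightarrow> Q V2 E2 i j)"
proof -
  let ?A = "bei_vars (V1 \<union> V2)" and ?A1 = "bei_vars V1" and ?A2 = "bei_vars V2"
  let ?I = "binomial_edge_ideal (V1 \<union> V2) (complete_edges (V1 \<union> V2)) :: ('v bvar, 'k) mpoly set"
  let ?J = "binomial_edge_ideal (V1 \<union> V2) (join_edges V1 E1 V2 E2) :: ('v bvar, 'k) mpoly set"
  let ?I1 = "binomial_edge_ideal V1 (complete_edges V1) :: ('v bvar, 'k) mpoly set"
  let ?I2 = "binomial_edge_ideal V2 (complete_edges V2) :: ('v bvar, 'k) mpoly set"
  let ?J1 = "binomial_edge_ideal V1 E1 :: ('v bvar, 'k) mpoly set"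
  let ?J2 = "binomial_edge_ideal V2 E2 :: ('v bvar, 'k) mpoly set"
  interpret s1: koszul_subring ?A ?A1 ord ?I ?J ?I1 ?J1
    by (rule koszul_subring_join[OF G1 G2 V ord])
  have V': "V2 \<inter> V1 = {}" using V by blast
  interpret s2: koszul_subring ?A ?A2 ord ?I ?J ?I2 ?J2
    using koszul_subring_join[OF G2 G1 V', where 'k = 'k, of ord] ord
    by (simp add: Un_commute join_edges_commute[of V2 E2])
  interpret poly_koszul ?A ord K
    using s1.finite_A ord by unfold_locales
  have complement: "?A - ?A1 = ?A2" "?A - ?A2 = ?A1" using V unfolding bei_vars_def by auto
  show ?thesis
  proof
    assume "\<forall>i j. j > r + i \<longrightarrow> Q (V1 \<union> V2) (join_edges V1 E1 V2 E2) i j"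
    then show "(\<forall>i j. j > r + i \<longrightarrow> Q V1 E1 i j) \<and> (\<forall>i j. j > r + i \<longrightarrow> Q V2 E2 i j)"
      unfolding Q_def using s1.vanishes_subring s2.vanishes_subring by blast
  next
    assume parts: "(\<forall>i j. j > r + i \<longrightarrow> Q V1 E1 i j) \<and> (\<forall>i j. j > r + i \<longrightarrow> Q V2 E2 i j)"
    have "vanishes (graded_part ?I) (graded_part ?J) i j" if ij: "j > r + i" for i j
    proof (rule vanishesI)
      fix u assume u: "u \<in> kchains (graded_part ?I) i j" and bdu: "bd u \<in> kchains (graded_part ?J) (i - 1) j"
      obtain v1 where v1: "v1 \<in> kchains (graded_part ?I1) (i + 1) j"
        "\<And>T. T \<subseteq> ?A \<Longrightarrow> int (card T) = i \<Longrightarrow> proj ?A1 (u T) - proj ?A1 (bd v1 T) \<in> graded_part ?J1 (j - i)"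
      proof (rule s1.solve_over_subring[of "\<lambda>_. 1" i j u])
        show "koszul_sign ord a (T \<union> R) p = 1 * koszul_sign ord a T p"
          if a: "a \<in> ?A1" and "T \<subseteq> ?A1" and R: "R \<subseteq> ?A - ?A1" for a T R and p :: "('v bvar, 'k) mpoly"
        proof -
          have "\<not> ord b < ord a" if "b \<in> R" for b
            using block[OF a, of b] R that unfolding complement by auto
          then have "{b \<in> T \<union> R. ord b < ord a} = {b \<in> T. ord b < ord a}" by blast
          then show ?thesis unfolding koszul_sign_def by simp
        qed
        \<comment> \<open>Lowering both degrees by \<open>t\<close> preserves
          \<open>j > r + i\<close>.\<close>
        show "poly_vanishes ?A1 ord ?I1 ?J1 (i - int t) (j - int t)" for t
          using parts ij unfolding Q_def by simp
      qed (use u bdu in \<open>auto intro: graded_family_binomial_edge_ideal\<close>)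
      obtain v2 where v2: "v2 \<in> kchains (graded_part ?I2) (i + 1) j"
        "\<And>T. T \<subseteq> ?A \<Longrightarrow> int (card T) = i \<Longrightarrow> proj ?A2 (u T) - proj ?A2 (bd v2 T) \<in> graded_part ?J2 (j - i)"
      proof (rule s2.solve_over_subring[of "\<lambda>R. if even (card R) then 1 else - 1" i j u])
        show "koszul_sign ord a (T \<union> R) p = (if even (card R) then 1 else - 1) * koszul_sign ord a T p"
          if a: "a \<in> ?A2" and T: "T \<subseteq> ?A2" and R: "R \<subseteq> ?A - ?A2" for a T R and p :: "('v bvar, 'k) mpoly"
        proof -
          have "ord b < ord a" if "b \<in> R" for b
            using block[OF _ a, of b] R that unfolding complement by auto
          then have "{b \<in> T \<union> R. ord b < ord a} = {b \<in> T. ord b < ord a} \<union> R" by blast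
          moreover have "{b \<in> T. ord b < ord a} \<inter> R = {}" using T R by blast
          moreover have "finite T" "finite R"
            using T R s1.finite_A s2.finite_B finite_subset by blast+
          ultimately have "card {b \<in> T \<union> R. ord b < ord a} = card {b \<in> T. ord b < ord a} + card R"
            by (simp add: card_Un_disjoint)
          then show ?thesis unfolding koszul_sign_def by simp
        qed
        show "poly_vanishes ?A2 ord ?I2 ?J2 (i - int t) (j - int t)" for t
          using parts ij unfolding Q_def by simp
      qed (use u bdu in \<open>auto intro: graded_family_binomial_edge_ideal\<close>)
      have v1I: "v1 \<in> kchains (graded_part ?I) (i + 1) j" and v2I: "v2 \<in> kchains (graded_part ?I) (i + 1) j"
        using v1(1) v2(1) s1.I'_I s2.I'_I unfolding koszul_chains_def graded_part_def by blast+
      have v: "v1 + v2 \<in> kchains (graded_part ?I) (i + 1) j"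
        by (rule graded_chains_add[OF s1.ideal_I v1I v2I])
      \<comment> \<open>The cross terms: each chain has its coefficients in the ideal of its own
        side, and these vanish when the variables of that side are set to zero.\<close>
      have kill: "proj ?A1 (bd v2 T) = 0" "proj ?A2 (bd v1 T) = 0"
        if T: "T \<subseteq> ?A" "int (card T) = i" for T
      proof -
        have card: "insert a T \<subseteq> ?A" "int (card (insert a T)) = i + 1" if "a \<in> ?A - T" for a
          using that T finite_subset[OF T(1) s1.finite_A] by auto
        have "proj ?A1 (v2 (insert a T)) = 0" if "a \<in> ?A1 - T" for a
        proof -
          have "v2 (insert a T) \<in> ?I2"
            using v2(1) card[of a] that s1.subset unfolding koszul_chains_def graded_part_def by blast
          then show ?thesis using proj_disjoint_binomial_edge_ideal[OF V] s2.I'_ring by blast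
        qed
        then show "proj ?A1 (bd v2 T) = 0"
          unfolding proj_koszul_bd[OF s1.finite_A s1.subset T(1)]
          by (intro sum.neutral) (auto simp: koszul_sign_def)
        have "proj ?A2 (v1 (insert a T)) = 0" if "a \<in> ?A2 - T" for a
        proof -
          have "v1 (insert a T) \<in> ?I1"
            using v1(1) card[of a] that s2.subset unfolding koszul_chains_def graded_part_def by blast
          then show ?thesis using proj_disjoint_binomial_edge_ideal[OF V'] s1.I'_ring by blast
        qed
        then show "proj ?A2 (bd v1 T) = 0"
          unfolding proj_koszul_bd[OF s1.finite_A s2.subset T(1)]
          by (intro sum.neutral) (auto simp: koszul_sign_def)
      qed
      have "(u - bd (v1 + v2)) T \<in> graded_part ?J (j - i)" if T: "T \<subseteq> ?A" "int (card T) = i" for T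
      proof -
        let ?p = "(u - bd (v1 + v2)) T"
        have p: "?p \<in> graded_part ?I (j - i)"
          using graded_chains_diff[OF s1.ideal_I u graded_chains_bd[OF s1.ideal_I s1.finite_A v]] T
          unfolding koszul_chains_def by blast
        have "proj ?A1 ?p \<in> ?J1" "proj ?A2 ?p \<in> ?J2"
          using v1(2)[OF T] v2(2)[OF T] kill[OF T]
          by (simp_all add: bd_add proj_diff proj_add graded_part_def)
        then have "proj ?A1 ?p + proj ?A2 ?p \<in> ?J"
          using s1.J'_J s2.J'_J by (intro binomial_edge_ideal_add) blast+
        moreover have "?p - proj ?A1 ?p - proj ?A2 ?p \<in> ?J"
          using p complete_minus_projections[OF V, of ?p E1 E2] unfolding graded_part_def by blast
        ultimately have "(?p - proj ?A1 ?p - proj ?A2 ?p) + (proj ?A1 ?p + proj ?A2 ?p) \<in> ?J"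
          by (rule binomial_edge_ideal_add[rotated])
        then have "?p \<in> ?J" by simp
        then show ?thesis using p unfolding graded_part_def by blast
      qed
      then have "u - bd (v1 + v2) \<in> kchains (graded_part ?J) i j" unfolding koszul_chains_def by blast
      then show "\<exists>v\<in>kchains (graded_part ?I) (i + 1) j. u - bd v \<in> kchains (graded_part ?J) i j"
        using v by blast
    qed
    then show "\<forall>i j. j > r + i \<longrightarrow> Q (V1 \<union> V2) (join_edges V1 E1 V2 E2) i j"
      unfolding Q_def by blast
  qed
qed


section \<open>A quadratic syzygy from an induced path on three vertices\<close>

text \<open>Edge binomials have degree 2, so in this degree only the constant terms of the
  multipliers count and \<open>p\<close> becomes a linear combination of edge binomials.\<close>

lemma coef_binomial_edge_ideal_quadric:
  fixes p :: "('v bvar, 'k::comm_ring_1) mpoly"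
  assumes "p \<in> binomial_edge_ideal V E" "mon_degree M = 2"
    and "\<And>i j. {i, j} \<in> E \<Longrightarrow> coef (edge_binomial i j) M = (0 :: 'k)"
  shows "coef p M = 0"
proof -
  have "p \<in> {p. coef p M = 0}"
    using assms(1)
  proof (rule binomial_edge_ideal_closed)
    fix c :: "('v bvar, 'k) mpoly" and i j assume e: "{i, j} \<in> E"
    have "coef (c * edge_binomial i j) M = coef (hcomp 2 (c * edge_binomial i j)) M"
      using assms(2) by (simp add: hcomp_def coef_restrict_supp)
    also have "\<dots> = coef (hcomp 0 c * edge_binomial i j) M"
      using hcomp_mult[OF edge_binomial_homogeneous, of 2 c i j] by simp
    also have "hcomp 0 c = monom 0 (coef c 0)"
      by (rule poly_mapping_eqI) (simp add: hcomp_def coef_restrict_supp lookup_single when_def mon_degree_eq_zero)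
    also have "coef (monom 0 (coef c 0) * edge_binomial i j) M = 0"
      using coef_monom_mult[of 0 "coef c 0" "edge_binomial i j" M] assms(3)[OF e] by simp
    finally show "c * edge_binomial i j \<in> {p. coef p M = 0}" by simp
  qed (auto simp: lookup_add)
  then show ?thesis by simp
qed

lemma coef_nonedge:
  assumes "p \<in> binomial_edge_ideal V E" "{k, l} \<notin> E"
  shows "coef p (expo (XVar k) + expo (YVar l)) = 0"
proof (rule coef_binomial_edge_ideal_quadric[OF assms(1)])
  fix i j assume "{i, j} \<in> E"
  moreover have "{l, k} \<notin> E" using assms(2) by (simp add: insert_commute)
  ultimately have ne: "\<not> (i = k \<and> j = l)" "\<not> (j = k \<and> i = l)" using assms(2) by blast+
  show "coef (edge_binomial i j) (expo (XVar k) + expo (YVar l)) = 0"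
    unfolding coef_edge_binomial if_not_P[OF ne(1)] if_not_P[OF ne(2)] by (rule diff_self)
qed (simp add: mon_degree_add)

lemma coef_same_type:
  assumes "p \<in> binomial_edge_ideal V E"
  shows "coef p (expo (XVar k) + expo (XVar l)) = 0" and "coef p (expo (YVar k) + expo (YVar l)) = 0"
proof -
  have "supp (expo (XVar i) + expo (YVar j)) \<noteq> supp (expo (XVar k) + expo (XVar l))"
    "supp (expo (XVar i) + expo (YVar j)) \<noteq> supp (expo (YVar k) + expo (YVar l))" for i j
    unfolding supp_add_nat by auto
  then have ne: "expo (XVar i) + expo (YVar j) \<noteq> expo (XVar k) + expo (XVar l)"
    "expo (XVar i) + expo (YVar j) \<noteq> expo (YVar k) + expo (YVar l)" for i j
    by metis+
  show "coef p (expo (XVar k) + expo (XVar l)) = 0"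
    by (rule coef_binomial_edge_ideal_quadric[OF assms])
      (simp_all add: mon_degree_add edge_binomial_monom lookup_minus lookup_single_not_eq[OF ne(1)])
  show "coef p (expo (YVar k) + expo (YVar l)) = 0"
    by (rule coef_binomial_edge_ideal_quadric[OF assms])
      (simp_all add: mon_degree_add edge_binomial_monom lookup_minus lookup_single_not_eq[OF ne(2)])
qed

text \<open>Every monomial of x_b p is divisible by x_b, so a summand with \<open>b\<close> outside
  the support of \<open>M\<close> contributes nothing.\<close>

lemma coef_koszul_bd_singleton:
  fixes v :: "'x set \<Rightarrow> ('x, 'k::comm_ring_1) mpoly"
  assumes A: "finite A" and C: "C \<subseteq> A - {a}" "supp M \<subseteq> insert a C"
    and a: "a \<notin> supp M"
  shows "coef (koszul_bd A ord (\<lambda>a p. indet a * p) v {a}) M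
    = (\<Sum>b\<in>C. coef (koszul_sign ord b {a} (indet b * v {a, b})) M)"
  unfolding koszul_bd_def lookup_sum
proof (rule sum.mono_neutral_cong_right)
  show "\<forall>b\<in>A - {a} - C. coef (koszul_sign ord b {a} (indet b * v (insert b {a}))) M = 0"
  proof
    fix b assume "b \<in> A - {a} - C"
    then have "b \<notin> supp M" using C(2) by blast
    then show "coef (koszul_sign ord b {a} (indet b * v (insert b {a}))) M = 0"
      by (simp add: koszul_sign_def coef_indet_mult_outside)
  qed
qed (use A C in \<open>auto simp: insert_commute\<close>)

text \<open>
  The cycle \<open>z\<close> corresponds to the Koszul syzygy between \<open>f = f\<^bsub>uw\<^esub>\<close> and \<open>g = f\<^bsub>wv\<^esub>\<close>. If \<open>z\<close> were the boundary of \<open>c\<close>,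
  then the coefficient of \<open>x\<^sub>u y\<^sub>w\<close> in \<open>c {x\<^sub>w, y\<^sub>v}\<close> would vanish, by looking at \<open>x\<^sub>u y\<^sub>v y\<^sub>w\<close> in \<open>z {x\<^sub>w}\<close>, and
  would be \<open>\<plusminus>1\<close>, by looking at \<open>x\<^sub>u y\<^sub>w x\<^sub>w\<close> in \<open>z {y\<^sub>v}\<close>.
\<close>

lemma not_vanishes_induced_path:
  fixes ord :: "'v bvar \<Rightarrow> nat"
  assumes G: "fin_simple_graph V E" and ord: "inj_on ord (bei_vars V)"
    and edges: "{u, w} \<in> E" "{w, v} \<in> E" and nonedge: "{u, v} \<notin> E" "u \<noteq> v"
  shows "\<not> poly_vanishes (bei_vars V) ord (binomial_edge_ideal V E :: ('v bvar, 'k::field) mpoly set) {0} 1 4"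
proof
  let ?J = "binomial_edge_ideal V E :: ('v bvar, 'k) mpoly set"
  let ?A = "bei_vars V"
  have V: "u \<in> V" "v \<in> V" "w \<in> V" "u \<noteq> w" "v \<noteq> w"
    using simple_graph_edges(2)[OF G] edges by blast+
  have finA: "finite ?A" using G unfolding fin_simple_graph_def by (blast intro: finite_bei_vars)
  interpret poly_koszul ?A ord "TYPE('k)" by unfold_locales (fact finA, fact ord)
  assume van: "vanishes (graded_part ?J) Null 1 4"
  define f g :: "('v bvar, 'k) mpoly" where "f = edge_binomial u w" and "g = edge_binomial w v"
  \<comment> \<open>Expand the left factors of g f - f g = 0 along their y-variables, which become
    the Koszul indices: g = x_w y_v - x_v y_w and f = x_u y_w - x_w y_u.\<close>
  define z where "z T = (if T = {YVar v} then indet (XVar w) * f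
      else if T = {YVar w} then - (indet (XVar v) * f) - indet (XVar u) * g
      else if T = {YVar u} then indet (XVar w) * g else 0)" for T
  have fJ: "c * f \<in> ?J" and gJ: "c * g \<in> ?J" if "c \<in> poly_ring ?A" for c
    unfolding f_def g_def
    using binomial_edge_ideal_gen[OF edges(1) that] binomial_edge_ideal_gen[OF edges(2) that] .
  have deg: "indet a * f \<in> homogeneous 3" "indet a * g \<in> homogeneous 3" for a
    using homogeneous_indet_mult[OF edge_binomial_homogeneous] unfolding f_def g_def by fastforce+
  have J: "graded (graded_part ?J)" by (rule graded_family_binomial_edge_ideal) simp
  have mem: "indet a * f \<in> graded_part ?J 3" "indet a * g \<in> graded_part ?J 3" if "a \<in> ?A" for a
    using fJ gJ deg poly_ring_indet[OF that] unfolding graded_part_def by blast+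
  have "z T \<in> graded_part ?J 3" for T
    unfolding z_def using mem V graded_zero[OF J] graded_diff[OF J] graded_minus[OF J] by auto
  then have z: "z \<in> kchains (graded_part ?J) 1 4" unfolding koszul_chains_def by simp
  have "bd z {} = (\<Sum>a\<in>?A. indet a * z {a})"
    unfolding koszul_bd_def koszul_sign_def by simp
  also have "\<dots> = (\<Sum>a\<in>{YVar v, YVar w, YVar u}. indet a * z {a})"
    using finA V by (intro sum.mono_neutral_right) (auto simp: z_def)
  also have "\<dots> = indet (YVar v) * z {YVar v} + (indet (YVar w) * z {YVar w} + indet (YVar u) * z {YVar u})"
    using V nonedge by simp
  also have "\<dots> = 0"
    unfolding z_def f_def g_def edge_binomial_def using V nonedge by (simp add: algebra_simps)
  finally have "bd z \<in> kchains Null (1 - 1) 4"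
    using finite_subset[OF _ finA] unfolding koszul_chains_def graded_part_def
    by (auto simp: homogeneous_zero)
  with van z obtain c where c: "c \<in> kchains (graded_part ?J) (1 + 1) 4" "z - bd c \<in> kchains Null 1 4"
    by (rule vanishesE)
  have zc: "z {a} = bd c {a}" if "a \<in> ?A" for a
  proof -
    have "(z - bd c) {a} \<in> Null (4 - 1)" using c(2) that unfolding koszul_chains_def by auto
    then show ?thesis unfolding graded_part_def by simp
  qed
  have cJ: "c {a, b} \<in> ?J" if "a \<in> ?A" "b \<in> ?A" "a \<noteq> b" for a b
    using c(1) that unfolding koszul_chains_def graded_part_def by auto
  have sign: "coef (koszul_sign ord b T p) M = 0" if "coef p M = 0" for b T p M
    using that unfolding koszul_sign_def by simp
  let ?xu = "expo (XVar u)" and ?xw = "expo (XVar w)"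
    and ?yu = "expo (YVar u)" and ?yv = "expo (YVar v)" and ?yw = "expo (YVar w)"
  define q where "q = c {XVar w, YVar v}"
  have q: "coef q (?xu + ?yw) = 0"
  proof -
    have "0 = coef (z {XVar w}) (?xu + ?yv + ?yw)" unfolding z_def by simp
    also have "\<dots> = (\<Sum>b\<in>{YVar v, XVar u, YVar w}.
        coef (koszul_sign ord b {XVar w} (indet b * c {XVar w, b})) (?xu + ?yv + ?yw))"
      unfolding zc[of "XVar w", simplified, OF V(3)]
      by (rule coef_koszul_bd_singleton[OF finA]) (use V in \<open>auto simp: supp_add_nat\<close>)
    also have "\<dots> = coef (koszul_sign ord (YVar v) {XVar w} (indet (YVar v) * q)) (?xu + ?yv + ?yw)"
    proof -
      \<comment> \<open>Dividing by x_u leaves y_v y_w, dividing by y_w leaves x_u y_v; the first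
        has two variables of one kind and the second belongs to a nonedge, so neither occurs in the
        ideal.\<close>
      have "coef (indet (XVar u) * c {XVar w, XVar u}) (?yv + ?yw + ?xu) = 0"
        unfolding coef_indet_mult using V by (intro coef_same_type(2)[OF cJ]) auto
      moreover have "coef (indet (YVar w) * c {XVar w, YVar w}) (?xu + ?yv + ?yw) = 0"
        unfolding coef_indet_mult using V nonedge by (intro coef_nonedge[OF cJ]) auto
      ultimately show ?thesis
        using V by (simp add: sign q_def ac_simps)
    qed
    finally have "coef (koszul_sign ord (YVar v) {XVar w} (indet (YVar v) * q)) (?xu + ?yw + ?yv) = 0"
      by (simp add: ac_simps)
    then show ?thesis unfolding koszul_sign_def by (simp split: if_splits)
  qed
  have "coef (z {YVar v}) (?xu + ?yw + ?xw) = 1"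
  proof -
    have "coef (z {YVar v}) (?xu + ?yw + ?xw) = coef f (?xu + ?yw)" unfolding z_def by simp
    also have "\<dots> = 1" using V unfolding f_def coef_edge_binomial by auto
    finally show ?thesis .
  qed
  moreover have "coef (z {YVar v}) (?xu + ?yw + ?xw) = (\<Sum>b\<in>{XVar w, XVar u, YVar w}.
      coef (koszul_sign ord b {YVar v} (indet b * c {YVar v, b})) (?xu + ?yw + ?xw))"
    unfolding zc[of "YVar v", simplified, OF V(2)]
    by (rule coef_koszul_bd_singleton[OF finA]) (use V in \<open>auto simp: supp_add_nat\<close>)
  \<comment> \<open>Dividing by x_w leaves x_u y_w, excluded by \<open>q\<close>; by x_u it leaves
    x_w y_w, and by y_w it leaves x_u x_w, which occur in no element of the ideal. So the
    coefficient 1 would have to be 0.\<close>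
  moreover have "coef (indet (XVar w) * c {YVar v, XVar w}) (?xu + ?yw + ?xw) = 0"
    unfolding coef_indet_mult using q by (simp add: q_def insert_commute)
  moreover have "{w, w} \<notin> E" using simple_graph_edges(2)[OF G, of w w] by blast
  then have "coef (indet (XVar u) * c {YVar v, XVar u}) (?xw + ?yw + ?xu) = 0"
    unfolding coef_indet_mult using V by (intro coef_nonedge[OF cJ]) auto
  moreover have "coef (indet (YVar w) * c {YVar v, YVar w}) (?xu + ?xw + ?yw) = 0"
    unfolding coef_indet_mult using V by (intro coef_same_type(1)[OF cJ]) auto
  ultimately show False
    using V by (simp add: sign ac_simps)
qed


section \<open>The regularity of a join\<close>

text \<open>Each bound \<open>r\<close> becomes the bound r - 1 for the quotient of the complete
  ideal. The vanishing criterion holds for any injective order, so one block order, restricted to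
  each side, serves all three graphs.\<close>

lemma bei_reg_join_le_iff:
  fixes K :: "'k::field itself" and V1 V2 :: "'v set"
  assumes G1: "fin_simple_graph V1 E1" and G2: "fin_simple_graph V2 E2" and V: "V1 \<inter> V2 = {}"
    and r: "r \<ge> 3"
  shows "bei_reg K (V1 \<union> V2) (join_edges V1 E1 V2 E2) \<le> r \<longleftrightarrow> bei_reg K V1 E1 \<le> r \<and> bei_reg K V2 E2 \<le> r"
proof -
  have fin: "finite V1" "finite V2" using G1 G2 unfolding fin_simple_graph_def by auto
  have disjoint: "bei_vars V1 \<inter> bei_vars V2 = {}" using V unfolding bei_vars_def by auto
  obtain ord :: "'v bvar \<Rightarrow> nat" where ord: "inj_on ord (bei_vars (V1 \<union> V2))"
      "\<And>a b. a \<in> bei_vars V1 \<Longrightarrow> b \<in> bei_vars V2 \<Longrightarrow> ord a < ord b"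
    using block_order_exists[OF finite_bei_vars[OF fin(1)] finite_bei_vars[OF fin(2)] disjoint]
    unfolding bei_vars_Un by blast
  have reg: "bei_reg K W E \<le> r \<longleftrightarrow> (\<forall>i j. j > r - 1 + i \<longrightarrow> poly_vanishes (bei_vars W) ord
      (binomial_edge_ideal W (complete_edges W) :: ('v bvar, 'k) mpoly set) (binomial_edge_ideal W E) i j)"
    if W: "fin_simple_graph W E" "W \<subseteq> V1 \<union> V2" for W E
  proof -
    have "bei_vars W \<subseteq> bei_vars (V1 \<union> V2)" using W(2) unfolding bei_vars_def by blast
    then have ordW: "inj_on ord (bei_vars W)" using ord(1) inj_on_subset by blast
    interpret complete_bei W ord K
      using W ordW unfolding fin_simple_graph_def by unfold_locales (auto simp: finite_bei_vars)
    show ?thesis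
      using bei_reg_le_iff[OF W(1) ordW, of r K] regularity_quotient_iff[OF simple_graph_edges(1)[OF W(1)] r] r
      by simp
  qed
  show ?thesis
    unfolding reg[OF fin_simple_graph_join[OF G1 G2 V] subset_refl] reg[OF G1 Un_upper1] reg[OF G2 Un_upper2]
    by (rule vanishes_join_quotient_iff[OF G1 G2 V ord])
qed

text \<open>A nonadjacent pair in \<open>V1\<close> and any vertex of \<open>V2\<close> form an
  induced path, whose syzygy sits at i = 1 and j = 4, beyond 2 + 1.\<close>

lemma bei_reg_join_gt:
  fixes K :: "'k::field itself" and V1 V2 :: "'v set"
  assumes G1: "fin_simple_graph V1 E1" and G2: "fin_simple_graph V2 E2"
    and V: "V1 \<inter> V2 = {}" "V2 \<noteq> {}" and incomplete: "\<not> complete_graph V1 E1"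
  shows "bei_reg K (V1 \<union> V2) (join_edges V1 E1 V2 E2) > 2"
proof -
  let ?E = "join_edges V1 E1 V2 E2"
  obtain u v where uv: "u \<in> V1" "v \<in> V1" "u \<noteq> v" "{u, v} \<notin> E1"
    using incomplete unfolding complete_graph_def by blast
  obtain w where w: "w \<in> V2" using V(2) by blast
  have E: "{u, w} \<in> ?E" "{w, v} \<in> ?E"
    using uv w unfolding join_edges_def by (auto simp: insert_commute)
  have "{u, v} \<notin> ?E" using edges_subset_join[OF G1 G2 V(1), of "{u, v}"] uv by auto
  moreover have G: "fin_simple_graph (V1 \<union> V2) ?E" by (rule fin_simple_graph_join[OF G1 G2 V(1)])
  moreover have "finite (bei_vars (V1 \<union> V2))"
    using G unfolding fin_simple_graph_def by (blast intro: finite_bei_vars)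
  then obtain ord :: "'v bvar \<Rightarrow> nat" where ord: "inj_on ord (bei_vars (V1 \<union> V2))"
    using finite_imp_inj_to_nat_seg by blast
  ultimately have "\<not> poly_vanishes (bei_vars (V1 \<union> V2)) ord
      (binomial_edge_ideal (V1 \<union> V2) ?E :: ('v bvar, 'k) mpoly set) {0} 1 4"
    using uv(3) by (intro not_vanishes_induced_path[OF _ _ E]) auto
  then have "\<not> bei_reg K (V1 \<union> V2) ?E \<le> 2"
    unfolding bei_reg_le_iff[OF G ord, of 2 K, simplified] by force
  then show ?thesis by simp
qed

theorem theorem3p19:
  fixes K :: "'k::field itself"
    and V1 V2 :: "'v set" and E1 E2 :: "'v set set"
  assumes "fin_simple_graph V1 E1" and "fin_simple_graph V2 E2"
    and "V1 \<noteq> {}" and "V2 \<noteq> {}" and "V1 \<inter> V2 = {}"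
    and "\<not> (complete_graph V1 E1 \<and> complete_graph V2 E2)"
  shows "bei_reg K (V1 \<union> V2) (join_edges V1 E1 V2 E2)
    = Max {bei_reg K V1 E1, bei_reg K V2 E2, 3}"
proof (rule antisym)
  let ?R = "bei_reg K (V1 \<union> V2) (join_edges V1 E1 V2 E2)"
  let ?m = "Max {bei_reg K V1 E1, bei_reg K V2 E2, 3}"
  note le_iff = bei_reg_join_le_iff[OF assms(1,2,5), of _ K]
  have m: "bei_reg K V1 E1 \<le> ?m" "bei_reg K V2 E2 \<le> ?m" "3 \<le> ?m" by simp_all
  show "?R \<le> ?m" using le_iff[OF m(3)] m(1,2) by blast
  have V: "V2 \<inter> V1 = {}" using assms(5) by blast
  have "?R > 2"
  proof (cases "complete_graph V1 E1")
    case False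
    then show ?thesis using bei_reg_join_gt[OF assms(1,2,5,4)] by blast
  next
    case True
    then have "bei_reg K (V2 \<union> V1) (join_edges V2 E2 V1 E1) > 2"
      using bei_reg_join_gt[OF assms(2,1) V assms(3)] assms(6) by blast
    then show ?thesis by (simp add: Un_commute join_edges_commute[of V2 E2])
  qed
  \<comment> \<open>The regularity of the join is at least 3 and so is itself an admissible
    \<open>r\<close>.\<close>
  then show "?m \<le> ?R" using le_iff[of ?R] by simp
qed

end
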